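(* In the setting of the context ($\pi\colon E\to I$ a fibred site, $X$ a $\mathbb U$-site, $\Psi^+\colon E\to X$ a continuous left exact functor, $\Psi\colon\widetilde X\to\widetilde E$, $\Psi_i\colon \widetilde X_{/u^*(i)}\to\widetilde E_i$, $\beta\colon\widetilde E\to\widetilde E_\iota$ the associated morphisms of topoi), suppose that for every $i\in\mathrm{Ob}(I)$ the adjunction morphism $\mathrm{id}\to\Psi_{i*}\Psi_i^*$ is an isomorphism. Then: (i) for every sheaf $F$ of $\widetilde E_\iota$, $\beta^*(F)$ is the sheaf on $E$ defined by $\{i\mapsto f_i^*F\}$; (ii) the adjunction morphism $\mathrm{id}\to\beta_*\beta^*$ is an isomorphism; (iii) the adjunction morphism $\beta^*\to\Psi_*\Psi_\iota^*$ is an isomorphism.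
   Context: Fix a universe $\mathbb U$ containing an element of infinite cardinality; sheaves are of $\mathbb U$-sets. Let $I$ be a $\mathbb U$-site and $\pi\colon E\to I$ a cleaved and normalized fibred category over the category underlying $I$, such that: (i) finite limits are representable in $I$; (ii) each fibre category $E_i$ carries a topology making it a $\mathbb U$-site, and finite limits are representable in $E_i$ ($\widetilde E_i$ is the topos of sheaves on $E_i$); (iii) for every morphism $f\colon i\to j$ of $I$, the inverse image functor $f^+\colon E_j\to E_i$ is continuous and left exact, hence defines a morphism of topoi $f\colon\widetilde E_i\to\widetilde E_j$ with $f_*(G)=G\circ f^+$. The co-evanescent topology on $E$ is generated by the families $(V_n\to V)_{n\in\Sigma}$ of two types: (v) covering families of some fibre $E_i$; (c) families for which there is a covering family $(f_n\colon i_n\to i)_{n\in\Sigma}$ of $I$, with $i=\pi(V)$, such that $V_n\simeq f_n^+(V)$ for all $n$ (with $V_n\to V$ the canonical morphism). $\widetilde E$ is the topos of sheaves on $E$. A presheaf $F$ on $E$ is written $\{i\mapsto F_i\}$, with $F_i=F|_{E_i}$ and transition morphisms $F_j\to f_*(F_i)$ for $f\colon i\to j$. Fix a final object $\iota$ of $I$ and a final object $e$ of $E_\iota$; for $i\in\mathrm{Ob}(I)$ let $f_i\colon i\to\iota$ be the canonical morphism. The inclusion $E_\iota\to E$ is continuous and left exact and defines $\beta\colon\widetilde E\to\widetilde E_\iota$, with $\beta_*(\{i\mapsto F_i\})=F_\iota$. The functor $\sigma^+\colon I\to E$, $i\mapsto f_i^+(e)$ (the cartesian section of $\pi$ with $\sigma^+(\iota)=e$)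 is continuous and left exact; $\sigma^+(i)$ is a final object of $E_i$. It defines $\sigma\colon\widetilde E\to\widetilde I$. Let $X$ be a $\mathbb U$-site and $\Psi^+\colon E\to X$ a continuous left exact functor; $\widetilde X$ is the topos of sheaves on $X$, $\Psi\colon\widetilde X\to\widetilde E$ the associated morphism of topoi, $u^+=\Psi^+\circ\sigma^+\colon I\to X$ and $u=\sigma\Psi\colon\widetilde X\to\widetilde I$. For $i\in\mathrm{Ob}(I)$, $\Psi^+$ induces a functor $\Psi_i^+\colon E_i\to X_{/u^+(i)}$, which is left exact and continuous for the induced topology on $X_{/u^+(i)}$; it defines $\Psi_i\colon\widetilde X_{/u^*(i)}\to\widetilde E_i$. In particular $\Psi_\iota=\beta\Psi\colon\widetilde X\to\widetilde E_\iota$, and the morphism in (iii) is adjoint to the isomorphism $\Psi^*\beta^*= \Psi_\iota^*$. In (i), for $f\colon j\to i$ in $I$, the transition morphism $f_i^*F\to f_*(f_j^*F)$ of $\{i\mapsto f_i^*F\}$ is the adjoint of the canonical isomorphism $f^*(f_i^*F)\simeq f_j^*F$. *)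

theory Defs
  imports "HOL-Library.FuncSet"
begin

section \<open>Universes\<close>

text \<open>
  The universe is the type \<open>'u\<close>; \<open>U x\<close> is the set of elements of the universe member \<open>x\<close>, so that
  a \<open>\<bbbU>\<close>-set is a term of type \<open>'u\<close>. Transitivity of the universe is built into the type of \<open>U\<close>. The
  last clause is the existence of a member of infinite cardinality.
\<close>

definition universe :: "('u \<Rightarrow> 'u set) \<Rightarrow> bool" where
  "universe U \<longleftrightarrow>
     inj U \<and>
     (\<forall>x y. \<exists>z. U z = {x, y}) \<and>
     (\<forall>x. \<exists>p. U ` U p = Pow (U x)) \<and>
     (\<forall>x. \<forall>f :: 'u \<Rightarrow> 'u. \<exists>z. U z = (\<Union>i\<in>U x. U (f i))) \<and>
     (\<exists>x. infinite (U x))"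

definition small :: "('u \<Rightarrow> 'u set) \<Rightarrow> 'a set \<Rightarrow> bool" where
  "small U A \<longleftrightarrow> (\<exists>x h. bij_betw h A (U x))"


section \<open>Categories and finite limits\<close>

record ('o, 'a) cat =
  Obj :: "'o set"
  Arr :: "'a set"
  Dom :: "'a \<Rightarrow> 'o"
  Cod :: "'a \<Rightarrow> 'o"
  Ide :: "'o \<Rightarrow> 'a"
  Cmp :: "'a \<Rightarrow> 'a \<Rightarrow> 'a"  \<comment> \<open>\<open>Cmp C g f\<close> is \<open>g\<close> after \<open>f\<close>\<close>

record ('o, 'a, 'p, 'b) fctr =
  fobj :: "'o \<Rightarrow> 'p"
  farr :: "'a \<Rightarrow> 'b"

definition hom :: "('o, 'a, 'z) cat_scheme \<Rightarrow> 'o \<Rightarrow> 'o \<Rightarrow> 'a set" where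
  "hom C a b = {f \<in> Arr C. Dom C f = a \<and> Cod C f = b}"

definition category :: "('o, 'a, 'z) cat_scheme \<Rightarrow> bool" where
  "category C \<longleftrightarrow>
     (\<forall>f\<in>Arr C. Dom C f \<in> Obj C \<and> Cod C f \<in> Obj C) \<and>
     (\<forall>c\<in>Obj C. Ide C c \<in> hom C c c) \<and>
     (\<forall>f\<in>Arr C. \<forall>g\<in>Arr C. Dom C g = Cod C f \<longrightarrow> Cmp C g f \<in> hom C (Dom C f) (Cod C g)) \<and>
     (\<forall>f\<in>Arr C. Cmp C f (Ide C (Dom C f)) = f \<and> Cmp C (Ide C (Cod C f)) f = f) \<and>
     (\<forall>f\<in>Arr C. \<forall>g\<in>Arr C. \<forall>h\<in>Arr C. Dom C g = Cod C f \<and> Dom C h = Cod C g \<longrightarrow>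
        Cmp C h (Cmp C g f) = Cmp C (Cmp C h g) f)"

definition is_functor ::
    "('o, 'a, 'z) cat_scheme \<Rightarrow> ('p, 'b, 'y) cat_scheme \<Rightarrow> ('o, 'a, 'p, 'b) fctr \<Rightarrow> bool" where
  "is_functor C D u \<longleftrightarrow>
     (\<forall>c\<in>Obj C. fobj u c \<in> Obj D \<and> farr u (Ide C c) = Ide D (fobj u c)) \<and>
     (\<forall>f\<in>Arr C. farr u f \<in> hom D (fobj u (Dom C f)) (fobj u (Cod C f))) \<and>
     (\<forall>f\<in>Arr C. \<forall>g\<in>Arr C. Dom C g = Cod C f \<longrightarrow>
        farr u (Cmp C g f) = Cmp D (farr u g) (farr u f))"

definition fcomp :: "('p, 'b, 'q, 'c) fctr \<Rightarrow> ('o, 'a, 'p, 'b) fctr \<Rightarrow> ('o, 'a, 'q, 'c) fctr" where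
  "fcomp v u = \<lparr>fobj = (\<lambda>c. fobj v (fobj u c)), farr = (\<lambda>f. farr v (farr u f))\<rparr>"

definition final_obj :: "('o, 'a, 'z) cat_scheme \<Rightarrow> 'o \<Rightarrow> bool" where
  "final_obj C t \<longleftrightarrow> t \<in> Obj C \<and> (\<forall>c\<in>Obj C. \<exists>!f. f \<in> hom C c t)"

definition to_final :: "('o, 'a, 'z) cat_scheme \<Rightarrow> 'o \<Rightarrow> 'o \<Rightarrow> 'a" where
  "to_final C t c = (THE f. f \<in> hom C c t)"

definition is_cone ::
    "('j, 'k, 'y) cat_scheme \<Rightarrow> ('o, 'a, 'z) cat_scheme \<Rightarrow> ('j, 'k, 'o, 'a) fctr \<Rightarrow>
     'o \<Rightarrow> ('j \<Rightarrow> 'a) \<Rightarrow> bool" where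
  "is_cone J C D l p \<longleftrightarrow>
     l \<in> Obj C \<and>
     (\<forall>j\<in>Obj J. p j \<in> hom C l (fobj D j)) \<and>
     (\<forall>k\<in>Arr J. Cmp C (farr D k) (p (Dom J k)) = p (Cod J k))"

definition is_limit ::
    "('j, 'k, 'y) cat_scheme \<Rightarrow> ('o, 'a, 'z) cat_scheme \<Rightarrow> ('j, 'k, 'o, 'a) fctr \<Rightarrow>
     'o \<Rightarrow> ('j \<Rightarrow> 'a) \<Rightarrow> bool" where
  "is_limit J C D l p \<longleftrightarrow>
     is_cone J C D l p \<and>
     (\<forall>c q. is_cone J C D c q \<longrightarrow>
        (\<exists>!h. h \<in> hom C c l \<and> (\<forall>j\<in>Obj J. Cmp C (p j) h = q j)))"

text \<open>Every finite category is isomorphic to one whose objects and arrows are natural numbers.\<close>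

definition finite_category :: "(nat, nat) cat \<Rightarrow> bool" where
  "finite_category J \<longleftrightarrow> category J \<and> finite (Obj J) \<and> finite (Arr J)"

definition has_finite_limits :: "('o, 'a, 'z) cat_scheme \<Rightarrow> bool" where
  "has_finite_limits C \<longleftrightarrow>
     (\<forall>J D. finite_category J \<and> is_functor J C D \<longrightarrow> (\<exists>l p. is_limit J C D l p))"

definition left_exact ::
    "('o, 'a, 'z) cat_scheme \<Rightarrow> ('p, 'b, 'y) cat_scheme \<Rightarrow> ('o, 'a, 'p, 'b) fctr \<Rightarrow> bool" where
  "left_exact C D u \<longleftrightarrow>
     (\<forall>J G l p. finite_category J \<and> is_functor J C G \<and> is_limit J C G l p \<longrightarrow>
        is_limit J D (fcomp u G) (fobj u l) (\<lambda>j. farr u (p j)))"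


section \<open>Sites\<close>

text \<open>A topology is given by its covering sieves; a sieve on \<open>c\<close> is a set of arrows with target \<open>c\<close>.\<close>

record ('o, 'a) site = "('o, 'a) cat" +
  Cov :: "'o \<Rightarrow> 'a set set"

definition arrows_to :: "('o, 'a, 'z) cat_scheme \<Rightarrow> 'o \<Rightarrow> 'a set" where
  "arrows_to C c = {f \<in> Arr C. Cod C f = c}"

definition sieve :: "('o, 'a, 'z) cat_scheme \<Rightarrow> 'o \<Rightarrow> 'a set \<Rightarrow> bool" where
  "sieve C c S \<longleftrightarrow> S \<subseteq> arrows_to C c \<and> (\<forall>f\<in>S. \<forall>g\<in>arrows_to C (Dom C f). Cmp C f g \<in> S)"

definition generated_sieve :: "('o, 'a, 'z) cat_scheme \<Rightarrow> 'a set \<Rightarrow> 'a set" where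
  "generated_sieve C A = {Cmp C f g | f g. f \<in> A \<and> g \<in> arrows_to C (Dom C f)}"

definition pullback_sieve :: "('o, 'a, 'z) cat_scheme \<Rightarrow> 'a \<Rightarrow> 'a set \<Rightarrow> 'a set" where
  "pullback_sieve C f S = {g \<in> arrows_to C (Dom C f). Cmp C f g \<in> S}"

definition topology :: "('o, 'a, 'z) cat_scheme \<Rightarrow> ('o \<Rightarrow> 'a set set) \<Rightarrow> bool" where
  "topology C J \<longleftrightarrow>
     (\<forall>c\<in>Obj C.
        (\<forall>S\<in>J c. sieve C c S) \<and>
        arrows_to C c \<in> J c \<and>
        (\<forall>S\<in>J c. \<forall>f\<in>arrows_to C c. pullback_sieve C f S \<in> J (Dom C f)) \<and>
        (\<forall>S\<in>J c. \<forall>R. sieve C c R \<and> (\<forall>f\<in>S. pullback_sieve C f R \<in> J (Dom C f)) \<longrightarrow> R \<in> J c))"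

definition covering_family :: "('o, 'a, 'z) site_scheme \<Rightarrow> 'o \<Rightarrow> 'a set \<Rightarrow> bool" where
  "covering_family C c A \<longleftrightarrow> A \<subseteq> arrows_to C c \<and> generated_sieve C A \<in> Cov C c"

text \<open>
  The topology generated by a set of families (pairs of an object and a set of arrows towards it) is
  the coarsest one for which all of them are covering.
\<close>

definition generated_topology ::
    "('o, 'a, 'z) cat_scheme \<Rightarrow> ('o \<times> 'a set) set \<Rightarrow> 'o \<Rightarrow> 'a set set" where
  "generated_topology C \<G> c =
     {S. sieve C c S \<and>
         (\<forall>J. topology C J \<and> (\<forall>(d, A)\<in>\<G>. generated_sieve C A \<in> J d) \<longrightarrow> S \<in> J c)}"

text \<open>
  A \<open>\<bbbU>\<close>-site has small sets of morphisms and a small topologically generating family \<open>G\<close>: every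
  object is covered by the morphisms towards it whose source belongs to \<open>G\<close>.
\<close>

definition U_site :: "('u \<Rightarrow> 'u set) \<Rightarrow> ('o, 'a, 'z) site_scheme \<Rightarrow> bool" where
  "U_site U C \<longleftrightarrow>
     category C \<and> topology C (Cov C) \<and>
     (\<forall>a\<in>Obj C. \<forall>b\<in>Obj C. small U (hom C a b)) \<and>
     (\<exists>G\<subseteq>Obj C. small U G \<and> (\<forall>c\<in>Obj C. covering_family C c {f \<in> arrows_to C c. Dom C f \<in> G}))"

text \<open>
  The slice over \<open>x\<close>: objects are arrows \<open>p\<close> with target \<open>x\<close>; \<open>(p, k, q)\<close> is the morphism from \<open>p\<close> to
  \<open>q\<close> given by \<open>k\<close>. It carries the topology induced by the forgetful functor to \<open>C\<close>: a sieve is covering iff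
  its image (again a sieve) is.
\<close>

definition slice :: "('o, 'a, 'z) site_scheme \<Rightarrow> 'o \<Rightarrow> ('a, 'a \<times> 'a \<times> 'a) site" where
  "slice C x =
     \<lparr>Obj = arrows_to C x,
      Arr = {(p, k, q). p \<in> arrows_to C x \<and> q \<in> arrows_to C x \<and>
               k \<in> hom C (Dom C p) (Dom C q) \<and> Cmp C q k = p},
      Dom = (\<lambda>(p, k, q). p),
      Cod = (\<lambda>(p, k, q). q),
      Ide = (\<lambda>p. (p, Ide C (Dom C p), p)),
      Cmp = (\<lambda>(p', k', q') (p, k, q). (p, Cmp C k' k, q')),
      Cov = (\<lambda>q. {S. S \<subseteq> {(p, k, q'). p \<in> arrows_to C x \<and> q' = q \<and>
                                     k \<in> hom C (Dom C p) (Dom C q) \<and> Cmp C q k = p} \<and>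
                     (\<lambda>(p, k, q'). k) ` S \<in> Cov C (Dom C q)})\<rparr>"


section \<open>Presheaves and sheaves of \<open>\<bbbU>\<close>-sets\<close>

record ('o, 'a, 'u) psh =
  Sec :: "'o \<Rightarrow> 'u"
  Res :: "'a \<Rightarrow> 'u \<Rightarrow> 'u"

definition presheaf ::
    "('u \<Rightarrow> 'u set) \<Rightarrow> ('o, 'a, 'z) cat_scheme \<Rightarrow> ('o, 'a, 'u) psh \<Rightarrow> bool" where
  "presheaf U C F \<longleftrightarrow>
     (\<forall>f\<in>Arr C. Res F f \<in> U (Sec F (Cod C f)) \<rightarrow> U (Sec F (Dom C f))) \<and>
     (\<forall>c\<in>Obj C. \<forall>s\<in>U (Sec F c). Res F (Ide C c) s = s) \<and>
     (\<forall>f\<in>Arr C. \<forall>g\<in>Arr C. Dom C g = Cod C f \<longrightarrow>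
        (\<forall>s\<in>U (Sec F (Cod C g)). Res F (Cmp C g f) s = Res F f (Res F g s)))"

definition sheaf ::
    "('u \<Rightarrow> 'u set) \<Rightarrow> ('o, 'a, 'z) site_scheme \<Rightarrow> ('o, 'a, 'u) psh \<Rightarrow> bool" where
  "sheaf U C F \<longleftrightarrow>
     presheaf U C F \<and>
     (\<forall>c\<in>Obj C. \<forall>S\<in>Cov C c. \<forall>s.
        (\<forall>f\<in>S. s f \<in> U (Sec F (Dom C f))) \<and>
        (\<forall>f\<in>S. \<forall>g\<in>arrows_to C (Dom C f). Res F g (s f) = s (Cmp C f g)) \<longrightarrow>
        (\<exists>!t. t \<in> U (Sec F c) \<and> (\<forall>f\<in>S. Res F f t = s f)))"

text \<open>
  Components of morphisms are extensional, so that equality of morphisms is equality in HOL.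
\<close>

definition pmor ::
    "('u \<Rightarrow> 'u set) \<Rightarrow> ('o, 'a, 'z) cat_scheme \<Rightarrow> ('o, 'a, 'u) psh \<Rightarrow> ('o, 'a, 'u) psh \<Rightarrow>
     ('o \<Rightarrow> 'u \<Rightarrow> 'u) set" where
  "pmor U C F G =
     {m \<in> (\<Pi>\<^sub>E c\<in>Obj C. U (Sec F c) \<rightarrow>\<^sub>E U (Sec G c)).
        \<forall>f\<in>Arr C. \<forall>s\<in>U (Sec F (Cod C f)). m (Dom C f) (Res F f s) = Res G f (m (Cod C f) s)}"

text \<open>In \<open>pcomp U C F n m\<close> (\<open>n\<close> after \<open>m\<close>), \<open>F\<close> is the source of \<open>m\<close>.\<close>

definition pcomp ::
    "('u \<Rightarrow> 'u set) \<Rightarrow> ('o, 'a, 'z) cat_scheme \<Rightarrow> ('o, 'a, 'u) psh \<Rightarrow>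
     ('o \<Rightarrow> 'u \<Rightarrow> 'u) \<Rightarrow> ('o \<Rightarrow> 'u \<Rightarrow> 'u) \<Rightarrow> 'o \<Rightarrow> 'u \<Rightarrow> 'u" where
  "pcomp U C F n m = (\<lambda>c\<in>Obj C. \<lambda>s\<in>U (Sec F c). n c (m c s))"

definition pid ::
    "('u \<Rightarrow> 'u set) \<Rightarrow> ('o, 'a, 'z) cat_scheme \<Rightarrow> ('o, 'a, 'u) psh \<Rightarrow> 'o \<Rightarrow> 'u \<Rightarrow> 'u" where
  "pid U C F = (\<lambda>c\<in>Obj C. \<lambda>s\<in>U (Sec F c). s)"

definition piso ::
    "('u \<Rightarrow> 'u set) \<Rightarrow> ('o, 'a, 'z) cat_scheme \<Rightarrow> ('o, 'a, 'u) psh \<Rightarrow> ('o, 'a, 'u) psh \<Rightarrow>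
     ('o \<Rightarrow> 'u \<Rightarrow> 'u) \<Rightarrow> bool" where
  "piso U C F G m \<longleftrightarrow>
     m \<in> pmor U C F G \<and>
     (\<exists>n\<in>pmor U C G F. pcomp U C F n m = pid U C F \<and> pcomp U C G m n = pid U C G)"


section \<open>Morphisms of topoi defined by continuous functors\<close>

text \<open>For \<open>u\<close> from \<open>C\<close> to \<open>D\<close>, \<open>direct u\<close> and \<open>direct_mor C u\<close> are the functor \<open>G \<mapsto> G \<circ> u\<close>.\<close>

definition direct :: "('o, 'a, 'p, 'b) fctr \<Rightarrow> ('p, 'b, 'u) psh \<Rightarrow> ('o, 'a, 'u) psh" where
  "direct u G = \<lparr>Sec = (\<lambda>c. Sec G (fobj u c)), Res = (\<lambda>f. Res G (farr u f))\<rparr>"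

definition direct_mor ::
    "('o, 'a, 'z) cat_scheme \<Rightarrow> ('o, 'a, 'p, 'b) fctr \<Rightarrow> ('p \<Rightarrow> 'u \<Rightarrow> 'u) \<Rightarrow> 'o \<Rightarrow> 'u \<Rightarrow> 'u" where
  "direct_mor C u n = (\<lambda>c\<in>Obj C. n (fobj u c))"

definition continuous_functor ::
    "('u \<Rightarrow> 'u set) \<Rightarrow> ('o, 'a, 'z) site_scheme \<Rightarrow> ('p, 'b, 'y) site_scheme \<Rightarrow>
     ('o, 'a, 'p, 'b) fctr \<Rightarrow> bool" where
  "continuous_functor U C D u \<longleftrightarrow>
     is_functor C D u \<and> (\<forall>G. sheaf U D G \<longrightarrow> sheaf U C (direct u G))"

text \<open>
  An inverse image functor is a left adjoint of the direct image functor on sheaves, given by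
  universal arrows: \<open>star\<close> is its object part and \<open>adj F\<close> the adjunction morphism from \<open>F\<close> to the
  direct image of \<open>star F\<close>. It is unique up to a unique isomorphism compatible with \<open>adj\<close>.
\<close>

record ('o, 'a, 'p, 'b, 'u) inv_im =
  star :: "('o, 'a, 'u) psh \<Rightarrow> ('p, 'b, 'u) psh"
  adj :: "('o, 'a, 'u) psh \<Rightarrow> 'o \<Rightarrow> 'u \<Rightarrow> 'u"

definition inverse_image ::
    "('u \<Rightarrow> 'u set) \<Rightarrow> ('o, 'a, 'z) site_scheme \<Rightarrow> ('p, 'b, 'y) site_scheme \<Rightarrow>
     ('o, 'a, 'p, 'b) fctr \<Rightarrow> ('o, 'a, 'p, 'b, 'u) inv_im \<Rightarrow> bool" where
  "inverse_image U C D u L \<longleftrightarrow>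
     (\<forall>F. sheaf U C F \<longrightarrow>
        sheaf U D (star L F) \<and>
        adj L F \<in> pmor U C F (direct u (star L F)) \<and>
        (\<forall>G. sheaf U D G \<longrightarrow> (\<forall>m\<in>pmor U C F (direct u G).
           \<exists>!n. n \<in> pmor U D (star L F) G \<and> pcomp U C F (direct_mor C u n) (adj L F) = m)))"

text \<open>
  Let \<open>u: A \<rightarrow> B\<close>, \<open>v: B \<rightarrow> C\<close>, \<open>w: A \<rightarrow> C\<close> be functors with inverse images \<open>Lu\<close>, \<open>Lv\<close>, \<open>Lw\<close>, and
  let \<open>\<rho> a: v (u a) \<rightarrow> w a\<close> be a natural isomorphism, so that composition with \<open>\<rho>\<close> identifies the
  direct image under \<open>w\<close> with the composite of those under \<open>v\<close> and \<open>u\<close>. Then \<open>canonical_iso\<close> is the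
  corresponding isomorphism of left adjoints, from \<open>star Lv (star Lu F)\<close> to \<open>star Lw F\<close>.
\<close>

definition canonical_iso ::
    "('u \<Rightarrow> 'u set) \<Rightarrow> ('o, 'a, 'z) site_scheme \<Rightarrow> ('q, 'c, 'x) site_scheme \<Rightarrow>
     ('o, 'a, 'p, 'b) fctr \<Rightarrow> ('p, 'b, 'q, 'c) fctr \<Rightarrow>
     ('o, 'a, 'p, 'b, 'u) inv_im \<Rightarrow> ('p, 'b, 'q, 'c, 'u) inv_im \<Rightarrow> ('o, 'a, 'q, 'c, 'u) inv_im \<Rightarrow>
     ('o \<Rightarrow> 'c) \<Rightarrow> ('o, 'a, 'u) psh \<Rightarrow> 'q \<Rightarrow> 'u \<Rightarrow> 'u" where
  "canonical_iso U A C u v Lu Lv Lw \<rho> F =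
     (THE n. n \<in> pmor U C (star Lv (star Lu F)) (star Lw F) \<and>
        pcomp U A F (direct_mor A (fcomp v u) n)
          (pcomp U A F (direct_mor A u (adj Lv (star Lu F))) (adj Lu F)) =
        pcomp U A F (\<lambda>a. Res (star Lw F) (\<rho> a)) (adj Lw F))"


section \<open>Fibred sites\<close>

text \<open>
  \<open>tot\<close> is the category \<open>E\<close>, \<open>base\<close> the site \<open>I\<close>, \<open>proj\<close> the functor \<open>\<pi>\<close>, \<open>lift f V\<close> the chosen
  cartesian morphism over \<open>f\<close> with target \<open>V\<close>, and \<open>fcov i\<close> the topology of the fibre \<open>E\<^sub>i\<close>.
\<close>

record ('o, 'a, 'i, 'f) fibred =
  tot :: "('o, 'a) cat"
  base :: "('i, 'f) site"
  proj :: "('o, 'a, 'i, 'f) fctr"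
  lift :: "'f \<Rightarrow> 'o \<Rightarrow> 'a"
  fcov :: "'i \<Rightarrow> 'o \<Rightarrow> 'a set set"

definition fibre :: "('o, 'a, 'i, 'f) fibred \<Rightarrow> 'i \<Rightarrow> ('o, 'a) site" where
  "fibre P i =
     \<lparr>Obj = {V \<in> Obj (tot P). fobj (proj P) V = i},
      Arr = {m \<in> Arr (tot P). fobj (proj P) (Dom (tot P) m) = i \<and> farr (proj P) m = Ide (base P) i},
      Dom = Dom (tot P), Cod = Cod (tot P), Ide = Ide (tot P), Cmp = Cmp (tot P),
      Cov = fcov P i\<rparr>"

definition cartesian :: "('o, 'a, 'i, 'f) fibred \<Rightarrow> 'a \<Rightarrow> bool" where
  "cartesian P m \<longleftrightarrow>
     m \<in> Arr (tot P) \<and>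
     (\<forall>n\<in>arrows_to (tot P) (Cod (tot P) m).
        \<forall>g\<in>hom (base P) (fobj (proj P) (Dom (tot P) n)) (fobj (proj P) (Dom (tot P) m)).
          farr (proj P) n = Cmp (base P) (farr (proj P) m) g \<longrightarrow>
          (\<exists>!k. k \<in> hom (tot P) (Dom (tot P) n) (Dom (tot P) m) \<and> farr (proj P) k = g \<and>
                Cmp (tot P) m k = n))"

definition inv_obj :: "('o, 'a, 'i, 'f) fibred \<Rightarrow> 'f \<Rightarrow> 'o \<Rightarrow> 'o" where
  "inv_obj P f V = Dom (tot P) (lift P f V)"

text \<open>\<open>vert P f V m\<close>: the factorisation through \<open>lift P f V\<close>, in a fibre, of a morphism \<open>m\<close> over \<open>f\<close> with target \<open>V\<close>.\<close>

definition vert :: "('o, 'a, 'i, 'f) fibred \<Rightarrow> 'f \<Rightarrow> 'o \<Rightarrow> 'a \<Rightarrow> 'a" where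
  "vert P f V m =
     (THE k. k \<in> hom (fibre P (Dom (base P) f)) (Dom (tot P) m) (inv_obj P f V) \<and>
             Cmp (tot P) (lift P f V) k = m)"

definition inv_functor :: "('o, 'a, 'i, 'f) fibred \<Rightarrow> 'f \<Rightarrow> ('o, 'a, 'o, 'a) fctr" where
  "inv_functor P f =
     \<lparr>fobj = inv_obj P f,
      farr = (\<lambda>k. vert P f (Cod (tot P) k) (Cmp (tot P) k (lift P f (Dom (tot P) k))))\<rparr>"

definition cleaved_normalized_fibration :: "('o, 'a, 'i, 'f) fibred \<Rightarrow> bool" where
  "cleaved_normalized_fibration P \<longleftrightarrow>
     category (tot P) \<and> category (base P) \<and> is_functor (tot P) (base P) (proj P) \<and>
     (\<forall>f\<in>Arr (base P). \<forall>V\<in>Obj (fibre P (Cod (base P) f)).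
        cartesian P (lift P f V) \<and> Cod (tot P) (lift P f V) = V \<and> farr (proj P) (lift P f V) = f) \<and>
     (\<forall>V\<in>Obj (tot P). lift P (Ide (base P) (fobj (proj P) V)) V = Ide (tot P) V)"

definition fibred_site :: "('u \<Rightarrow> 'u set) \<Rightarrow> ('o, 'a, 'i, 'f) fibred \<Rightarrow> bool" where
  "fibred_site U P \<longleftrightarrow>
     cleaved_normalized_fibration P \<and>
     U_site U (base P) \<and> has_finite_limits (base P) \<and>
     (\<forall>i\<in>Obj (base P). U_site U (fibre P i) \<and> has_finite_limits (fibre P i)) \<and>
     (\<forall>f\<in>Arr (base P).
        continuous_functor U (fibre P (Cod (base P) f)) (fibre P (Dom (base P) f)) (inv_functor P f) \<and>
        left_exact (fibre P (Cod (base P) f)) (fibre P (Dom (base P) f)) (inv_functor P f))"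

definition vertical_families :: "('o, 'a, 'i, 'f) fibred \<Rightarrow> ('o \<times> 'a set) set" where
  "vertical_families P =
     {(V, A). V \<in> Obj (tot P) \<and> covering_family (fibre P (fobj (proj P) V)) V A}"

text \<open>
  In a cartesian family every member is, up to an isomorphism \<open>k\<close> of its source in the fibre, a chosen
  lift of a member of a covering family of the base. Repetitions in the base family are allowed.
\<close>

definition cartesian_families :: "('o, 'a, 'i, 'f) fibred \<Rightarrow> ('o \<times> 'a set) set" where
  "cartesian_families P =
     {(V, A). V \<in> Obj (tot P) \<and> A \<subseteq> arrows_to (tot P) V \<and>
        covering_family (base P) (fobj (proj P) V) (farr (proj P) ` A) \<and>
        (\<forall>m\<in>A. let f = farr (proj P) m; Ef = fibre P (Dom (base P) f) in
           \<exists>k\<in>hom Ef (Dom (tot P) m) (inv_obj P f V).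
           \<exists>k'\<in>hom Ef (inv_obj P f V) (Dom (tot P) m).
             Cmp Ef k' k = Ide Ef (Dom (tot P) m) \<and> Cmp Ef k k' = Ide Ef (inv_obj P f V) \<and>
             m = Cmp (tot P) (lift P f V) k)}"

definition coevanescent_topology :: "('o, 'a, 'i, 'f) fibred \<Rightarrow> 'o \<Rightarrow> 'a set set" where
  "coevanescent_topology P = generated_topology (tot P) (vertical_families P \<union> cartesian_families P)"

definition coevanescent_site :: "('o, 'a, 'i, 'f) fibred \<Rightarrow> ('o, 'a) site" where
  "coevanescent_site P = cat.extend (tot P) (site.fields (coevanescent_topology P))"

text \<open>The functor from \<open>E\<^sub>\<iota>\<close> to \<open>E\<close> defining \<open>\<beta>\<close>.\<close>

definition fibre_inclusion :: "('o, 'a, 'o, 'a) fctr" where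
  "fibre_inclusion = \<lparr>fobj = (\<lambda>V. V), farr = (\<lambda>m. m)\<rparr>"

definition sigma_obj :: "('o, 'a, 'i, 'f) fibred \<Rightarrow> 'i \<Rightarrow> 'o \<Rightarrow> 'i \<Rightarrow> 'o" where
  "sigma_obj P \<iota> e i = inv_obj P (to_final (base P) \<iota> i) e"

definition u_obj ::
    "('o, 'a, 'i, 'f) fibred \<Rightarrow> ('o, 'a, 'x, 'y) fctr \<Rightarrow> 'i \<Rightarrow> 'o \<Rightarrow> 'i \<Rightarrow> 'x" where
  "u_obj P \<Psi> \<iota> e i = fobj \<Psi> (sigma_obj P \<iota> e i)"

text \<open>\<open>\<Psi>\<^sub>i\<^sup>+\<close> sends \<open>V\<close> to the image under \<open>\<Psi>\<^sup>+\<close> of the morphism from \<open>V\<close> to the final object of \<open>E\<^sub>i\<close>.\<close>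

definition Psi_at ::
    "('o, 'a, 'i, 'f) fibred \<Rightarrow> ('o, 'a, 'x, 'y) fctr \<Rightarrow> 'i \<Rightarrow> 'o \<Rightarrow> 'i \<Rightarrow>
     ('o, 'a, 'y, 'y \<times> 'y \<times> 'y) fctr" where
  "Psi_at P \<Psi> \<iota> e i =
     (let t = (\<lambda>V. farr \<Psi> (to_final (fibre P i) (sigma_obj P \<iota> e i) V))
      in \<lparr>fobj = t, farr = (\<lambda>k. (t (Dom (tot P) k), farr \<Psi> k, t (Cod (tot P) k)))\<rparr>)"


section \<open>Presheaves on the total category\<close>

text \<open>
  The presheaf \<open>{i \<mapsto> F\<^sub>i}\<close> with transition morphisms \<open>\<gamma> f: F\<^sub>i \<rightarrow> f\<^sub>*(F\<^sub>j)\<close> for \<open>f: j \<rightarrow> i\<close>: a morphism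
  \<open>m: W \<rightarrow> V\<close> of \<open>E\<close> over \<open>f\<close> acts by \<open>F\<^sub>i(V) \<rightarrow> F\<^sub>j(f\<^sup>+V) \<rightarrow> F\<^sub>j(W)\<close>.
\<close>

definition glue ::
    "('o, 'a, 'i, 'f) fibred \<Rightarrow> ('i \<Rightarrow> ('o, 'a, 'u) psh) \<Rightarrow> ('f \<Rightarrow> 'o \<Rightarrow> 'u \<Rightarrow> 'u) \<Rightarrow>
     ('o, 'a, 'u) psh" where
  "glue P Fs \<gamma> =
     \<lparr>Sec = (\<lambda>V. Sec (Fs (fobj (proj P) V)) V),
      Res = (\<lambda>m s. let f = farr (proj P) m; V = Cod (tot P) m
                   in Res (Fs (Dom (base P) f)) (vert P f V m) (\<gamma> f V s))\<rparr>"

text \<open>The canonical isomorphism \<open>f\<^sup>*(g\<^sup>*F) \<rightarrow> (gf)\<^sup>*F\<close> for composable \<open>f: j \<rightarrow> i\<close> and \<open>g: i \<rightarrow> l\<close>.\<close>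

definition inv_comp_iso ::
    "('u \<Rightarrow> 'u set) \<Rightarrow> ('o, 'a, 'i, 'f) fibred \<Rightarrow> ('f \<Rightarrow> ('o, 'a, 'o, 'a, 'u) inv_im) \<Rightarrow>
     'f \<Rightarrow> 'f \<Rightarrow> ('o, 'a, 'u) psh \<Rightarrow> 'o \<Rightarrow> 'u \<Rightarrow> 'u" where
  "inv_comp_iso U P L g f F =
     (let gf = Cmp (base P) g f in
      canonical_iso U (fibre P (Cod (base P) g)) (fibre P (Dom (base P) f))
        (inv_functor P g) (inv_functor P f) (L g) (L f) (L gf)
        (\<lambda>V. vert P gf V (Cmp (tot P) (lift P g V) (lift P f (inv_obj P g V)))) F)"

text \<open>The presheaf \<open>{i \<mapsto> f\<^sub>i\<^sup>*F}\<close>, with transition morphisms adjoint to these canonical isomorphisms.\<close>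

definition pullback_transition ::
    "('u \<Rightarrow> 'u set) \<Rightarrow> ('o, 'a, 'i, 'f) fibred \<Rightarrow> ('f \<Rightarrow> ('o, 'a, 'o, 'a, 'u) inv_im) \<Rightarrow>
     'i \<Rightarrow> ('o, 'a, 'u) psh \<Rightarrow> 'f \<Rightarrow> 'o \<Rightarrow> 'u \<Rightarrow> 'u" where
  "pullback_transition U P L \<iota> F f =
     (let Ei = fibre P (Cod (base P) f);
          fi = to_final (base P) \<iota> (Cod (base P) f);
          G = star (L fi) F
      in pcomp U Ei G (direct_mor Ei (inv_functor P f) (inv_comp_iso U P L fi f F)) (adj (L f) G))"

definition pullback_presheaf ::
    "('u \<Rightarrow> 'u set) \<Rightarrow> ('o, 'a, 'i, 'f) fibred \<Rightarrow> ('f \<Rightarrow> ('o, 'a, 'o, 'a, 'u) inv_im) \<Rightarrow>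
     'i \<Rightarrow> ('o, 'a, 'u) psh \<Rightarrow> ('o, 'a, 'u) psh" where
  "pullback_presheaf U P L \<iota> F =
     glue P (\<lambda>i. star (L (to_final (base P) \<iota> i)) F) (pullback_transition U P L \<iota> F)"

text \<open>
  The adjunct \<open>\<beta>\<^sup>*F \<rightarrow> \<Psi>\<^sub>*(\<Psi>\<^sub>\<iota>\<^sup>*F)\<close> of the canonical isomorphism \<open>\<Psi>\<^sup>*(\<beta>\<^sup>*F) \<rightarrow> \<Psi>\<^sub>\<iota>\<^sup>*F\<close>, where
  \<open>\<Psi>\<^sub>\<iota> = \<beta>\<Psi>\<close>; here \<open>\<rho>\<close> of \<open>canonical_iso\<close> is the identity.
\<close>

definition beta_Psi_mor ::
    "('u \<Rightarrow> 'u set) \<Rightarrow> ('o, 'a, 'i, 'f) fibred \<Rightarrow> ('x, 'y) site \<Rightarrow> ('o, 'a, 'x, 'y) fctr \<Rightarrow> 'i \<Rightarrow>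
     ('o, 'a, 'o, 'a, 'u) inv_im \<Rightarrow> ('o, 'a, 'x, 'y, 'u) inv_im \<Rightarrow> ('o, 'a, 'x, 'y, 'u) inv_im \<Rightarrow>
     ('o, 'a, 'u) psh \<Rightarrow> 'o \<Rightarrow> 'u \<Rightarrow> 'u" where
  "beta_Psi_mor U P X \<Psi> \<iota> L\<beta> L\<Psi> L\<Psi>\<iota> F =
     (let E = coevanescent_site P in
      pcomp U E (star L\<beta> F)
        (direct_mor E \<Psi>
           (canonical_iso U (fibre P \<iota>) X fibre_inclusion \<Psi> L\<beta> L\<Psi> L\<Psi>\<iota> (\<lambda>V. Ide X (fobj \<Psi> V)) F))
        (adj L\<Psi> (star L\<beta> F)))"

end

theory Submission
  imports Defs
begin

text \<open>
  Put \<open>G = \<Psi>\<^sub>\<iota>\<^sup>*F\<close> and \<open>H = \<Psi>\<^sub>*G\<close>, so that \<open>H\<close> is \<open>V \<mapsto> G(\<Psi>\<^sup>+V)\<close> on \<open>E\<^sub>i\<close>. Since \<open>f\<^sub>i\<^sup>+V\<close> is the product of \<open>V\<close> and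
  \<open>\<sigma>\<^sup>+(i)\<close> in \<open>E\<close>, the restriction of \<open>G\<close> to the slice over \<open>u\<^sup>+(i)\<close> and \<open>\<Psi>\<^sub>i\<^sup>*f\<^sub>i\<^sup>*F\<close> have the same universal
  property, and applying \<open>\<Psi>\<^sub>i\<^sub>*\<close> the hypothesis identifies \<open>f\<^sub>i\<^sup>*F\<close> with \<open>H\<^sub>i\<close>. A sheaf on \<open>E\<close> restricts to sheaves
  on the fibres, and compatibility with a transition morphism can be tested on \<open>F\<close> by the universal
  property of \<open>f\<^sub>i\<^sup>*F\<close>; hence \<open>H\<close> has the universal property of \<open>\<beta>\<^sup>*F\<close>. The three assertions follow from
  \<open>\<beta>\<^sup>*F = H\<close>, the second one because \<open>f\<^sub>\<iota>\<close> is the identity.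
\<close>

section \<open>Categories, presheaves and universal arrows\<close>

text \<open>Inverse images are known only through universal arrows, and each \<open>L\<close> is an
  arbitrary choice of these. Comparisons between inverse images are therefore morphisms determined
  by their values on sections coming from \<open>F\<close>, and nearly every equation is tested on
  such sections. Two obstacles shape the rest. Restriction to the slice preserves the relevant
  universal arrows because it has a right adjoint; products with an object need not exist in
  \<open>X\<close>, so this adjoint is built from families indexed by spans, and their smallness
  rests on the generating family of \<open>X\<close>. Moreover the coevanescent topology is given by
  generators, so a compatible family of a fibre has to be shown compatible in \<open>E\<close>
  before a sheaf on \<open>E\<close> can glue it; finite limits in the fibres and left exactness of
  the inverse image functors enter there. That the inverse images of \<open>F\<close> glue to a
  sheaf is not checked on coverings: the sheaf condition, and even functoriality, are read off
  \<open>H\<close> through the fibrewise isomorphisms.\<close>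

lemma hom_iff: "f \<in> hom C a b \<longleftrightarrow> f \<in> Arr C \<and> Dom C f = a \<and> Cod C f = b"
  by (auto simp: hom_def)

lemma arrows_to_iff: "f \<in> arrows_to C a \<longleftrightarrow> f \<in> Arr C \<and> Cod C f = a"
  by (auto simp: arrows_to_def)

lemma Dom_in_Obj [simp]: "category C \<Longrightarrow> f \<in> Arr C \<Longrightarrow> Dom C f \<in> Obj C"
  and Cod_in_Obj [simp]: "category C \<Longrightarrow> f \<in> Arr C \<Longrightarrow> Cod C f \<in> Obj C"
  and Ide_in_Arr [simp]: "category C \<Longrightarrow> c \<in> Obj C \<Longrightarrow> Ide C c \<in> Arr C"
  and Dom_Ide [simp]: "category C \<Longrightarrow> c \<in> Obj C \<Longrightarrow> Dom C (Ide C c) = c"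
  and Cod_Ide [simp]: "category C \<Longrightarrow> c \<in> Obj C \<Longrightarrow> Cod C (Ide C c) = c"
  by (auto simp: category_def hom_def)

lemma Ide_in_hom: "category C \<Longrightarrow> c \<in> Obj C \<Longrightarrow> Ide C c \<in> hom C c c"
  by (simp add: hom_iff)

lemma Cmp_in_Arr [simp]:
    "category C \<Longrightarrow> f \<in> Arr C \<Longrightarrow> g \<in> Arr C \<Longrightarrow> Dom C g = Cod C f \<Longrightarrow> Cmp C g f \<in> Arr C"
  and Dom_Cmp [simp]:
    "category C \<Longrightarrow> f \<in> Arr C \<Longrightarrow> g \<in> Arr C \<Longrightarrow> Dom C g = Cod C f \<Longrightarrow> Dom C (Cmp C g f) = Dom C f"
  and Cod_Cmp [simp]:
    "category C \<Longrightarrow> f \<in> Arr C \<Longrightarrow> g \<in> Arr C \<Longrightarrow> Dom C g = Cod C f \<Longrightarrow> Cod C (Cmp C g f) = Cod C g"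
  unfolding category_def hom_def by blast+

lemma Cmp_in_hom: "category C \<Longrightarrow> f \<in> hom C a b \<Longrightarrow> g \<in> hom C b c \<Longrightarrow> Cmp C g f \<in> hom C a c"
  by (simp add: hom_iff)

lemma Cmp_Ide_right [simp]: "category C \<Longrightarrow> f \<in> Arr C \<Longrightarrow> Dom C f = a \<Longrightarrow> Cmp C f (Ide C a) = f"
  and Cmp_Ide_left [simp]: "category C \<Longrightarrow> f \<in> Arr C \<Longrightarrow> Cod C f = b \<Longrightarrow> Cmp C (Ide C b) f = f"
  unfolding category_def by blast+

lemma Cmp_assoc:
  "category C \<Longrightarrow> f \<in> Arr C \<Longrightarrow> g \<in> Arr C \<Longrightarrow> h \<in> Arr C \<Longrightarrow> Dom C g = Cod C f \<Longrightarrow>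
     Dom C h = Cod C g \<Longrightarrow> Cmp C (Cmp C h g) f = Cmp C h (Cmp C g f)"
  unfolding category_def by metis

lemma functor_Obj: "is_functor C D u \<Longrightarrow> c \<in> Obj C \<Longrightarrow> fobj u c \<in> Obj D"
  and functor_Ide: "is_functor C D u \<Longrightarrow> c \<in> Obj C \<Longrightarrow> farr u (Ide C c) = Ide D (fobj u c)"
  and functor_Arr: "is_functor C D u \<Longrightarrow> f \<in> Arr C \<Longrightarrow> farr u f \<in> Arr D"
  and functor_Dom: "is_functor C D u \<Longrightarrow> f \<in> Arr C \<Longrightarrow> Dom D (farr u f) = fobj u (Dom C f)"
  and functor_Cod: "is_functor C D u \<Longrightarrow> f \<in> Arr C \<Longrightarrow> Cod D (farr u f) = fobj u (Cod C f)"
  and functor_Cmp: "is_functor C D u \<Longrightarrow> f \<in> Arr C \<Longrightarrow> g \<in> Arr C \<Longrightarrow> Dom C g = Cod C f \<Longrightarrow>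
        farr u (Cmp C g f) = Cmp D (farr u g) (farr u f)"
  by (auto simp: is_functor_def hom_def)

lemma functor_hom: "is_functor C D u \<Longrightarrow> f \<in> hom C a b \<Longrightarrow> farr u f \<in> hom D (fobj u a) (fobj u b)"
  by (auto simp: is_functor_def hom_def)

lemmas functor_simps = functor_Obj functor_Ide functor_Arr functor_Dom functor_Cod

lemma final_obj_unique:
  "final_obj C t \<Longrightarrow> c \<in> Obj C \<Longrightarrow> f \<in> hom C c t \<Longrightarrow> g \<in> hom C c t \<Longrightarrow> f = g"
  by (auto simp: final_obj_def)

lemma to_final_in_hom: "final_obj C t \<Longrightarrow> c \<in> Obj C \<Longrightarrow> to_final C t c \<in> hom C c t"
  unfolding to_final_def final_obj_def by (metis theI')

lemma to_final_eqI: "final_obj C t \<Longrightarrow> c \<in> Obj C \<Longrightarrow> f \<in> hom C c t \<Longrightarrow> f = to_final C t c"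
  using final_obj_unique to_final_in_hom by metis

section \<open>Presheaves, their morphisms and isomorphisms\<close>

lemma Res_in:
  "presheaf U C F \<Longrightarrow> f \<in> hom C a b \<Longrightarrow> s \<in> U (Sec F b) \<Longrightarrow> Res F f s \<in> U (Sec F a)"
  by (auto simp: presheaf_def hom_def)

lemma Res_Ide: "presheaf U C F \<Longrightarrow> c \<in> Obj C \<Longrightarrow> s \<in> U (Sec F c) \<Longrightarrow> Res F (Ide C c) s = s"
  by (auto simp: presheaf_def)

lemma Res_Cmp:
  "presheaf U C F \<Longrightarrow> f \<in> hom C a b \<Longrightarrow> g \<in> hom C b c \<Longrightarrow> s \<in> U (Sec F c) \<Longrightarrow>
     Res F (Cmp C g f) s = Res F f (Res F g s)"
  by (auto simp: presheaf_def hom_def)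

lemma sheaf_presheaf: "sheaf U C F \<Longrightarrow> presheaf U C F"
  by (simp add: sheaf_def)

lemma sheaf_glue_unique:
  assumes "sheaf U C F" "c \<in> Obj C" "S \<in> Cov C c" "\<And>f. f \<in> S \<Longrightarrow> s f \<in> U (Sec F (Dom C f))"
    and "\<And>f g. f \<in> S \<Longrightarrow> g \<in> arrows_to C (Dom C f) \<Longrightarrow> Res F g (s f) = s (Cmp C f g)"
  shows "\<exists>!t. t \<in> U (Sec F c) \<and> (\<forall>f\<in>S. Res F f t = s f)"
  by (rule assms(1)[unfolded sheaf_def, THEN conjunct2, rule_format, OF assms(2,3)])
    (use assms(4,5) in simp)

lemma pmorI:
  assumes "\<And>c s. c \<in> Obj C \<Longrightarrow> s \<in> U (Sec F c) \<Longrightarrow> t c s \<in> U (Sec G c)"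
    and "\<And>f a b s. f \<in> hom C a b \<Longrightarrow> a \<in> Obj C \<Longrightarrow> b \<in> Obj C \<Longrightarrow> s \<in> U (Sec F b) \<Longrightarrow>
           t a (Res F f s) = Res G f (t b s)"
    and "category C" "presheaf U C F"
  shows "(\<lambda>c\<in>Obj C. \<lambda>s\<in>U (Sec F c). t c s) \<in> pmor U C F G"
  unfolding pmor_def using assms Res_in[OF assms(4)]
  by (auto simp: hom_def)

lemma pmor_in: "m \<in> pmor U C F G \<Longrightarrow> c \<in> Obj C \<Longrightarrow> s \<in> U (Sec F c) \<Longrightarrow> m c s \<in> U (Sec G c)"
  unfolding pmor_def by (auto simp: PiE_iff Pi_iff)

lemma pmor_Res:
  "m \<in> pmor U C F G \<Longrightarrow> f \<in> hom C a b \<Longrightarrow> s \<in> U (Sec F b) \<Longrightarrow>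
     m a (Res F f s) = Res G f (m b s)"
  unfolding pmor_def by (auto simp: hom_def)

text \<open>Components are extensional, so agreement on sections is enough. The targets
  \<open>G\<close> and \<open>G'\<close> may differ, because one family can be a morphism to two
  presheaves that have the same sections over \<open>C\<close> without being equal as
  records.\<close>

lemma pmor_eqI:
  assumes "m \<in> pmor U C F G" "m' \<in> pmor U C F G'"
    and "\<And>c s. c \<in> Obj C \<Longrightarrow> s \<in> U (Sec F c) \<Longrightarrow> m c s = m' c s"
  shows "m = m'"
proof
  fix c
  show "m c = m' c"
  proof (cases "c \<in> Obj C")
    case True
    then have "m c \<in> extensional (U (Sec F c))" "m' c \<in> extensional (U (Sec F c))"
      using assms(1,2) by (auto simp: pmor_def PiE_iff)
    then show ?thesis
      using True assms(3) by (auto intro: extensionalityI)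
  next
    case False
    then show ?thesis
      using assms(1,2) by (auto simp: pmor_def PiE_iff extensional_def)
  qed
qed

lemma pcomp_apply [simp]:
  "c \<in> Obj C \<Longrightarrow> s \<in> U (Sec F c) \<Longrightarrow> pcomp U C F n m c s = n c (m c s)"
  by (simp add: pcomp_def)

lemma direct_mor_apply [simp]: "c \<in> Obj C \<Longrightarrow> direct_mor C u n c = n (fobj u c)"
  by (simp add: direct_mor_def)

lemma pid_apply [simp]: "c \<in> Obj C \<Longrightarrow> s \<in> U (Sec F c) \<Longrightarrow> pid U C F c s = s"
  by (simp add: pid_def)

lemma Sec_direct [simp]: "Sec (direct u G) c = Sec G (fobj u c)"
  and Res_direct [simp]: "Res (direct u G) f = Res G (farr u f)"
  by (simp_all add: direct_def)

lemma pid_pmor: "category C \<Longrightarrow> presheaf U C F \<Longrightarrow> pid U C F \<in> pmor U C F F"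
  unfolding pid_def by (rule pmorI) auto

lemma pcomp_pmor:
  assumes "category C" "presheaf U C F" "m \<in> pmor U C F G" "n \<in> pmor U C G H"
  shows "pcomp U C F n m \<in> pmor U C F H"
  unfolding pcomp_def
  by (rule pmorI) (use assms in \<open>auto simp: pmor_in pmor_Res\<close>)

lemma pcomp_eqI:
  assumes "m' \<in> pmor U C F G" "\<And>c s. c \<in> Obj C \<Longrightarrow> s \<in> U (Sec F c) \<Longrightarrow> n c (m c s) = m' c s"
  shows "pcomp U C F n m = m'"
proof
  fix c
  show "pcomp U C F n m c = m' c"
  proof (cases "c \<in> Obj C")
    case True
    then have "m' c \<in> extensional (U (Sec F c))"
      using assms(1) by (auto simp: pmor_def PiE_iff)
    then show ?thesis
      using True assms(2) by (auto intro: extensionalityI simp: pcomp_def)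
  next
    case False
    then show ?thesis
      using assms(1) by (auto simp: pmor_def PiE_iff extensional_def pcomp_def)
  qed
qed

lemma direct_presheaf:
  assumes "is_functor C D u" "category C" "category D" "presheaf U D G"
  shows "presheaf U C (direct u G)"
  unfolding presheaf_def
proof (intro conjI ballI impI)
  fix f assume f: "f \<in> Arr C"
  have "farr u f \<in> hom D (fobj u (Dom C f)) (fobj u (Cod C f))"
    using assms f by (simp add: hom_iff functor_simps)
  then show "Res (direct u G) f \<in> U (Sec (direct u G) (Cod C f)) \<rightarrow> U (Sec (direct u G) (Dom C f))"
    using Res_in[OF assms(4)] by auto
next
  fix c s assume "c \<in> Obj C" "s \<in> U (Sec (direct u G) c)"
  then show "Res (direct u G) (Ide C c) s = s"
    using assms Res_Ide[OF assms(4)] by (simp add: functor_simps)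
next
  fix f g s assume *: "f \<in> Arr C" "g \<in> Arr C" "Dom C g = Cod C f" "s \<in> U (Sec (direct u G) (Cod C g))"
  have "farr u f \<in> hom D (fobj u (Dom C f)) (fobj u (Dom C g))"
       "farr u g \<in> hom D (fobj u (Dom C g)) (fobj u (Cod C g))"
    using assms * by (simp_all add: hom_iff functor_simps)
  from Res_Cmp[OF assms(4) this] show
    "Res (direct u G) (Cmp C g f) s = Res (direct u G) f (Res (direct u G) g s)"
    using * assms by (simp add: functor_Cmp)
qed

lemma pisoD:
  assumes "piso U C F G m" "c \<in> Obj C"
  shows "bij_betw (m c) (U (Sec F c)) (U (Sec G c))"
proof -
  obtain n where m: "m \<in> pmor U C F G" and n: "n \<in> pmor U C G F"
    and nm: "pcomp U C F n m = pid U C F" and mn: "pcomp U C G m n = pid U C G"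
    using assms(1) by (auto simp: piso_def)
  show ?thesis
  proof (rule bij_betw_byWitness[where f' = "n c"])
    show "\<forall>s\<in>U (Sec F c). n c (m c s) = s"
      using fun_cong[OF fun_cong[OF nm]] assms(2) by (metis pcomp_apply pid_apply)
    show "\<forall>s\<in>U (Sec G c). m c (n c s) = s"
      using fun_cong[OF fun_cong[OF mn]] assms(2) by (metis pcomp_apply pid_apply)
  qed (use m n assms(2) in \<open>auto simp: pmor_in\<close>)
qed

text \<open>The inverse of a natural family of bijections is natural: every section of
  \<open>G\<close> is the image of one of \<open>F\<close>, and the naturality of \<open>m\<close>
  can be read backwards. Isomorphisms can thus be checked one object at a time.\<close>

lemma piso_iff:
  assumes C: "category C" and F: "presheaf U C F" and G: "presheaf U C G"
  shows "piso U C F G m \<longleftrightarrow>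
     m \<in> pmor U C F G \<and> (\<forall>c\<in>Obj C. bij_betw (m c) (U (Sec F c)) (U (Sec G c)))"
proof
  assume "piso U C F G m"
  then show "m \<in> pmor U C F G \<and> (\<forall>c\<in>Obj C. bij_betw (m c) (U (Sec F c)) (U (Sec G c)))"
    by (metis piso_def pisoD)
next
  assume *: "m \<in> pmor U C F G \<and> (\<forall>c\<in>Obj C. bij_betw (m c) (U (Sec F c)) (U (Sec G c)))"
  then have m: "m \<in> pmor U C F G" by blast
  define t where "t = (\<lambda>c. inv_into (U (Sec F c)) (m c))"
  have t_in: "t c s \<in> U (Sec F c)" and mt: "m c (t c s) = s" if "c \<in> Obj C" "s \<in> U (Sec G c)" for c s
    using * that unfolding t_def bij_betw_def by (auto simp: inv_into_into f_inv_into_f)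
  have tm: "t c (m c s) = s" if "c \<in> Obj C" "s \<in> U (Sec F c)" for c s
    using * that unfolding t_def bij_betw_def by auto
  let ?n = "\<lambda>c\<in>Obj C. \<lambda>s\<in>U (Sec G c). t c s"
  have "?n \<in> pmor U C G F"
  proof (rule pmorI)
    fix f a b s assume f: "f \<in> hom C a b" "a \<in> Obj C" "b \<in> Obj C" and s: "s \<in> U (Sec G b)"
    have "t a (Res G f s) = t a (m a (Res F f (t b s)))"
      using pmor_Res[OF m f(1) t_in] mt f s by simp
    also have "\<dots> = Res F f (t b s)"
      using tm f s t_in Res_in[OF F f(1)] by simp
    finally show "t a (Res G f s) = Res F f (t b s)" .
  qed (use t_in C G in auto)
  moreover have "pcomp U C F ?n m = pid U C F"
    by (rule pcomp_eqI[OF pid_pmor]) (use C F tm pmor_in[OF m] in auto)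
  moreover have "pcomp U C G m ?n = pid U C G"
    by (rule pcomp_eqI[OF pid_pmor]) (use C G mt pmor_in[OF m] in auto)
  ultimately show "piso U C F G m"
    using m by (auto simp: piso_def)
qed

lemma piso_pmor: "piso U C F G m \<Longrightarrow> m \<in> pmor U C F G"
  by (simp add: piso_def)

lemma piso_inverse:
  assumes "piso U C F G m" "category C" "presheaf U C F" "presheaf U C G"
  obtains n where "piso U C G F n"
    and "\<And>c s. c \<in> Obj C \<Longrightarrow> s \<in> U (Sec F c) \<Longrightarrow> n c (m c s) = s"
    and "\<And>c s. c \<in> Obj C \<Longrightarrow> s \<in> U (Sec G c) \<Longrightarrow> m c (n c s) = s"
proof -
  obtain n where m: "m \<in> pmor U C F G" and n: "n \<in> pmor U C G F"
    and nm: "pcomp U C F n m = pid U C F" and mn: "pcomp U C G m n = pid U C G"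
    using assms(1) by (auto simp: piso_def)
  show thesis
  proof
    show "piso U C G F n"
      using m n nm mn by (auto simp: piso_def)
    show "n c (m c s) = s" if "c \<in> Obj C" "s \<in> U (Sec F c)" for c s
      using fun_cong[OF fun_cong[OF nm]] that by (metis pcomp_apply pid_apply)
    show "m c (n c s) = s" if "c \<in> Obj C" "s \<in> U (Sec G c)" for c s
      using fun_cong[OF fun_cong[OF mn]] that by (metis pcomp_apply pid_apply)
  qed
qed

lemma piso_pcomp:
  assumes "category C" "presheaf U C F" "presheaf U C G" "presheaf U C H"
    and "piso U C F G m" "piso U C G H n"
  shows "piso U C F H (pcomp U C F n m)"
proof -
  have "bij_betw (pcomp U C F n m c) (U (Sec F c)) (U (Sec H c))" if "c \<in> Obj C" for c
  proof -
    have "bij_betw (n c \<circ> m c) (U (Sec F c)) (U (Sec H c))"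
      using assms(5,6) that bij_betw_trans pisoD by metis
    then show ?thesis
      by (rule bij_betw_cong[THEN iffD1, rotated]) (use that in auto)
  qed
  then show ?thesis
    using assms by (auto simp: piso_iff intro!: pcomp_pmor)
qed

text \<open>The clause of \<open>inverse_image\<close> that concerns one sheaf \<open>F\<close>,
  detached from the choice of an inverse image functor so that it makes sense for other candidates
  such as \<open>H\<close>. Composites are compared on sections, and existence and uniqueness of
  factorizations are separated because they are proved by different constructions.\<close>

definition universal_arrow ::
    "('u \<Rightarrow> 'u set) \<Rightarrow> ('o, 'a, 'z) site_scheme \<Rightarrow> ('p, 'b, 'y) site_scheme \<Rightarrow>
     ('o, 'a, 'p, 'b) fctr \<Rightarrow> ('o, 'a, 'u) psh \<Rightarrow> ('p, 'b, 'u) psh \<Rightarrow> ('o \<Rightarrow> 'u \<Rightarrow> 'u) \<Rightarrow> bool" where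
  "universal_arrow U C D u F G m \<longleftrightarrow>
     sheaf U D G \<and> m \<in> pmor U C F (direct u G) \<and>
     (\<forall>K. sheaf U D K \<longrightarrow>
        (\<forall>m'\<in>pmor U C F (direct u K). \<exists>n\<in>pmor U D G K.
           \<forall>c\<in>Obj C. \<forall>s\<in>U (Sec F c). n (fobj u c) (m c s) = m' c s) \<and>
        (\<forall>n\<in>pmor U D G K. \<forall>n'\<in>pmor U D G K.
           (\<forall>c\<in>Obj C. \<forall>s\<in>U (Sec F c). n (fobj u c) (m c s) = n' (fobj u c) (m c s)) \<longrightarrow> n = n'))"

lemma universal_arrow_sheaf: "universal_arrow U C D u F G m \<Longrightarrow> sheaf U D G"
  and universal_arrow_pmor: "universal_arrow U C D u F G m \<Longrightarrow> m \<in> pmor U C F (direct u G)"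
  by (simp_all add: universal_arrow_def)

lemma universal_arrow_factor:
  assumes "universal_arrow U C D u F G m" "sheaf U D K" "m' \<in> pmor U C F (direct u K)"
  obtains n where "n \<in> pmor U D G K"
    "\<And>c s. c \<in> Obj C \<Longrightarrow> s \<in> U (Sec F c) \<Longrightarrow> n (fobj u c) (m c s) = m' c s"
  using assms unfolding universal_arrow_def by blast

lemma universal_arrow_eqI:
  assumes "universal_arrow U C D u F G m" "sheaf U D K" "n \<in> pmor U D G K" "n' \<in> pmor U D G K"
    and "\<And>c s. c \<in> Obj C \<Longrightarrow> s \<in> U (Sec F c) \<Longrightarrow> n (fobj u c) (m c s) = n' (fobj u c) (m c s)"
  shows "n = n'"
  using assms unfolding universal_arrow_def by blast

text \<open>Existence is a translation. For uniqueness, the common composite of \<open>n\<close> and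
  \<open>n'\<close> with \<open>adj L F\<close> has to be recognised as a morphism into
  \<open>direct u K\<close>, since only then does the unique existence clause apply to it.\<close>

lemma inverse_image_universal_arrow:
  assumes "category C" "is_functor C D u" "inverse_image U C D u L" "sheaf U C F"
  shows "universal_arrow U C D u F (star L F) (adj L F)"
proof -
  note L = assms(3)[unfolded inverse_image_def, rule_format, OF assms(4)]
  have *: "sheaf U D (star L F)" "adj L F \<in> pmor U C F (direct u (star L F))"
    using L[THEN conjunct1] L[THEN conjunct2, THEN conjunct1] .
  have ex1: "\<And>G m. sheaf U D G \<Longrightarrow> m\<in>pmor U C F (direct u G) \<Longrightarrow>
       \<exists>!n. n \<in> pmor U D (star L F) G \<and> pcomp U C F (direct_mor C u n) (adj L F) = m"
    by (rule L[THEN conjunct2, THEN conjunct2, rule_format])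
  show ?thesis
    unfolding universal_arrow_def
  proof (intro conjI allI impI ballI)
    fix K m assume "sheaf U D K" "m \<in> pmor U C F (direct u K)"
    from ex1[OF this] obtain n where n: "n \<in> pmor U D (star L F) K"
      "pcomp U C F (direct_mor C u n) (adj L F) = m" by (elim ex1E conjE)
    show "\<exists>n\<in>pmor U D (star L F) K. \<forall>c\<in>Obj C. \<forall>s\<in>U (Sec F c). n (fobj u c) (adj L F c s) = m c s"
    proof (intro bexI[of _ n] ballI)
      show "n (fobj u c) (adj L F c s) = m c s" if "c \<in> Obj C" "s \<in> U (Sec F c)" for c s
        unfolding n(2)[symmetric] using that by simp
    qed (fact n(1))
  next
    fix K n n' assume K: "sheaf U D K" and n: "n \<in> pmor U D (star L F) K" "n' \<in> pmor U D (star L F) K"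
      and eq: "\<forall>c\<in>Obj C. \<forall>s\<in>U (Sec F c). n (fobj u c) (adj L F c s) = n' (fobj u c) (adj L F c s)"
    have "pcomp U C F (direct_mor C u n) (adj L F) = pcomp U C F (direct_mor C u n') (adj L F)"
      unfolding pcomp_def by (intro restrict_ext) (simp add: eq)
    moreover have "pcomp U C F (direct_mor C u n) (adj L F) \<in> pmor U C F (direct u K)"
    proof -
      have "(\<lambda>c\<in>Obj C. \<lambda>s\<in>U (Sec F c). n (fobj u c) (adj L F c s)) \<in> pmor U C F (direct u K)"
      proof (rule pmorI)
        fix f a b s assume f: "f \<in> hom C a b" "b \<in> Obj C" and s: "s \<in> U (Sec F b)"
        have "adj L F b s \<in> U (Sec (star L F) (fobj u b))"
          using pmor_in[OF *(2) f(2) s] by simp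
        then show "n (fobj u a) (adj L F a (Res F f s)) = Res (direct u K) f (n (fobj u b) (adj L F b s))"
          using pmor_Res[OF *(2) f(1) s] pmor_Res[OF n(1) functor_hom[OF assms(2) f(1)]] by simp
      next
        fix c s assume c: "c \<in> Obj C" and s: "s \<in> U (Sec F c)"
        show "n (fobj u c) (adj L F c s) \<in> U (Sec (direct u K) c)"
          using pmor_in[OF n(1) functor_Obj[OF assms(2) c]] pmor_in[OF *(2) c s] by simp
      qed (use assms(1,4) sheaf_presheaf in blast)+
      moreover have "pcomp U C F (direct_mor C u n) (adj L F) =
          (\<lambda>c\<in>Obj C. \<lambda>s\<in>U (Sec F c). n (fobj u c) (adj L F c s))"
        unfolding pcomp_def by (intro restrict_ext) simp
      ultimately show ?thesis
        by simp
    qed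
    ultimately show "n = n'"
      using ex1[OF K, of "pcomp U C F (direct_mor C u n) (adj L F)"] n by auto
  qed (fact *)+
qed

section \<open>Small sets\<close>

context
  fixes U :: "'u \<Rightarrow> 'u set"
  assumes universe: "universe U"
begin

lemma universe_doubleton: "\<exists>z. U z = {x, y}"
  using universe unfolding universe_def by blast

lemma universe_UN: "\<exists>z. U z = (\<Union>i\<in>U x. U (f i))"
  using universe unfolding universe_def by blast

lemma universe_Pow: "\<exists>p. U ` U p = Pow (U x)"
  using universe unfolding universe_def by blast

lemma universe_inj: "inj U"
  using universe unfolding universe_def by blast

lemma universe_subset: "A \<subseteq> U x \<Longrightarrow> \<exists>z. U z = A"
  using universe_Pow[of x] by (metis PowI imageE)

text \<open>Replacement: the union axiom is applied to the singletons of the \<open>h i\<close>,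
  which are doubletons with equal entries.\<close>

lemma universe_image: "\<exists>z. U z = h ` U x"
proof -
  define g where "g i = (SOME z. U z = {h i, h i})" for i
  have "U (g i) = {h i, h i}" for i
    unfolding g_def by (rule someI_ex[OF universe_doubleton])
  then have "(\<Union>i\<in>U x. U (g i)) = h ` U x"
    by auto
  then show ?thesis
    using universe_UN[of g x] by metis
qed

text \<open>Smallness only means being in bijection with a member of the universe; for a set of
  elements of \<open>'u\<close>, replacement along the inverse bijection produces a member with
  exactly these elements.\<close>

lemma small_iff: "small U A \<longleftrightarrow> (\<exists>z. U z = A)" for A :: "'u set"
proof
  assume "small U A"
  then obtain x h where "bij_betw h A (U x)"
    by (auto simp: small_def)
  then have "A = inv_into A h ` U x"
    by (metis bij_betw_def bij_betw_inv_into)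
  then show "\<exists>z. U z = A"
    using universe_image by metis
next
  assume "\<exists>z. U z = A"
  then show "small U A"
    unfolding small_def using bij_betw_id by metis
qed

lemma small_bij: "bij_betw f A B \<Longrightarrow> small U B \<Longrightarrow> small U A"
  unfolding small_def using bij_betw_trans by blast

lemma small_subset:
  assumes "small U B" "A \<subseteq> B"
  shows "small U A"
proof -
  obtain x h where h: "bij_betw h B (U x)"
    using assms by (auto simp: small_def)
  then have "h ` A \<subseteq> U x"
    using assms by (auto simp: bij_betw_def)
  then obtain z where "U z = h ` A"
    using universe_subset by metis
  moreover have "inj_on h A"
    using h assms by (auto simp: bij_betw_def intro: inj_on_subset)
  ultimately show ?thesis
    unfolding small_def by (metis inj_on_imp_bij_betw)
qed

lemma small_inj: "inj_on f A \<Longrightarrow> f ` A \<subseteq> B \<Longrightarrow> small U B \<Longrightarrow> small U A"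
  using small_subset small_bij by (metis inj_on_imp_bij_betw)

lemma small_Pow:
  assumes "small U A"
  shows "small U (Pow A)"
proof -
  obtain x h where h: "bij_betw h A (U x)"
    using assms by (auto simp: small_def)
  obtain p where "U ` U p = Pow (U x)"
    using universe_Pow by blast
  \<comment> \<open>Injectivity of \<open>U\<close> makes it a bijection from the elements of the
    power object \<open>p\<close> to the subsets of \<open>U x\<close>.\<close>
  then have "bij_betw U (U p) (Pow (U x))"
    using inj_on_subset[OF universe_inj subset_UNIV] by (simp add: bij_betw_def)
  then have "bij_betw (inv_into (U p) U) (Pow (U x)) (U p)"
    by (rule bij_betw_inv_into)
  then have "small U (Pow (U x))"
    by (auto simp: small_def)
  moreover have "bij_betw (image h) (Pow A) (Pow (U x))"
    using h by (rule bij_betw_Pow)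
  ultimately show ?thesis
    using small_bij by blast
qed

text \<open>Pairs are coded inside the universe as Kuratowski pairs \<open>p i j\<close>; the
  disjoint union then embeds into a union of members indexed by \<open>U x\<close>.\<close>

lemma small_Sigma:
  assumes A: "small U A" and B: "\<And>a. a \<in> A \<Longrightarrow> small U (B a)"
  shows "small U (Sigma A B)"
proof -
  obtain x h where h: "bij_betw h A (U x)"
    using A by (auto simp: small_def)
  have "\<forall>a. \<exists>y g. a \<in> A \<longrightarrow> bij_betw g (B a) (U y)"
    using B by (auto simp: small_def)
  then obtain y g where g: "\<And>a. a \<in> A \<Longrightarrow> bij_betw (g a) (B a) (U (y a))"
    by metis
  define d where "d i j = (SOME z. U z = {i, j})" for i j
  have d: "U (d i j) = {i, j}" for i j
    unfolding d_def by (rule someI_ex[OF universe_doubleton])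
  define p where "p i j = d (d i i) (d i j)" for i j
  have p_inj: "i = i' \<and> j = j'" if "p i j = p i' j'" for i j i' j'
  proof -
    \<comment> \<open>Taking the elements of a code, and then the elements of each of these, gives
      the set \<open>{{i}, {i, j}}\<close>, which determines \<open>i\<close> and
      \<open>j\<close>.\<close>
    have "{{i}, {i, j}} = {{i'}, {i', j'}}"
    proof -
      have "U ` U (p i j) = U ` U (p i' j')"
        using that by simp
      then show ?thesis
        by (simp add: p_def d)
    qed
    then show ?thesis
      by (auto simp: doubleton_eq_iff)
  qed
  \<comment> \<open>The union axiom takes its indices in the universe, so an index \<open>i\<close>
    in \<open>U x\<close> is decoded to the element \<open>inv_into A h i\<close> of
    \<open>A\<close>.\<close>
  have "\<forall>i. \<exists>z. U z = p i ` U (y (inv_into A h i))"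
    using universe_image by blast
  then obtain f where f: "\<And>i. U (f i) = p i ` U (y (inv_into A h i))"
    by metis
  obtain z where z: "U z = (\<Union>i\<in>U x. U (f i))"
    using universe_UN by blast
  have inv: "inv_into A h (h a) = a" if "a \<in> A" for a
    using h that by (simp add: bij_betw_def)
  let ?F = "\<lambda>(a, b). p (h a) (g a b)"
  have "inj_on ?F (Sigma A B)"
  proof (rule inj_onI, clarify)
    fix a b a' b' assume *: "a \<in> A" "b \<in> B a" "a' \<in> A" "b' \<in> B a'" "p (h a) (g a b) = p (h a') (g a' b')"
    then have "h a = h a'" "g a b = g a' b'"
      using p_inj by blast+
    then show "a = a' \<and> b = b'"
      using * inv g by (metis bij_betw_def inj_onD)
  qed
  moreover have "?F ` Sigma A B \<subseteq> U z"
  proof clarify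
    fix a b assume *: "a \<in> A" "b \<in> B a"
    then have "h a \<in> U x" "g a b \<in> U (y a)"
      using h g by (auto simp: bij_betw_def)
    then show "p (h a) (g a b) \<in> U z"
      unfolding z by (intro UN_I[of "h a"]) (simp_all add: f inv[OF *(1)])
  qed
  moreover have "small U (U z)"
    using small_iff by blast
  ultimately show ?thesis
    using small_inj by blast
qed

text \<open>An extensional function on \<open>A\<close> is determined by its graph, a subset of
  \<open>Sigma A B\<close>, so smallness of sums and of power sets suffices.\<close>

lemma small_PiE:
  assumes "small U A" "\<And>a. a \<in> A \<Longrightarrow> small U (B a)"
  shows "small U (Pi\<^sub>E A B)"
proof (rule small_inj)
  show "small U (Pow (Sigma A B))"
    using assms by (intro small_Pow small_Sigma)
  show "(\<lambda>f. (\<lambda>a. (a, f a)) ` A) ` Pi\<^sub>E A B \<subseteq> Pow (Sigma A B)"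
    by (auto simp: PiE_iff)
  show "inj_on (\<lambda>f. (\<lambda>a. (a, f a)) ` A) (Pi\<^sub>E A B)"
  proof (rule inj_onI)
    fix f g assume *: "f \<in> Pi\<^sub>E A B" "g \<in> Pi\<^sub>E A B" "(\<lambda>a. (a, f a)) ` A = (\<lambda>a. (a, g a)) ` A"
    have "f a = g a" if "a \<in> A" for a
    proof -
      have "(a, f a) \<in> (\<lambda>a. (a, g a)) ` A"
        unfolding *(3)[symmetric] using that by blast
      then show ?thesis
        by blast
    qed
    then show "f = g"
      using PiE_ext[OF *(1,2)] by blast
  qed
qed

end

section \<open>Localization of a site\<close>

lemma topology_sieve:
  assumes "topology C J" "c \<in> Obj C" "S \<in> J c"
  shows "sieve C c S"
  using assms(1)[unfolded topology_def, rule_format, OF assms(2), THEN conjunct1] assms(3) by blast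

lemma topology_pullback:
  assumes "topology C J" "c \<in> Obj C" "S \<in> J c" "f \<in> arrows_to C c"
  shows "pullback_sieve C f S \<in> J (Dom C f)"
  using assms(1)[unfolded topology_def, rule_format, OF assms(2), THEN conjunct2, THEN conjunct2,
      THEN conjunct1] assms(3,4) by blast

lemma sieve_arrows: "sieve C c S \<Longrightarrow> f \<in> S \<Longrightarrow> f \<in> Arr C \<and> Cod C f = c"
  by (auto simp: sieve_def arrows_to_def)

text \<open>Sections of a sheaf are elements of \<open>'u\<close>, whereas constructions produce
  sets of other types. A functor \<open>T\<close> with small values that satisfies the sheaf
  condition is brought into the universe by chosen bijections \<open>h\<close>, its restrictions
  being conjugated by them.\<close>

lemma represent_sheaf:
  fixes T :: "'o \<Rightarrow> 'z set" and r :: "'a \<Rightarrow> 'z \<Rightarrow> 'z" and C :: "('o, 'a, 'y) site_scheme"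
  assumes C: "category C" "topology C (Cov C)"
    and small: "\<And>c. c \<in> Obj C \<Longrightarrow> small U (T c)"
    and r_in: "\<And>f a b q. f \<in> hom C a b \<Longrightarrow> q \<in> T b \<Longrightarrow> r f q \<in> T a"
    and r_Ide: "\<And>c q. c \<in> Obj C \<Longrightarrow> q \<in> T c \<Longrightarrow> r (Ide C c) q = q"
    and r_Cmp: "\<And>f g a b c q. f \<in> hom C a b \<Longrightarrow> g \<in> hom C b c \<Longrightarrow> q \<in> T c \<Longrightarrow>
           r (Cmp C g f) q = r f (r g q)"
    and glue: "\<And>c S s. c \<in> Obj C \<Longrightarrow> S \<in> Cov C c \<Longrightarrow> (\<And>f. f \<in> S \<Longrightarrow> s f \<in> T (Dom C f)) \<Longrightarrow>
           (\<And>f g. f \<in> S \<Longrightarrow> g \<in> arrows_to C (Dom C f) \<Longrightarrow> r g (s f) = s (Cmp C f g)) \<Longrightarrow>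
           \<exists>!t. t \<in> T c \<and> (\<forall>f\<in>S. r f t = s f)"
  obtains J h where "sheaf U C J" "\<And>c. c \<in> Obj C \<Longrightarrow> bij_betw (h c) (T c) (U (Sec J c))"
    "\<And>f a b q. f \<in> hom C a b \<Longrightarrow> b \<in> Obj C \<Longrightarrow> q \<in> T b \<Longrightarrow> Res J f (h b q) = h a (r f q)"
proof -
  have "\<forall>c. \<exists>z h. c \<in> Obj C \<longrightarrow> bij_betw h (T c) (U z)"
    using small by (auto simp: small_def)
  then obtain z h where h: "\<And>c. c \<in> Obj C \<Longrightarrow> bij_betw (h c) (T c) (U (z c))"
    by metis
  define g where "g c = inv_into (T c) (h c)" for c
  have h_in: "h c q \<in> U (z c)" and gh: "g c (h c q) = q" if "c \<in> Obj C" "q \<in> T c" for c q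
    using h[OF that(1)] that(2) unfolding g_def bij_betw_def by auto
  have g_in: "g c t \<in> T c" and hg: "h c (g c t) = t" if "c \<in> Obj C" "t \<in> U (z c)" for c t
    using h[OF that(1)] that(2) unfolding g_def bij_betw_def
    by (auto simp: inv_into_into f_inv_into_f)
  define J where "J = \<lparr>Sec = z, Res = (\<lambda>f t. h (Dom C f) (r f (g (Cod C f) t)))\<rparr>"
  have Res: "Res J f t = h a (r f (g b t))" if "f \<in> hom C a b" for f a b t
    using that by (auto simp: J_def hom_iff)
  have Sec: "Sec J = z"
    by (simp add: J_def)
  have J: "presheaf U C J"
    unfolding presheaf_def
  proof (intro conjI ballI impI)
    fix f assume f: "f \<in> Arr C"
    show "Res J f \<in> U (Sec J (Cod C f)) \<rightarrow> U (Sec J (Dom C f))"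
    proof
      fix t assume "t \<in> U (Sec J (Cod C f))"
      moreover have "f \<in> hom C (Dom C f) (Cod C f)"
        using f by (simp add: hom_iff)
      ultimately show "Res J f t \<in> U (Sec J (Dom C f))"
        using f C Res r_in g_in h_in Sec by simp
    qed
  next
    fix c t assume "c \<in> Obj C" "t \<in> U (Sec J c)"
    then show "Res J (Ide C c) t = t"
      using Res[OF Ide_in_hom[OF C(1)]] g_in hg r_Ide Sec by simp
  next
    fix f g' t assume *: "f \<in> Arr C" "g' \<in> Arr C" "Dom C g' = Cod C f" "t \<in> U (Sec J (Cod C g'))"
    have f: "f \<in> hom C (Dom C f) (Dom C g')" "g' \<in> hom C (Dom C g') (Cod C g')"
      using * by (auto simp: hom_iff)
    have "Res J (Cmp C g' f) t = h (Dom C f) (r f (r g' (g (Cod C g') t)))"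
      using Res[OF Cmp_in_hom[OF C(1) f]] r_Cmp[OF f] g_in Sec C * by simp
    also have "\<dots> = Res J f (Res J g' t)"
      using Res[OF f(1)] Res[OF f(2)] gh r_in[OF f(2)] g_in Sec C * by simp
    finally show "Res J (Cmp C g' f) t = Res J f (Res J g' t)" .
  qed
  have "sheaf U C J"
    unfolding sheaf_def
  proof (intro conjI ballI allI impI J)
    fix c S s assume c: "c \<in> Obj C" and S: "S \<in> Cov C c"
      and s: "(\<forall>f\<in>S. s f \<in> U (Sec J (Dom C f))) \<and>
              (\<forall>f\<in>S. \<forall>g\<in>arrows_to C (Dom C f). Res J g (s f) = s (Cmp C f g))"
    have S_hom: "f \<in> hom C (Dom C f) c" "Dom C f \<in> Obj C" if "f \<in> S" for f
      using sieve_arrows[OF topology_sieve[of C "Cov C", OF C(2) c S] that] C(1) by (simp_all add: hom_iff)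
    have s_in: "s f \<in> U (z (Dom C f))" if "f \<in> S" for f
      using s that Sec by auto
    have "\<exists>!q. q \<in> T c \<and> (\<forall>f\<in>S. r f q = g (Dom C f) (s f))"
    proof (rule glue[OF c S])
      show "g (Dom C f) (s f) \<in> T (Dom C f)" if "f \<in> S" for f
        using g_in S_hom s_in that by blast
      fix f k assume f: "f \<in> S" and k: "k \<in> arrows_to C (Dom C f)"
      have k': "k \<in> hom C (Dom C k) (Dom C f)" "Dom C k \<in> Obj C" "Dom C (Cmp C f k) = Dom C k"
        using k C S_hom[OF f] by (auto simp: arrows_to_iff hom_iff)
      have "g (Dom C k) (s (Cmp C f k)) = g (Dom C k) (Res J k (s f))"
        using s f k by auto
      also have "\<dots> = r k (g (Dom C f) (s f))"
        using Res[OF k'(1)] gh[OF k'(2)] r_in[OF k'(1)] g_in S_hom[OF f] s_in[OF f] by simp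
      finally show "r k (g (Dom C f) (s f)) = g (Dom C (Cmp C f k)) (s (Cmp C f k))"
        using k' by simp
    qed
    then obtain q where q: "q \<in> T c \<and> (\<forall>f\<in>S. r f q = g (Dom C f) (s f))"
      and q_unique: "\<forall>q'. q' \<in> T c \<and> (\<forall>f\<in>S. r f q' = g (Dom C f) (s f)) \<longrightarrow> q' = q"
      by (rule ex1E)
    show "\<exists>!t. t \<in> U (Sec J c) \<and> (\<forall>f\<in>S. Res J f t = s f)"
    proof (rule ex1I[of _ "h c q"])
      show "h c q \<in> U (Sec J c) \<and> (\<forall>f\<in>S. Res J f (h c q) = s f)"
        using h_in[OF c] Res[OF S_hom(1)] gh[OF c] q hg[OF S_hom(2) s_in] Sec by simp
      fix t assume t: "t \<in> U (Sec J c) \<and> (\<forall>f\<in>S. Res J f t = s f)"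
      have gt: "g c t \<in> T c"
        using g_in c t Sec by simp
      have "r f (g c t) = g (Dom C f) (s f)" if f: "f \<in> S" for f
      proof -
        have "g (Dom C f) (s f) = g (Dom C f) (Res J f t)"
          using t f by simp
        then show ?thesis
          using Res[OF S_hom(1)[OF f]] gh[OF S_hom(2)[OF f]] r_in[OF S_hom(1)[OF f] gt] by simp
      qed
      then have "g c t = q"
        using q_unique gt by blast
      then show "t = h c q"
        using hg[of c t] c t Sec by simp
    qed
  qed
  moreover have "bij_betw (h c) (T c) (U (Sec J c))" if "c \<in> Obj C" for c
    using h that Sec by simp
  moreover have "Res J f (h b q) = h a (r f q)" if "f \<in> hom C a b" "b \<in> Obj C" "q \<in> T b" for f a b q
    using Res[OF that(1)] gh that by simp
  ultimately show thesis
    using that by blast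
qed

section \<open>The slice site and restriction of sheaves to it\<close>

lemma slice_simps:
  "Obj (slice C x) = arrows_to C x"
  "Dom (slice C x) (p, k, q) = p"
  "Cod (slice C x) (p, k, q) = q"
  "Ide (slice C x) p = (p, Ide C (Dom C p), p)"
  "Cmp (slice C x) (p', k', q') (p, k, q) = (p, Cmp C k' k, q')"
  by (simp_all add: slice_def)

lemma slice_Arr_iff:
  "(p, k, q) \<in> Arr (slice C x) \<longleftrightarrow> p \<in> arrows_to C x \<and> q \<in> arrows_to C x \<and>
     k \<in> hom C (Dom C p) (Dom C q) \<and> Cmp C q k = p"
  by (simp add: slice_def)

lemma slice_hom_iff:
  "m \<in> hom (slice C x) p q \<longleftrightarrow> p \<in> arrows_to C x \<and> q \<in> arrows_to C x \<and>
     (\<exists>k \<in> hom C (Dom C p) (Dom C q). m = (p, k, q) \<and> Cmp C q k = p)"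
  by (cases m) (auto simp: hom_iff[where C = "slice C x"] slice_Arr_iff slice_simps)

lemma slice_arrow:
  "category C \<Longrightarrow> b \<in> arrows_to C x \<Longrightarrow> k \<in> arrows_to C (Dom C b) \<Longrightarrow>
     (Cmp C b k, k, b) \<in> hom (slice C x) (Cmp C b k) b"
  unfolding slice_hom_iff by (simp add: arrows_to_iff hom_iff)

lemma slice_ArrE:
  assumes "m \<in> Arr (slice C x)"
  obtains k q where "m = (Cmp C q k, k, q)" "q \<in> Arr C" "Cod C q = x" "k \<in> Arr C" "Cod C k = Dom C q"
  using assms by (cases m) (auto simp: slice_Arr_iff arrows_to_iff hom_iff)

lemma slice_category:
  assumes C: "category C"
  shows "category (slice C x)"
  unfolding category_def
proof (intro conjI ballI impI)
  fix m assume "m \<in> Arr (slice C x)"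
  then obtain k q where m: "m = (Cmp C q k, k, q)" and *: "q \<in> Arr C" "Cod C q = x" "k \<in> Arr C" "Cod C k = Dom C q"
    by (rule slice_ArrE)
  show "Dom (slice C x) m \<in> Obj (slice C x)" "Cod (slice C x) m \<in> Obj (slice C x)"
    using * C by (simp_all add: m slice_simps arrows_to_iff)
  show "Cmp (slice C x) m (Ide (slice C x) (Dom (slice C x) m)) = m"
    "Cmp (slice C x) (Ide (slice C x) (Cod (slice C x) m)) m = m"
    using * C by (simp_all add: m slice_simps)
next
  fix q assume "q \<in> Obj (slice C x)"
  then show "Ide (slice C x) q \<in> hom (slice C x) q q"
    using C by (simp add: slice_hom_iff slice_simps arrows_to_iff) (simp add: hom_iff)
next
  fix f g assume f: "f \<in> Arr (slice C x)" and g: "g \<in> Arr (slice C x)" and gf: "Dom (slice C x) g = Cod (slice C x) f"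
  from f obtain k q where f: "f = (Cmp C q k, k, q)" "q \<in> Arr C" "Cod C q = x"
    "k \<in> Arr C" "Cod C k = Dom C q"
    by (rule slice_ArrE)
  from g obtain k' q' where g: "g = (Cmp C q' k', k', q')" "q' \<in> Arr C" "Cod C q' = x"
    "k' \<in> Arr C" "Cod C k' = Dom C q'"
    by (rule slice_ArrE)
  have "q = Cmp C q' k'"
    using gf f(1) g(1) by (simp add: slice_simps)
  then show "Cmp (slice C x) g f \<in> hom (slice C x) (Dom (slice C x) f) (Cod (slice C x) g)"
    using C f g by (simp add: slice_hom_iff slice_simps arrows_to_iff Cmp_assoc) (simp add: hom_iff Cmp_assoc)
next
  fix f g h assume f: "f \<in> Arr (slice C x)" and g: "g \<in> Arr (slice C x)" and h: "h \<in> Arr (slice C x)"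
    and gf: "Dom (slice C x) g = Cod (slice C x) f \<and> Dom (slice C x) h = Cod (slice C x) g"
  from f obtain k q where f: "f = (Cmp C q k, k, q)" "q \<in> Arr C" "Cod C q = x"
    "k \<in> Arr C" "Cod C k = Dom C q"
    by (rule slice_ArrE)
  from g obtain k' q' where g: "g = (Cmp C q' k', k', q')" "q' \<in> Arr C" "Cod C q' = x"
    "k' \<in> Arr C" "Cod C k' = Dom C q'"
    by (rule slice_ArrE)
  from h obtain k'' q'' where h: "h = (Cmp C q'' k'', k'', q'')" "q'' \<in> Arr C" "Cod C q'' = x"
    "k'' \<in> Arr C" "Cod C k'' = Dom C q''"
    by (rule slice_ArrE)
  have "q = Cmp C q' k'" "q' = Cmp C q'' k''"
    using gf f(1) g(1) h(1) by (simp_all add: slice_simps)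
  then show "Cmp (slice C x) h (Cmp (slice C x) g f) = Cmp (slice C x) (Cmp (slice C x) h g) f"
    using C f g h by (simp add: slice_simps Cmp_assoc)
qed

text \<open>Composing a sheaf with this functor restricts it to the slice. For the localization
  morphism from the topos of the slice to that of \<open>C\<close>,
  \<open>direct (slice_forget C)\<close> is thus the inverse image and not the direct image.\<close>

definition slice_forget :: "('o, 'a, 'z) cat_scheme \<Rightarrow> ('a, 'a \<times> 'a \<times> 'a, 'o, 'a) fctr" where
  "slice_forget C = \<lparr>fobj = Dom C, farr = (\<lambda>(p, k, q). k)\<rparr>"

lemma slice_forget_simps [simp]:
  "fobj (slice_forget C) p = Dom C p" "farr (slice_forget C) (p, k, q) = k"
  by (simp_all add: slice_forget_def)

lemma slice_forget_functor:
  assumes C: "category C"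
  shows "is_functor (slice C x) C (slice_forget C)"
  unfolding is_functor_def
proof (intro conjI ballI impI)
  fix q assume "q \<in> Obj (slice C x)"
  then show "fobj (slice_forget C) q \<in> Obj C"
    "farr (slice_forget C) (Ide (slice C x) q) = Ide C (fobj (slice_forget C) q)"
    using C by (simp_all add: slice_simps arrows_to_iff)
next
  fix m assume "m \<in> Arr (slice C x)"
  then show "farr (slice_forget C) m \<in> hom C (fobj (slice_forget C) (Dom (slice C x) m))
      (fobj (slice_forget C) (Cod (slice C x) m))"
    by (rule slice_ArrE) (use C in \<open>simp add: slice_simps hom_iff\<close>)
next
  fix f g show "farr (slice_forget C) (Cmp (slice C x) g f) =
      Cmp C (farr (slice_forget C) g) (farr (slice_forget C) f)"
    by (cases f, cases g) (simp add: slice_simps)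
qed

lemma slice_covering_sieve:
  assumes "topology C (Cov C)" "category C" "b \<in> arrows_to C x" "S \<in> Cov C (Dom C b)"
  shows "(\<lambda>k. (Cmp C b k, k, b)) ` S \<in> Cov (slice C x) b"
proof -
  have S: "S \<subseteq> arrows_to C (Dom C b)"
    using sieve_arrows[OF topology_sieve[of C "Cov C", OF assms(1) _ assms(4)]] assms(2,3)
    by (auto simp: arrows_to_iff)
  have "(\<lambda>(p, k, q'). k) ` (\<lambda>k. (Cmp C b k, k, b)) ` S = S"
    by (auto simp: image_image)
  then show ?thesis
    using S assms unfolding slice_def by (auto simp: arrows_to_iff hom_iff)
qed

text \<open>An arrow to \<open>q\<close> in the slice is determined by its middle component, so a
  covering sieve of \<open>q\<close> and its image on the source of \<open>q\<close> have the same
  compatible families and the same amalgamations.\<close>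

lemma slice_forget_sheaf:
  assumes C: "category C" and G: "sheaf U C G"
  shows "sheaf U (slice C x) (direct (slice_forget C) G)"
  unfolding sheaf_def
proof (intro conjI ballI allI impI)
  show "presheaf U (slice C x) (direct (slice_forget C) G)"
    by (rule direct_presheaf[OF slice_forget_functor[OF C] slice_category[OF C] C sheaf_presheaf[OF G]])
next
  fix q S s assume q: "q \<in> Obj (slice C x)" and S: "S \<in> Cov (slice C x) q"
    and s: "(\<forall>f\<in>S. s f \<in> U (Sec (direct (slice_forget C) G) (Dom (slice C x) f))) \<and>
      (\<forall>f\<in>S. \<forall>g\<in>arrows_to (slice C x) (Dom (slice C x) f).
         Res (direct (slice_forget C) G) g (s f) = s (Cmp (slice C x) f g))"
  let ?S = "(\<lambda>(p, k, q'). k) ` S"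
  have q: "q \<in> Arr C" "Cod C q = x"
    using q by (auto simp: slice_simps arrows_to_iff)
  have S_Cov: "?S \<in> Cov C (Dom C q)"
    using S by (simp add: slice_def)
  have S_elim: "\<exists>k. f = (Cmp C q k, k, q) \<and> k \<in> Arr C \<and> Cod C k = Dom C q" if "f \<in> S" for f
    using S that by (auto simp: slice_def hom_iff)
  have S_iff: "k \<in> ?S \<longleftrightarrow> (Cmp C q k, k, q) \<in> S" for k
  proof
    assume "k \<in> ?S"
    then obtain f where f: "f \<in> S" "(\<lambda>(p, k, q'). k) f = k"
      by blast
    then show "(Cmp C q k, k, q) \<in> S"
      using S_elim[OF f(1)] by auto
  qed (force simp: image_iff)
  define s' where "s' k = s (Cmp C q k, k, q)" for k
  have "\<exists>!t. t \<in> U (Sec G (Dom C q)) \<and> (\<forall>k\<in>?S. Res G k t = s' k)"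
  proof (rule sheaf_glue_unique[OF G _ S_Cov])
    fix k assume k: "k \<in> ?S"
    then have k': "k \<in> Arr C" "Cod C k = Dom C q" "(Cmp C q k, k, q) \<in> S"
      using S_iff[THEN iffD1, OF k] S_elim[OF S_iff[THEN iffD1, OF k]] by auto
    have "s (Cmp C q k, k, q) \<in> U (Sec (direct (slice_forget C) G) (Dom (slice C x) (Cmp C q k, k, q)))"
      using s k'(3) by blast
    then show "s' k \<in> U (Sec G (Dom C k))"
      using k' q C by (simp add: s'_def slice_simps)
    fix g assume g: "g \<in> arrows_to C (Dom C k)"
    have "(Cmp C q (Cmp C k g), g, Cmp C q k) \<in> arrows_to (slice C x) (Cmp C q k)"
      using g k' q C by (simp add: arrows_to_iff slice_Arr_iff slice_simps hom_iff Cmp_assoc)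
    then have "Res (direct (slice_forget C) G) (Cmp C q (Cmp C k g), g, Cmp C q k) (s (Cmp C q k, k, q))
        = s (Cmp (slice C x) (Cmp C q k, k, q) (Cmp C q (Cmp C k g), g, Cmp C q k))"
      using s k'(3) by (metis slice_simps(2))
    then show "Res G g (s' k) = s' (Cmp C k g)"
      by (simp add: s'_def slice_simps)
  qed (use C q in simp)
  moreover have "(\<forall>k\<in>?S. Res G k t = s' k) \<longleftrightarrow> (\<forall>f\<in>S. Res (direct (slice_forget C) G) f t = s f)" for t
    using S_elim by (force simp: s'_def)
  ultimately show "\<exists>!t. t \<in> U (Sec (direct (slice_forget C) G) q) \<and>
      (\<forall>f\<in>S. Res (direct (slice_forget C) G) f t = s f)"
    by simp
qed

text \<open>
  For a sheaf \<open>Q\<close> on the slice over \<open>x\<close>, the sections over \<open>A\<close> of its direct image under the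
  localization morphism are the natural families of elements of \<open>Q(b)\<close> indexed by the pairs
  \<open>(a: B \<rightarrow> A, b: B \<rightarrow> x)\<close>; the product of \<open>A\<close> and \<open>x\<close> need not exist.
\<close>

definition spans :: "('o, 'a, 'z) cat_scheme \<Rightarrow> 'o \<Rightarrow> 'o \<Rightarrow> ('a \<times> 'a) set" where
  "spans X x A = {(a, b). a \<in> arrows_to X A \<and> b \<in> arrows_to X x \<and> Dom X a = Dom X b}"

definition span_families ::
    "('u \<Rightarrow> 'u set) \<Rightarrow> ('o, 'a, 'z) cat_scheme \<Rightarrow> 'o \<Rightarrow> ('a, 'a \<times> 'a \<times> 'a, 'u) psh \<Rightarrow> 'o \<Rightarrow>
     ('a \<times> 'a \<Rightarrow> 'u) set" where
  "span_families U X x Q A =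
     {q \<in> (\<Pi>\<^sub>E p\<in>spans X x A. U (Sec Q (snd p))).
        \<forall>a b k. (a, b) \<in> spans X x A \<longrightarrow> k \<in> Arr X \<longrightarrow> Cod X k = Dom X b \<longrightarrow>
          q (Cmp X a k, Cmp X b k) = Res Q (Cmp X b k, k, b) (q (a, b))}"

definition span_res ::
    "('o, 'a, 'z) cat_scheme \<Rightarrow> 'o \<Rightarrow> 'a \<Rightarrow> ('a \<times> 'a \<Rightarrow> 'u) \<Rightarrow> 'a \<times> 'a \<Rightarrow> 'u" where
  "span_res X x f q = (\<lambda>p\<in>spans X x (Dom X f). q (Cmp X f (fst p), snd p))"

lemma spans_iff:
  "(a, b) \<in> spans X x A \<longleftrightarrow>
     a \<in> Arr X \<and> b \<in> Arr X \<and> Cod X a = A \<and> Cod X b = x \<and> Dom X a = Dom X b"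
  by (auto simp: spans_def arrows_to_def)

lemma span_families_in:
  "q \<in> span_families U X x Q A \<Longrightarrow> (a, b) \<in> spans X x A \<Longrightarrow> q (a, b) \<in> U (Sec Q b)"
  unfolding span_families_def by (auto simp: PiE_iff)

lemma span_families_natural:
  "q \<in> span_families U X x Q A \<Longrightarrow> (a, b) \<in> spans X x A \<Longrightarrow> k \<in> Arr X \<Longrightarrow> Cod X k = Dom X b \<Longrightarrow>
     q (Cmp X a k, Cmp X b k) = Res Q (Cmp X b k, k, b) (q (a, b))"
  unfolding span_families_def by blast

lemma span_families_eqI:
  assumes "q \<in> span_families U X x Q A" "q' \<in> span_families U X x Q A"
    and "\<And>a b. (a, b) \<in> spans X x A \<Longrightarrow> q (a, b) = q' (a, b)"
  shows "q = q'"
proof (rule PiE_ext)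
  show "q \<in> (\<Pi>\<^sub>E p\<in>spans X x A. U (Sec Q (snd p)))" "q' \<in> (\<Pi>\<^sub>E p\<in>spans X x A. U (Sec Q (snd p)))"
    using assms(1,2) by (simp_all add: span_families_def)
  show "q p = q' p" if "p \<in> spans X x A" for p
    using assms(3) that by (cases p) simp
qed

lemma span_familiesI:
  assumes "\<And>a b. (a, b) \<in> spans X x A \<Longrightarrow> q (a, b) \<in> U (Sec Q b)"
    and "\<And>a b k. (a, b) \<in> spans X x A \<Longrightarrow> k \<in> Arr X \<Longrightarrow> Cod X k = Dom X b \<Longrightarrow>
      q (Cmp X a k, Cmp X b k) = Res Q (Cmp X b k, k, b) (q (a, b))"
    and "category X"
  shows "(\<lambda>p\<in>spans X x A. q p) \<in> span_families U X x Q A"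
  unfolding span_families_def
proof (intro CollectI conjI allI impI)
  show "(\<lambda>p\<in>spans X x A. q p) \<in> (\<Pi>\<^sub>E p\<in>spans X x A. U (Sec Q (snd p)))"
    using assms(1) by auto
  fix a b k assume *: "(a, b) \<in> spans X x A" "k \<in> Arr X" "Cod X k = Dom X b"
  then have "(Cmp X a k, Cmp X b k) \<in> spans X x A"
    using assms(3) by (simp add: spans_iff)
  then show "(\<lambda>p\<in>spans X x A. q p) (Cmp X a k, Cmp X b k) =
      Res Q (Cmp X b k, k, b) ((\<lambda>p\<in>spans X x A. q p) (a, b))"
    using assms(2) * by simp
qed

lemma span_res_apply:
  "(a, b) \<in> spans X x (Dom X f) \<Longrightarrow> span_res X x f q (a, b) = q (Cmp X f a, b)"
  by (simp add: span_res_def)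

lemma span_res_in:
  assumes X: "category X" and f: "f \<in> hom X A' A" and q: "q \<in> span_families U X x Q A"
  shows "span_res X x f q \<in> span_families U X x Q A'"
proof -
  have "(Cmp X f a, b) \<in> spans X x A" if "(a, b) \<in> spans X x A'" for a b
    using X f that by (simp add: spans_iff hom_iff)
  moreover have "Cmp X f (Cmp X a k) = Cmp X (Cmp X f a) k"
    if "(a, b) \<in> spans X x A'" "k \<in> Arr X" "Cod X k = Dom X b" for a b k
    using X f that by (simp add: spans_iff hom_iff Cmp_assoc)
  ultimately have "(\<lambda>p\<in>spans X x A'. q (Cmp X f (fst p), snd p)) \<in> span_families U X x Q A'"
    using X span_families_in[OF q] span_families_natural[OF q] by (intro span_familiesI) auto
  then show ?thesis
    using f by (simp add: span_res_def hom_iff)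
qed

context
  fixes U :: "'u \<Rightarrow> 'u set" and X :: "('o, 'a) site" and x :: 'o and Q :: "('a, 'a \<times> 'a \<times> 'a, 'u) psh"
  assumes X: "category X" and top: "topology X (Cov X)" and Q: "sheaf U (slice X x) Q"
begin

lemma slice_Res_in:
  "b \<in> Arr X \<Longrightarrow> Cod X b = x \<Longrightarrow> k \<in> Arr X \<Longrightarrow> Cod X k = Dom X b \<Longrightarrow> t \<in> U (Sec Q b) \<Longrightarrow>
     Res Q (Cmp X b k, k, b) t \<in> U (Sec Q (Cmp X b k))"
  by (rule Res_in[OF sheaf_presheaf[OF Q]], rule slice_arrow[OF X]) (simp_all add: arrows_to_iff)

lemma slice_Res_Cmp:
  assumes "b \<in> Arr X" "Cod X b = x" "k \<in> Arr X" "Cod X k = Dom X b" "g \<in> Arr X" "Cod X g = Dom X k"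
    and "t \<in> U (Sec Q b)"
  shows "Res Q (Cmp X b (Cmp X k g), g, Cmp X b k) (Res Q (Cmp X b k, k, b) t) =
     Res Q (Cmp X b (Cmp X k g), Cmp X k g, b) t"
proof -
  have k: "(Cmp X b k, k, b) \<in> hom (slice X x) (Cmp X b k) b"
    using assms X by (intro slice_arrow) (simp_all add: arrows_to_iff)
  have g: "(Cmp X (Cmp X b k) g, g, Cmp X b k) \<in> hom (slice X x) (Cmp X (Cmp X b k) g) (Cmp X b k)"
    using assms X by (intro slice_arrow) (simp_all add: arrows_to_iff)
  show ?thesis
    using Res_Cmp[OF sheaf_presheaf[OF Q] g k assms(7)] assms X
    by (simp add: slice_simps Cmp_assoc)
qed

lemma slice_Res_Ide:
  "b \<in> Arr X \<Longrightarrow> Cod X b = x \<Longrightarrow> t \<in> U (Sec Q b) \<Longrightarrow> Res Q (b, Ide X (Dom X b), b) t = t"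
  using Res_Ide[OF sheaf_presheaf[OF Q], of b t] by (simp add: slice_simps arrows_to_iff)

text \<open>The sheaf condition of \<open>Q\<close> at \<open>b\<close>, rephrased for a covering
  sieve of the source of \<open>b\<close> in \<open>X\<close>, so that coverings of the slice itself
  no longer have to be handled.\<close>

lemma slice_sheaf_glue:
  assumes b: "b \<in> Arr X" "Cod X b = x" and S: "S \<in> Cov X (Dom X b)"
    and s: "\<And>k. k \<in> S \<Longrightarrow> s k \<in> U (Sec Q (Cmp X b k))"
    and nat: "\<And>k g. k \<in> S \<Longrightarrow> g \<in> Arr X \<Longrightarrow> Cod X g = Dom X k \<Longrightarrow>
      Res Q (Cmp X b (Cmp X k g), g, Cmp X b k) (s k) = s (Cmp X k g)"
  shows "\<exists>!t. t \<in> U (Sec Q b) \<and> (\<forall>k\<in>S. Res Q (Cmp X b k, k, b) t = s k)"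
proof -
  let ?S = "(\<lambda>k. (Cmp X b k, k, b)) ` S"
  have sv: "k \<in> Arr X" "Cod X k = Dom X b" if "k \<in> S" for k
    using sieve_arrows[OF topology_sieve[of X "Cov X", OF top _ S] that] X b by simp_all
  have "\<exists>!t. t \<in> U (Sec Q b) \<and> (\<forall>f\<in>?S. Res Q f t = s (fst (snd f)))"
  proof (rule sheaf_glue_unique[OF Q])
    show "b \<in> Obj (slice X x)"
      using b by (simp add: slice_simps arrows_to_iff)
    show "?S \<in> Cov (slice X x) b"
      by (rule slice_covering_sieve[OF top X _ S]) (simp add: b arrows_to_iff)
    show "s (fst (snd f)) \<in> U (Sec Q (Dom (slice X x) f))" if "f \<in> ?S" for f
      using that s by (auto simp: slice_simps)
    fix f m assume f: "f \<in> ?S" and m: "m \<in> arrows_to (slice X x) (Dom (slice X x) f)"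
    obtain k where k: "f = (Cmp X b k, k, b)" "k \<in> S"
      using f by blast
    obtain g q where g: "m = (Cmp X q g, g, q)" "g \<in> Arr X" "Cod X g = Dom X q"
      using m by (auto simp: arrows_to_iff elim: slice_ArrE)
    have "q = Cmp X b k"
      using m g(1) k(1) by (simp add: arrows_to_iff slice_simps)
    then show "Res Q m (s (fst (snd f))) = s (fst (snd (Cmp (slice X x) f m)))"
      using nat[OF k(2) g(2)] g k sv[OF k(2)] X b by (simp add: slice_simps Cmp_assoc)
  qed
  then show ?thesis
    by simp
qed

text \<open>The restrictions of \<open>t'\<close> form a compatible family, of which
  \<open>t\<close> and \<open>t'\<close> are both amalgamations.\<close>

lemma slice_sheaf_separated:
  assumes b: "b \<in> Arr X" "Cod X b = x" and S: "S \<in> Cov X (Dom X b)"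
    and t: "t \<in> U (Sec Q b)" "t' \<in> U (Sec Q b)"
    and eq: "\<And>k. k \<in> S \<Longrightarrow> k \<in> Arr X \<Longrightarrow> Cod X k = Dom X b \<Longrightarrow>
      Res Q (Cmp X b k, k, b) t = Res Q (Cmp X b k, k, b) t'"
  shows "t = t'"
proof -
  have sv: "k \<in> Arr X" "Cod X k = Dom X b" if "k \<in> S" for k
    using sieve_arrows[OF topology_sieve[of X "Cov X", OF top _ S] that] X b by simp_all
  have "\<exists>!t. t \<in> U (Sec Q b) \<and> (\<forall>k\<in>S. Res Q (Cmp X b k, k, b) t = Res Q (Cmp X b k, k, b) t')"
    by (rule slice_sheaf_glue[OF b S]) (simp_all add: slice_Res_in slice_Res_Cmp sv b t(2))
  then show ?thesis
    using t eq sv by blast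
qed

text \<open>The value of the glued family at a span \<open>(a, b)\<close> is itself obtained by
  gluing, in the sections of \<open>Q\<close> over \<open>b\<close>: the pullback of
  \<open>S\<close> along \<open>a\<close> covers the common source of \<open>a\<close> and
  \<open>b\<close>, and along its arrows the given families prescribe the value. Naturality,
  restriction and uniqueness are then checked on these sieves because \<open>Q\<close> is
  separated.\<close>

lemma span_families_glue:
  assumes A: "A \<in> Obj X" and S: "S \<in> Cov X A"
    and s: "\<And>f. f \<in> S \<Longrightarrow> s f \<in> span_families U X x Q (Dom X f)"
    and nat: "\<And>f g. f \<in> S \<Longrightarrow> g \<in> arrows_to X (Dom X f) \<Longrightarrow> span_res X x g (s f) = s (Cmp X f g)"
  shows "\<exists>!t. t \<in> span_families U X x Q A \<and> (\<forall>f\<in>S. span_res X x f t = s f)"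
proof -
  have sv: "f \<in> Arr X" "Cod X f = A" if "f \<in> S" for f
    using sieve_arrows[OF topology_sieve[of X "Cov X", OF top A S] that] by simp_all
  have nat': "s (Cmp X f g) (a, b) = s f (Cmp X g a, b)"
    if "f \<in> S" "g \<in> Arr X" "Cod X g = Dom X f" "(a, b) \<in> spans X x (Dom X g)" for f g a b
    using nat[OF that(1), of g] span_res_apply[OF that(4)] that(2,3) by (metis arrows_to_iff)
  let ?P = "\<lambda>a b. pullback_sieve X a S"
  have P_iff: "k \<in> ?P a b \<longleftrightarrow> k \<in> Arr X \<and> Cod X k = Dom X b \<and> Cmp X a k \<in> S"
    if "(a, b) \<in> spans X x A" for a b k
    using that by (auto simp: pullback_sieve_def arrows_to_iff spans_iff)
  have P_Cov: "?P a b \<in> Cov X (Dom X b)" if "(a, b) \<in> spans X x A" for a b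
    using topology_pullback[of X "Cov X", OF top A S, of a] that by (simp add: spans_iff arrows_to_iff)
  \<comment> \<open>When \<open>Cmp X a k\<close> lies in \<open>S\<close>, the span
    \<open>(Cmp X a k, Cmp X b k)\<close> comes from one whose first leg is an identity, by
    composition with \<open>Cmp X a k\<close>; the family \<open>s (Cmp X a k)\<close> at that span
    is the only possible value.\<close>
  define v where "v a b k = s (Cmp X a k) (Ide X (Dom X k), Cmp X b k)" for a b k
  have ex1: "\<exists>!t. t \<in> U (Sec Q b) \<and> (\<forall>k\<in>?P a b. Res Q (Cmp X b k, k, b) t = v a b k)"
    if ab: "(a, b) \<in> spans X x A" for a b
  proof (rule slice_sheaf_glue)
    show "b \<in> Arr X" "Cod X b = x" "?P a b \<in> Cov X (Dom X b)"
      using ab P_Cov by (auto simp: spans_iff)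
    fix k assume k: "k \<in> ?P a b"
    then have k': "k \<in> Arr X" "Cod X k = Dom X b" "Cmp X a k \<in> S"
      using P_iff ab by blast+
    have sp: "(Ide X (Dom X k), Cmp X b k) \<in> spans X x (Dom X (Cmp X a k))"
      using k' X ab by (simp add: spans_iff)
    show "v a b k \<in> U (Sec Q (Cmp X b k))"
      unfolding v_def by (rule span_families_in[OF s[OF k'(3)] sp])
    fix g assume g: "g \<in> Arr X" "Cod X g = Dom X k"
    have "v a b (Cmp X k g) = s (Cmp X (Cmp X a k) g) (Ide X (Dom X g), Cmp X b (Cmp X k g))"
      using k' X ab g by (simp add: v_def Cmp_assoc spans_iff)
    also have "\<dots> = s (Cmp X a k) (Cmp X g (Ide X (Dom X g)), Cmp X b (Cmp X k g))"
      by (rule nat') (use k' X ab g in \<open>simp_all add: spans_iff\<close>)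
    also have "\<dots> = s (Cmp X a k) (Cmp X (Ide X (Dom X k)) g, Cmp X (Cmp X b k) g)"
      using k' X ab g by (simp add: Cmp_assoc spans_iff)
    also have "\<dots> = Res Q (Cmp X (Cmp X b k) g, g, Cmp X b k) (v a b k)"
      unfolding v_def by (rule span_families_natural[OF s[OF k'(3)] sp])
        (use k' X ab g in \<open>simp_all add: spans_iff\<close>)
    finally show "Res Q (Cmp X b (Cmp X k g), g, Cmp X b k) (v a b k) = v a b (Cmp X k g)"
      using k' X ab g by (simp add: Cmp_assoc spans_iff)
  qed
  define q where "q p = (THE t. t \<in> U (Sec Q (snd p)) \<and>
      (\<forall>k\<in>?P (fst p) (snd p). Res Q (Cmp X (snd p) k, k, snd p) t = v (fst p) (snd p) k))" for p
  have q_in: "q (a, b) \<in> U (Sec Q b)"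
    and q_v: "\<And>k. k \<in> Arr X \<Longrightarrow> Cod X k = Dom X b \<Longrightarrow> Cmp X a k \<in> S \<Longrightarrow>
      Res Q (Cmp X b k, k, b) (q (a, b)) = v a b k"
    if ab: "(a, b) \<in> spans X x A" for a b
    using theI'[OF ex1[OF ab]] P_iff[OF ab] by (auto simp: q_def)
  \<comment> \<open>Separation with respect to the pullback of \<open>S\<close> along
    \<open>a\<close>; the three verifications below reduce to it.\<close>
  have sep: "t = t'" if "(a, b) \<in> spans X x A" "t \<in> U (Sec Q b)" "t' \<in> U (Sec Q b)"
    and "\<And>k. k \<in> Arr X \<Longrightarrow> Cod X k = Dom X b \<Longrightarrow> Cmp X a k \<in> S \<Longrightarrow>
      Res Q (Cmp X b k, k, b) t = Res Q (Cmp X b k, k, b) t'" for a b t t'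
  proof (rule slice_sheaf_separated)
    show "b \<in> Arr X" "Cod X b = x" "?P a b \<in> Cov X (Dom X b)"
      using that(1) P_Cov by (auto simp: spans_iff)
  qed (use that P_iff in auto)
  let ?q = "\<lambda>p\<in>spans X x A. q p"
  have q_fam: "?q \<in> span_families U X x Q A"
  proof (rule span_familiesI[OF _ _ X])
    show "q (a, b) \<in> U (Sec Q b)" if "(a, b) \<in> spans X x A" for a b
      by (rule q_in[OF that])
  next
    fix a b k assume ab: "(a, b) \<in> spans X x A" and k: "k \<in> Arr X" "Cod X k = Dom X b"
    have abk: "(Cmp X a k, Cmp X b k) \<in> spans X x A"
      using ab k X by (simp add: spans_iff)
    show "q (Cmp X a k, Cmp X b k) = Res Q (Cmp X b k, k, b) (q (a, b))"
    proof (rule sep[OF abk q_in[OF abk]])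
      show "Res Q (Cmp X b k, k, b) (q (a, b)) \<in> U (Sec Q (Cmp X b k))"
        using slice_Res_in q_in[OF ab] ab k by (auto simp: spans_iff)
      fix g assume g: "g \<in> Arr X" "Cod X g = Dom X (Cmp X b k)" "Cmp X (Cmp X a k) g \<in> S"
      have *: "a \<in> Arr X" "b \<in> Arr X" "Cod X a = A" "Cod X b = x" "Dom X a = Dom X b"
        "Cod X g = Dom X k" "Cmp X a (Cmp X k g) \<in> S"
        using ab g k X by (simp_all add: spans_iff Cmp_assoc)
      have "Res Q (Cmp X (Cmp X b k) g, g, Cmp X b k) (q (Cmp X a k, Cmp X b k)) = v (Cmp X a k) (Cmp X b k) g"
        by (rule q_v[OF abk g])
      also have "\<dots> = v a b (Cmp X k g)"
        using * g(1) k X by (simp add: v_def Cmp_assoc)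
      also have "\<dots> = Res Q (Cmp X b (Cmp X k g), Cmp X k g, b) (q (a, b))"
        using q_v[OF ab, of "Cmp X k g"] * g(1) k X by simp
      also have "\<dots> = Res Q (Cmp X (Cmp X b k) g, g, Cmp X b k) (Res Q (Cmp X b k, k, b) (q (a, b)))"
        using slice_Res_Cmp[of b k g, OF _ _ _ _ _ _ q_in[OF ab]] * g(1) k X by (simp add: Cmp_assoc)
      finally show "Res Q (Cmp X (Cmp X b k) g, g, Cmp X b k) (q (Cmp X a k, Cmp X b k)) =
        Res Q (Cmp X (Cmp X b k) g, g, Cmp X b k) (Res Q (Cmp X b k, k, b) (q (a, b)))" .
    qed
  qed
  have v_eq: "v a b k = span_res X x (Cmp X a k) t (Ide X (Dom X k), Cmp X b k)"
    if "\<And>f. f \<in> S \<Longrightarrow> span_res X x f t = s f" "Cmp X a k \<in> S" for a b k t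
    using that by (simp add: v_def)
  show ?thesis
  proof (rule ex1I[of _ ?q], intro conjI q_fam ballI)
    fix f assume f: "f \<in> S"
    have f_hom: "f \<in> hom X (Dom X f) A"
      using sv[OF f] by (simp add: hom_iff)
    show "span_res X x f ?q = s f"
    proof (rule span_families_eqI[OF span_res_in[OF X f_hom q_fam] s[OF f]])
      fix a b assume ab: "(a, b) \<in> spans X x (Dom X f)"
      then have fab: "(Cmp X f a, b) \<in> spans X x A"
        using sv[OF f] X by (simp add: spans_iff)
      have "q (Cmp X f a, b) = s f (a, b)"
      proof (rule sep[OF fab q_in[OF fab] span_families_in[OF s[OF f] ab]])
        fix k assume k: "k \<in> Arr X" "Cod X k = Dom X b" "Cmp X (Cmp X f a) k \<in> S"
        have *: "a \<in> Arr X" "b \<in> Arr X" "Cod X a = Dom X f" "Cod X b = x" "Dom X a = Dom X b"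
          using ab by (simp_all add: spans_iff)
        have "Res Q (Cmp X b k, k, b) (q (Cmp X f a, b)) = s (Cmp X f (Cmp X a k)) (Ide X (Dom X k), Cmp X b k)"
          using q_v[OF fab k] * k X sv[OF f] by (simp add: v_def Cmp_assoc)
        also have "\<dots> = s f (Cmp X (Cmp X a k) (Ide X (Dom X k)), Cmp X b k)"
          by (rule nat'[OF f]) (use * k X in \<open>simp_all add: spans_iff\<close>)
        also have "\<dots> = Res Q (Cmp X b k, k, b) (s f (a, b))"
          using span_families_natural[OF s[OF f] ab k(1,2)] * k X by simp
        finally show "Res Q (Cmp X b k, k, b) (q (Cmp X f a, b)) = Res Q (Cmp X b k, k, b) (s f (a, b))" .
      qed
      then show "span_res X x f ?q (a, b) = s f (a, b)"
        using fab by (simp add: span_res_apply[OF ab])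
    qed
  next
    fix t assume t: "t \<in> span_families U X x Q A \<and> (\<forall>f\<in>S. span_res X x f t = s f)"
    show "t = ?q"
    proof (rule span_families_eqI[OF _ q_fam])
      fix a b assume ab: "(a, b) \<in> spans X x A"
      have "t (a, b) = q (a, b)"
      proof (rule sep[OF ab _ q_in[OF ab]])
        show "t (a, b) \<in> U (Sec Q b)"
          using span_families_in[OF _ ab] t by metis
        fix k assume k: "k \<in> Arr X" "Cod X k = Dom X b" "Cmp X a k \<in> S"
        have *: "a \<in> Arr X" "b \<in> Arr X" "Cod X a = A" "Cod X b = x" "Dom X a = Dom X b"
          using ab by (simp_all add: spans_iff)
        have "Res Q (Cmp X b k, k, b) (t (a, b)) = t (Cmp X a k, Cmp X b k)"
          using span_families_natural[OF _ ab k(1,2)] t by metis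
        also have "\<dots> = span_res X x (Cmp X a k) t (Ide X (Dom X k), Cmp X b k)"
          using * k X by (subst span_res_apply) (simp_all add: spans_iff)
        also have "\<dots> = v a b k"
          using t k by (simp add: v_def)
        finally show "Res Q (Cmp X b k, k, b) (t (a, b)) = Res Q (Cmp X b k, k, b) (q (a, b))"
          using q_v[OF ab k] by simp
      qed
      then show "t (a, b) = ?q (a, b)"
        using ab by simp
    qed (use t in blast)
  qed
qed

end

text \<open>The objects of \<open>X\<close> need not form a small set, and neither need the spans.
  By separation a family is determined by its values at the spans whose source lies in the small
  generating family \<open>G\<close>, and these spans form a small set.\<close>

lemma span_families_small:
  fixes X :: "('o, 'a) site"
  assumes univ: "universe U" and X: "U_site U X" and A: "A \<in> Obj X" and x: "x \<in> Obj X"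
    and Q: "sheaf U (slice X x) Q"
  shows "small U (span_families U X x Q A)"
proof -
  have cat: "category X" and top: "topology X (Cov X)"
    and small_hom: "\<And>a b. a \<in> Obj X \<Longrightarrow> b \<in> Obj X \<Longrightarrow> small U (hom X a b)"
    using X by (auto simp: U_site_def)
  obtain G where G: "G \<subseteq> Obj X" "small U G"
    and cov: "\<And>c. c \<in> Obj X \<Longrightarrow> covering_family X c {f \<in> arrows_to X c. Dom X f \<in> G}"
    using X unfolding U_site_def by blast
  let ?I = "{p \<in> spans X x A. Dom X (snd p) \<in> G}"
  \<comment> \<open>Tagging a span with its source embeds the set into a small sum of products of
    morphism sets.\<close>
  have "small U ?I"
  proof (rule small_inj[OF univ])
    show "small U (SIGMA B:G. hom X B A \<times> hom X B x)"
      using G small_hom A x by (intro small_Sigma univ) auto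
    show "inj_on (\<lambda>p. (Dom X (snd p), p)) ?I"
      by (rule inj_onI) simp
    show "(\<lambda>p. (Dom X (snd p), p)) ` ?I \<subseteq> (SIGMA B:G. hom X B A \<times> hom X B x)"
      by (auto simp: spans_iff hom_iff)
  qed
  then have "small U (\<Pi>\<^sub>E p\<in>?I. U (Sec Q (snd p)))"
    using small_iff[OF univ] by (intro small_PiE univ) auto
  moreover have "(\<lambda>q. restrict q ?I) ` span_families U X x Q A \<subseteq> (\<Pi>\<^sub>E p\<in>?I. U (Sec Q (snd p)))"
  proof (rule image_subsetI, rule PiE_I)
    show "restrict q ?I p \<in> U (Sec Q (snd p))" if "q \<in> span_families U X x Q A" "p \<in> ?I" for q p
      using span_families_in[OF that(1), of "fst p" "snd p"] that(2) by simp
  qed auto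
  moreover have "inj_on (\<lambda>q. restrict q ?I) (span_families U X x Q A)"
  proof (rule inj_onI, rule span_families_eqI)
    fix q q' a b
    assume q: "q \<in> span_families U X x Q A" and q': "q' \<in> span_families U X x Q A"
      and eq: "restrict q ?I = restrict q' ?I" and ab: "(a, b) \<in> spans X x A"
    have *: "a \<in> Arr X" "b \<in> Arr X" "Cod X a = A" "Cod X b = x" "Dom X a = Dom X b"
      using ab by (simp_all add: spans_iff)
    let ?C = "{f \<in> arrows_to X (Dom X b). Dom X f \<in> G}"
    show "q (a, b) = q' (a, b)"
    proof (rule slice_sheaf_separated[OF cat top Q *(2,4)])
      show "generated_sieve X ?C \<in> Cov X (Dom X b)"
        using cov[of "Dom X b"] cat * by (simp add: covering_family_def)
      show "q (a, b) \<in> U (Sec Q b)" "q' (a, b) \<in> U (Sec Q b)"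
        using span_families_in[OF q ab] span_families_in[OF q' ab] .
      fix k assume "k \<in> generated_sieve X ?C"
      then obtain f g where k: "k = Cmp X f g" "f \<in> Arr X" "Cod X f = Dom X b" "Dom X f \<in> G"
        "g \<in> Arr X" "Cod X g = Dom X f"
        by (auto simp: generated_sieve_def arrows_to_iff)
      have sp: "(Cmp X a f, Cmp X b f) \<in> ?I"
        using * k cat by (simp add: spans_iff)
      \<comment> \<open>Here \<open>k\<close> is \<open>f\<close> after \<open>g\<close> with the
        source of \<open>f\<close> in \<open>G\<close>, so by naturality the restriction along
        \<open>k\<close> is computed from the value at a span of \<open>?I\<close>.\<close>
      have val: "Res Q (Cmp X b k, k, b) (r (a, b)) =
          Res Q (Cmp X (Cmp X b f) g, g, Cmp X b f) (r (Cmp X a f, Cmp X b f))"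
        if r: "r \<in> span_families U X x Q A" for r
      proof -
        have "Res Q (Cmp X b k, k, b) (r (a, b)) = r (Cmp X a k, Cmp X b k)"
          using span_families_natural[OF r ab, of k] k cat by simp
        also have "\<dots> = r (Cmp X (Cmp X a f) g, Cmp X (Cmp X b f) g)"
          using * k cat by (simp add: Cmp_assoc)
        also have "\<dots> = Res Q (Cmp X (Cmp X b f) g, g, Cmp X b f) (r (Cmp X a f, Cmp X b f))"
          using span_families_natural[OF r, of "Cmp X a f" "Cmp X b f" g] sp k cat * by simp
        finally show ?thesis .
      qed
      have "q (Cmp X a f, Cmp X b f) = q' (Cmp X a f, Cmp X b f)"
        using fun_cong[OF eq, of "(Cmp X a f, Cmp X b f)"] sp by simp
      then show "Res Q (Cmp X b k, k, b) (q (a, b)) = Res Q (Cmp X b k, k, b) (q' (a, b))"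
        using val[OF q] val[OF q'] by simp
    qed
  qed
  ultimately show ?thesis
    using small_inj[OF univ] by blast
qed

text \<open>\<open>J\<close> is the direct image of \<open>Q\<close> under the localization
  morphism, up to the bijections \<open>h\<close> that bring span families, which are functions,
  into the universe.\<close>

lemma span_families_sheaf:
  fixes X :: "('o, 'a) site"
  assumes univ: "universe U" and X: "U_site U X" and x: "x \<in> Obj X" and Q: "sheaf U (slice X x) Q"
  obtains J h where "sheaf U X J"
    "\<And>A. A \<in> Obj X \<Longrightarrow> bij_betw (h A) (span_families U X x Q A) (U (Sec J A))"
    "\<And>f A B q. f \<in> hom X A B \<Longrightarrow> B \<in> Obj X \<Longrightarrow> q \<in> span_families U X x Q B \<Longrightarrow>
       Res J f (h B q) = h A (span_res X x f q)"
proof -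
  have cat: "category X" and top: "topology X (Cov X)"
    using X by (auto simp: U_site_def)
  show thesis
  proof (rule represent_sheaf[OF cat top])
    show "small U (span_families U X x Q A)" if "A \<in> Obj X" for A
      by (rule span_families_small[OF univ X that x Q])
    show "span_res X x f q \<in> span_families U X x Q A"
      if "f \<in> hom X A B" "q \<in> span_families U X x Q B" for f A B q
      by (rule span_res_in[OF cat that])
    show "span_res X x (Ide X A) q = q" if A: "A \<in> Obj X" and q: "q \<in> span_families U X x Q A" for A q
    proof (rule span_families_eqI[OF span_res_in[OF cat Ide_in_hom[OF cat A] q] q])
      show "span_res X x (Ide X A) q (a, b) = q (a, b)" if "(a, b) \<in> spans X x A" for a b
        using that cat A by (simp add: span_res_apply spans_iff)
    qed
    show "span_res X x (Cmp X g f) q = span_res X x f (span_res X x g q)"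
      if f: "f \<in> hom X A B" and g: "g \<in> hom X B D" and q: "q \<in> span_families U X x Q D" for f g A B D q
    proof (rule span_families_eqI)
      show "span_res X x (Cmp X g f) q \<in> span_families U X x Q A"
        by (rule span_res_in[OF cat Cmp_in_hom[OF cat f g] q])
      show "span_res X x f (span_res X x g q) \<in> span_families U X x Q A"
        by (rule span_res_in[OF cat f span_res_in[OF cat g q]])
      show "span_res X x (Cmp X g f) q (a, b) = span_res X x f (span_res X x g q) (a, b)"
        if "(a, b) \<in> spans X x A" for a b
        using that cat f g by (simp add: span_res_apply spans_iff hom_iff Cmp_assoc)
    qed
    show "\<exists>!t. t \<in> span_families U X x Q A \<and> (\<forall>f\<in>S. span_res X x f t = s f)"
      if "A \<in> Obj X" "S \<in> Cov X A" "\<And>f. f \<in> S \<Longrightarrow> s f \<in> span_families U X x Q (Dom X f)"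
        "\<And>f g. f \<in> S \<Longrightarrow> g \<in> arrows_to X (Dom X f) \<Longrightarrow> span_res X x g (s f) = s (Cmp X f g)" for A S s
      by (rule span_families_glue[OF cat top Q that])
  qed (fact that)
qed

text \<open>
  Below, the source of \<open>v(V)\<close> is a product of \<open>w(V)\<close> and \<open>x\<close>, so that the direct image of \<open>Q\<close> under the
  localization morphism has the sections \<open>Q(v(V))\<close> over \<open>w(V)\<close>.
\<close>

lemma slice_universal_arrow:
  fixes X :: "('o, 'a) site" and C :: "('p, 'b, 'z) site_scheme"
  assumes univ: "universe U" and X: "U_site U X" and x: "x \<in> Obj X"
    and C: "category C" and F: "presheaf U C F" and w: "is_functor C X w"
    and G\<alpha>: "universal_arrow U C X w F G \<alpha>"
    and v_Obj: "\<And>V. V \<in> Obj C \<Longrightarrow> fobj v V \<in> arrows_to X x"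
    and p: "\<And>V. V \<in> Obj C \<Longrightarrow> p V \<in> hom X (Dom X (fobj v V)) (fobj w V)"
    and v_Arr: "\<And>f V' V. f \<in> hom C V' V \<Longrightarrow> \<exists>k\<in>hom X (Dom X (fobj v V')) (Dom X (fobj v V)).
       farr v f = (fobj v V', k, fobj v V) \<and> Cmp X (fobj v V) k = fobj v V' \<and>
       Cmp X (p V) k = Cmp X (farr w f) (p V')"
    and prod: "\<And>V a b. V \<in> Obj C \<Longrightarrow> (a, b) \<in> spans X x (fobj w V) \<Longrightarrow>
       \<exists>!k. k \<in> hom X (Dom X b) (Dom X (fobj v V)) \<and> Cmp X (p V) k = a \<and> Cmp X (fobj v V) k = b"
  shows "universal_arrow U C (slice X x) v F (direct (slice_forget X) G)
           (\<lambda>V\<in>Obj C. \<lambda>s\<in>U (Sec F V). Res G (p V) (\<alpha> V s))"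
proof -
  have cat: "category X" and top: "topology X (Cov X)"
    using X by (auto simp: U_site_def)
  note slice_cat = slice_category[OF cat]
  have G: "sheaf U X G" and \<alpha>: "\<alpha> \<in> pmor U C F (direct w G)"
    using G\<alpha> by (simp_all add: universal_arrow_def)
  note Gpre = sheaf_presheaf[OF G]
  have \<alpha>_in: "\<alpha> V s \<in> U (Sec G (fobj w V))" if "V \<in> Obj C" "s \<in> U (Sec F V)" for V s
    using pmor_in[OF \<alpha> that] by simp
  have v: "fobj v V \<in> Arr X" "Cod X (fobj v V) = x" if "V \<in> Obj C" for V
    using v_Obj[OF that] by (simp_all add: arrows_to_iff)
  \<comment> \<open>By \<open>prod\<close>, the source of \<open>fobj v V\<close> is a product of
    \<open>fobj w V\<close> and \<open>x\<close>; this is the arrow into it with components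
    \<open>a\<close> and \<open>b\<close>.\<close>
  define pair where "pair V a b =
    (THE k. k \<in> hom X (Dom X b) (Dom X (fobj v V)) \<and> Cmp X (p V) k = a \<and> Cmp X (fobj v V) k = b)" for V a b
  have pair: "pair V a b \<in> hom X (Dom X b) (Dom X (fobj v V))" "Cmp X (p V) (pair V a b) = a"
    "Cmp X (fobj v V) (pair V a b) = b" if "V \<in> Obj C" "(a, b) \<in> spans X x (fobj w V)" for V a b
    using theI'[OF prod[OF that]] by (auto simp: pair_def)
  have pair_eqI: "pair V a b = k" if "V \<in> Obj C" "k \<in> hom X B (Dom X (fobj v V))"
    "Cmp X (p V) k = a" "Cmp X (fobj v V) k = b" for V k a b B
  proof -
    have "(a, b) \<in> spans X x (fobj w V)"
      using that v p[OF that(1)] cat by (auto simp: spans_iff hom_iff)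
    moreover have "k \<in> hom X (Dom X b) (Dom X (fobj v V))"
      using that v p[OF that(1)] cat by (auto simp: hom_iff)
    ultimately show ?thesis
      using prod[OF that(1)] pair[OF that(1)] that(3,4) by blast
  qed
  let ?\<alpha> = "\<lambda>V\<in>Obj C. \<lambda>s\<in>U (Sec F V). Res G (p V) (\<alpha> V s)"
  have \<alpha>'_in: "Res G (p V) (\<alpha> V s) \<in> U (Sec G (Dom X (fobj v V)))" if "V \<in> Obj C" "s \<in> U (Sec F V)" for V s
    using Res_in[OF Gpre p \<alpha>_in] that by blast
  have \<alpha>': "?\<alpha> \<in> pmor U C F (direct v (direct (slice_forget X) G))"
  proof (rule pmorI[OF _ _ C F])
    fix f V' V s assume f: "f \<in> hom C V' V" and V: "V' \<in> Obj C" "V \<in> Obj C" and s: "s \<in> U (Sec F V)"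
    obtain k where k: "k \<in> hom X (Dom X (fobj v V')) (Dom X (fobj v V))"
      "farr v f = (fobj v V', k, fobj v V)" "Cmp X (p V) k = Cmp X (farr w f) (p V')"
      using v_Arr[OF f] by blast
    have "Res G (p V') (\<alpha> V' (Res F f s)) = Res G (p V') (Res G (farr w f) (\<alpha> V s))"
      using pmor_Res[OF \<alpha> f s] by simp
    also have "\<dots> = Res G (Cmp X (farr w f) (p V')) (\<alpha> V s)"
      using Res_Cmp[OF Gpre p[OF V(1)] functor_hom[OF w f] \<alpha>_in[OF V(2) s]] by simp
    also have "\<dots> = Res G k (Res G (p V) (\<alpha> V s))"
      using Res_Cmp[OF Gpre k(1) p[OF V(2)] \<alpha>_in[OF V(2) s]] k(3) by simp
    finally show "Res G (p V') (\<alpha> V' (Res F f s)) =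
        Res (direct v (direct (slice_forget X) G)) f (Res G (p V) (\<alpha> V s))"
      using k(2) by simp
  qed (use \<alpha>'_in in simp)
  show ?thesis
    unfolding universal_arrow_def
  proof (intro conjI allI impI ballI slice_forget_sheaf cat G \<alpha>')
    fix Q m assume Q: "sheaf U (slice X x) Q" and m: "m \<in> pmor U C F (direct v Q)"
    note Qpre = sheaf_presheaf[OF Q]
    have m_in: "m V s \<in> U (Sec Q (fobj v V))" if "V \<in> Obj C" "s \<in> U (Sec F V)" for V s
      using pmor_in[OF m that] by simp
    obtain J h where J: "sheaf U X J"
      and h: "\<And>A. A \<in> Obj X \<Longrightarrow> bij_betw (h A) (span_families U X x Q A) (U (Sec J A))"
      and Jh: "\<And>f A B q. f \<in> hom X A B \<Longrightarrow> B \<in> Obj X \<Longrightarrow> q \<in> span_families U X x Q B \<Longrightarrow>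
       Res J f (h B q) = h A (span_res X x f q)"
      using span_families_sheaf[OF univ X x Q] by metis
    define g where "g A = inv_into (span_families U X x Q A) (h A)" for A
    have h_in: "h A q \<in> U (Sec J A)" and gh: "g A (h A q) = q"
      if "A \<in> Obj X" "q \<in> span_families U X x Q A" for A q
      using h[OF that(1)] that(2) unfolding g_def bij_betw_def by auto
    have g_in: "g A t \<in> span_families U X x Q A" and hg: "h A (g A t) = t"
      if "A \<in> Obj X" "t \<in> U (Sec J A)" for A t
      using h[OF that(1)] that(2) unfolding g_def bij_betw_def
      by (auto simp: inv_into_into f_inv_into_f)
    \<comment> \<open>The adjunct of \<open>m\<close>: over \<open>fobj w V\<close>, its value at a
      span is the restriction of \<open>m V s\<close> along the arrow to the product that the span
      defines.\<close>
    let ?q = "\<lambda>V s p. Res Q (snd p, pair V (fst p) (snd p), fobj v V) (m V s)"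
    let ?m = "\<lambda>V s. \<lambda>p\<in>spans X x (fobj w V). ?q V s p"
    have slice_pair: "(b, pair V a b, fobj v V) \<in> hom (slice X x) b (fobj v V)"
      if "V \<in> Obj C" "(a, b) \<in> spans X x (fobj w V)" for V a b
      using pair[OF that] that v_Obj[OF that(1)] unfolding slice_hom_iff
      by (auto simp: spans_iff arrows_to_iff)
    have m_fam: "?m V s \<in> span_families U X x Q (fobj w V)" if V: "V \<in> Obj C" and s: "s \<in> U (Sec F V)" for V s
    proof (rule span_familiesI[OF _ _ cat])
      show "?q V s (a, b) \<in> U (Sec Q b)" if "(a, b) \<in> spans X x (fobj w V)" for a b
        using Res_in[OF Qpre slice_pair[OF V that] m_in[OF V s]] by simp
      fix a b k assume ab: "(a, b) \<in> spans X x (fobj w V)" and k: "k \<in> Arr X" "Cod X k = Dom X b"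
      have *: "a \<in> Arr X" "b \<in> Arr X" "Cod X b = x" "Dom X a = Dom X b"
        using ab by (simp_all add: spans_iff)
      note pr = pair[OF V ab]
      have pr': "pair V a b \<in> Arr X" "Dom X (pair V a b) = Dom X b" "Cod X (pair V a b) = Dom X (fobj v V)"
        using pr(1) by (simp_all add: hom_iff)
      have "pair V (Cmp X a k) (Cmp X b k) = Cmp X (pair V a b) k"
      proof (rule pair_eqI[OF V])
        show "Cmp X (pair V a b) k \<in> hom X (Dom X k) (Dom X (fobj v V))"
          using pr' k cat by (simp add: hom_iff)
        have "Cmp X (p V) (Cmp X (pair V a b) k) = Cmp X (Cmp X (p V) (pair V a b)) k"
          using pr' k cat p[OF V] by (subst Cmp_assoc) (simp_all add: hom_iff)
        then show "Cmp X (p V) (Cmp X (pair V a b) k) = Cmp X a k"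
          using pr(2) by simp
        have "Cmp X (fobj v V) (Cmp X (pair V a b) k) = Cmp X (Cmp X (fobj v V) (pair V a b)) k"
          using pr' k cat v[OF V] by (subst Cmp_assoc) (simp_all add: hom_iff)
        then show "Cmp X (fobj v V) (Cmp X (pair V a b) k) = Cmp X b k"
          using pr(3) by simp
      qed
      moreover have "(Cmp X b k, k, b) \<in> hom (slice X x) (Cmp X b k) b"
        by (rule slice_arrow[OF cat]) (use * k in \<open>simp_all add: arrows_to_iff\<close>)
      ultimately show "?q V s (Cmp X a k, Cmp X b k) = Res Q (Cmp X b k, k, b) (?q V s (a, b))"
        using Res_Cmp[OF Qpre _ slice_pair[OF V ab] m_in[OF V s], of "(Cmp X b k, k, b)" "Cmp X b k"]
        by (simp add: slice_simps)
    qed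
    have wV: "fobj w V \<in> Obj X" if "V \<in> Obj C" for V
      using w that by (simp add: functor_simps)
    have "(\<lambda>V\<in>Obj C. \<lambda>s\<in>U (Sec F V). h (fobj w V) (?m V s)) \<in> pmor U C F (direct w J)"
    proof (rule pmorI[OF _ _ C F])
      show "h (fobj w V) (?m V s) \<in> U (Sec (direct w J) V)" if "V \<in> Obj C" "s \<in> U (Sec F V)" for V s
        using h_in[OF wV m_fam] that by simp
      fix f V' V s assume f: "f \<in> hom C V' V" and V: "V' \<in> Obj C" "V \<in> Obj C" and s: "s \<in> U (Sec F V)"
      obtain k where k: "k \<in> hom X (Dom X (fobj v V')) (Dom X (fobj v V))"
        "farr v f = (fobj v V', k, fobj v V)" "Cmp X (fobj v V) k = fobj v V'"
        "Cmp X (p V) k = Cmp X (farr w f) (p V')"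
        using v_Arr[OF f] by blast
      note wf = functor_hom[OF w f]
      have Fs: "Res F f s \<in> U (Sec F V')"
        using Res_in[OF F f s] .
      have "span_res X x (farr w f) (?m V s) = ?m V' (Res F f s)"
      proof (rule span_families_eqI[OF span_res_in[OF cat wf m_fam[OF V(2) s]] m_fam[OF V(1) Fs]])
        fix a b assume ab: "(a, b) \<in> spans X x (fobj w V')"
        have ab': "(Cmp X (farr w f) a, b) \<in> spans X x (fobj w V)"
          using ab wf cat by (simp add: spans_iff hom_iff)
        note pr = pair[OF V(1) ab]
        have pk: "pair V (Cmp X (farr w f) a) b = Cmp X k (pair V' a b)"
        proof (rule pair_eqI[OF V(2)])
          show "Cmp X k (pair V' a b) \<in> hom X (Dom X b) (Dom X (fobj v V))"
            by (rule Cmp_in_hom[OF cat pr(1) k(1)])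
          have "Cmp X (p V) (Cmp X k (pair V' a b)) = Cmp X (Cmp X (p V) k) (pair V' a b)"
            using pr(1) k(1) p[OF V(2)] cat by (subst Cmp_assoc) (simp_all add: hom_iff)
          also have "\<dots> = Cmp X (farr w f) (Cmp X (p V') (pair V' a b))"
            unfolding k(4) using pr(1) wf p[OF V(1)] cat by (subst Cmp_assoc) (simp_all add: hom_iff)
          finally show "Cmp X (p V) (Cmp X k (pair V' a b)) = Cmp X (farr w f) a"
            using pr(2) by simp
          have "Cmp X (fobj v V) (Cmp X k (pair V' a b)) = Cmp X (Cmp X (fobj v V) k) (pair V' a b)"
            using pr(1) k(1) v[OF V(2)] cat by (subst Cmp_assoc) (simp_all add: hom_iff)
          then show "Cmp X (fobj v V) (Cmp X k (pair V' a b)) = b"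
            using k(3) pr(3) by simp
        qed
        have vf: "(fobj v V', k, fobj v V) \<in> hom (slice X x) (fobj v V') (fobj v V)"
          unfolding slice_hom_iff using k v_Obj V by simp
        have "?q V' (Res F f s) (a, b) = Res Q (b, pair V' a b, fobj v V') (Res Q (fobj v V', k, fobj v V) (m V s))"
          using pmor_Res[OF m f s] k(2) by simp
        also have "\<dots> = ?q V s (Cmp X (farr w f) a, b)"
          using Res_Cmp[OF Qpre slice_pair[OF V(1) ab] vf m_in[OF V(2) s]] by (simp add: slice_simps pk)
        finally show "span_res X x (farr w f) (?m V s) (a, b) = ?m V' (Res F f s) (a, b)"
          using ab ab' wf by (simp add: span_res_apply hom_iff)
      qed
      then show "h (fobj w V') (?m V' (Res F f s)) = Res (direct w J) f (h (fobj w V) (?m V s))"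
        using Jh[OF wf wV[OF V(2)] m_fam[OF V(2) s]] by simp
    qed
    \<comment> \<open>The universal property of \<open>G\<close> in \<open>X\<close> extends the
      adjunct to a morphism from \<open>G\<close> to the direct image of \<open>Q\<close>; it
      remains to pass back to the slice.\<close>
    from G\<alpha> J this obtain N where N: "N \<in> pmor U X G J"
      and N\<alpha>': "\<And>V s. V \<in> Obj C \<Longrightarrow> s \<in> U (Sec F V) \<Longrightarrow> N (fobj w V) (\<alpha> V s) =
        (\<lambda>V\<in>Obj C. \<lambda>s\<in>U (Sec F V). h (fobj w V) (?m V s)) V s"
      by (rule universal_arrow_factor) (rule that)
    have N\<alpha>: "N (fobj w V) (\<alpha> V s) = h (fobj w V) (?m V s)" if "V \<in> Obj C" "s \<in> U (Sec F V)" for V s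
      using N\<alpha>'[OF that] that by simp
    \<comment> \<open>The counit of the localization: a family over the source of \<open>b\<close>
      is evaluated at the span formed by the identity and \<open>b\<close>.\<close>
    let ?n = "\<lambda>b t. g (Dom X b) (N (Dom X b) t) (Ide X (Dom X b), b)"
    have n: "(\<lambda>b\<in>Obj (slice X x). \<lambda>t\<in>U (Sec (direct (slice_forget X) G) b). ?n b t)
        \<in> pmor U (slice X x) (direct (slice_forget X) G) Q"
    proof (rule pmorI[OF _ _ slice_cat sheaf_presheaf[OF slice_forget_sheaf[OF cat G]]])
      fix b t assume b: "b \<in> Obj (slice X x)" and t: "t \<in> U (Sec (direct (slice_forget X) G) b)"
      have b': "b \<in> Arr X" "Cod X b = x" "Dom X b \<in> Obj X"
        using b cat by (simp_all add: slice_simps arrows_to_iff)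
      have "(Ide X (Dom X b), b) \<in> spans X x (Dom X b)"
        using b' cat by (simp add: spans_iff)
      then show "?n b t \<in> U (Sec Q b)"
        using span_families_in[OF g_in[OF b'(3) pmor_in[OF N b'(3)]]] t by simp
    next
      fix f b' b t assume f: "f \<in> hom (slice X x) b' b" and t: "t \<in> U (Sec (direct (slice_forget X) G) b)"
      obtain k where k: "k \<in> hom X (Dom X b') (Dom X b)" "f = (b', k, b)" "Cmp X b k = b'"
        and b: "b \<in> Arr X" "Cod X b = x" "b' \<in> Arr X" "Cod X b' = x"
        using f unfolding slice_hom_iff by (auto simp: arrows_to_iff)
      have Ob: "Dom X b \<in> Obj X" "Dom X b' \<in> Obj X"
        using b cat by simp_all
      have t': "t \<in> U (Sec G (Dom X b))"
        using t by simp
      define q where "q = g (Dom X b) (N (Dom X b) t)"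
      have q: "q \<in> span_families U X x Q (Dom X b)" "N (Dom X b) t = h (Dom X b) q"
        using g_in[OF Ob(1) pmor_in[OF N Ob(1) t']] hg[OF Ob(1) pmor_in[OF N Ob(1) t']]
        by (simp_all add: q_def)
      have "g (Dom X b') (N (Dom X b') (Res G k t)) = span_res X x k q"
        using pmor_Res[OF N k(1) t'] Jh[OF k(1) Ob(1) q(1)] q(2)
          gh[OF Ob(2) span_res_in[OF cat k(1) q(1)]] by simp
      moreover have "span_res X x k q (Ide X (Dom X b'), b') = q (k, b')"
        using k b cat by (subst span_res_apply) (auto simp: spans_iff hom_iff)
      moreover have "q (k, b') = Res Q (b', k, b) (q (Ide X (Dom X b), b))"
        using span_families_natural[OF q(1), of "Ide X (Dom X b)" b k] k b cat
        by (auto simp: spans_iff hom_iff)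
      ultimately show "?n b' (Res (direct (slice_forget X) G) f t) = Res Q f (?n b t)"
        using k(2) by (simp add: q_def)
    qed
    have "?n (fobj v V) (Res G (p V) (\<alpha> V s)) = m V s" if V: "V \<in> Obj C" and s: "s \<in> U (Sec F V)" for V s
    proof -
      have O: "Dom X (fobj v V) \<in> Obj X"
        using v[OF V] cat by simp
      have sp: "(p V, fobj v V) \<in> spans X x (fobj w V)"
        using p[OF V] v[OF V] by (simp add: spans_iff hom_iff)
      have "N (Dom X (fobj v V)) (Res G (p V) (\<alpha> V s)) = h (Dom X (fobj v V)) (span_res X x (p V) (?m V s))"
        using pmor_Res[OF N p[OF V] \<alpha>_in[OF V s]] N\<alpha>[OF V s] Jh[OF p[OF V] wV[OF V] m_fam[OF V s]] by simp
      then have "?n (fobj v V) (Res G (p V) (\<alpha> V s)) =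
          span_res X x (p V) (?m V s) (Ide X (Dom X (fobj v V)), fobj v V)"
        using gh[OF O span_res_in[OF cat p[OF V] m_fam[OF V s]]] by simp
      also have "\<dots> = ?m V s (p V, fobj v V)"
        using p[OF V] v[OF V] O cat by (subst span_res_apply) (auto simp: spans_iff hom_iff)
      \<comment> \<open>The two projections form the span whose arrow to the product is the
        identity.\<close>
      also have "\<dots> = Res Q (fobj v V, Ide X (Dom X (fobj v V)), fobj v V) (m V s)"
        using sp pair_eqI[OF V Ide_in_hom[OF cat O], of "p V" "fobj v V"] p[OF V] v[OF V] cat
        by (simp add: hom_iff)
      also have "\<dots> = m V s"
        by (rule slice_Res_Ide[OF cat top Q v[OF V] m_in[OF V s]])
      finally show ?thesis .
    qed
    then show "\<exists>n\<in>pmor U (slice X x) (direct (slice_forget X) G) Q.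
        \<forall>V\<in>Obj C. \<forall>s\<in>U (Sec F V). n (fobj v V) (?\<alpha> V s) = m V s"
      using v_Obj \<alpha>'_in by (intro bexI[OF _ n] ballI) (simp add: slice_simps)
  next
    fix Q n n' assume Q: "sheaf U (slice X x) Q"
      and n: "n \<in> pmor U (slice X x) (direct (slice_forget X) G) Q"
      and n': "n' \<in> pmor U (slice X x) (direct (slice_forget X) G) Q"
      and eq: "\<forall>V\<in>Obj C. \<forall>s\<in>U (Sec F V). n (fobj v V) (?\<alpha> V s) = n' (fobj v V) (?\<alpha> V s)"
    obtain J h where J: "sheaf U X J"
      and h: "\<And>A. A \<in> Obj X \<Longrightarrow> bij_betw (h A) (span_families U X x Q A) (U (Sec J A))"
      and Jh: "\<And>f A B q. f \<in> hom X A B \<Longrightarrow> B \<in> Obj X \<Longrightarrow> q \<in> span_families U X x Q B \<Longrightarrow>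
       Res J f (h B q) = h A (span_res X x f q)"
      using span_families_sheaf[OF univ X x Q] by metis
    \<comment> \<open>For uniqueness, a morphism \<open>r\<close> from the restriction of
      \<open>G\<close> to \<open>Q\<close> is replaced by its adjunct from \<open>G\<close> to
      \<open>J\<close>, so that the universal property of \<open>G\<close> can separate
      \<open>n\<close> and \<open>n'\<close>.\<close>
    let ?q = "\<lambda>r t p. r (snd p) (Res G (fst p) t)"
    let ?N = "\<lambda>r A t. \<lambda>p\<in>spans X x A. ?q r t p"
    have r_in: "r b (Res G a t) \<in> U (Sec Q b)"
      if r: "r \<in> pmor U (slice X x) (direct (slice_forget X) G) Q"
        and t: "t \<in> U (Sec G A)" and ab: "(a, b) \<in> spans X x A" for r A t a b
    proof -
      have "a \<in> hom X (Dom X b) A" "b \<in> Obj (slice X x)"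
        using ab by (auto simp: spans_iff hom_iff slice_simps arrows_to_iff)
      then show ?thesis
        using pmor_in[OF r] Res_in[OF Gpre _ t] by simp
    qed
    have N_fam: "?N r A t \<in> span_families U X x Q A"
      if r: "r \<in> pmor U (slice X x) (direct (slice_forget X) G) Q" and t: "t \<in> U (Sec G A)" for r A t
    proof (rule span_familiesI[OF _ _ cat])
      show "?q r t (a, b) \<in> U (Sec Q b)" if "(a, b) \<in> spans X x A" for a b
        using r_in[OF r t that] by simp
      fix a b k assume ab: "(a, b) \<in> spans X x A" and k: "k \<in> Arr X" "Cod X k = Dom X b"
      have hom: "a \<in> hom X (Dom X b) A" "k \<in> hom X (Dom X k) (Dom X b)"
        and sl: "(Cmp X b k, k, b) \<in> hom (slice X x) (Cmp X b k) b"
        using ab k slice_arrow[OF cat, of b x k] by (auto simp: spans_iff hom_iff arrows_to_iff)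
      show "?q r t (Cmp X a k, Cmp X b k) = Res Q (Cmp X b k, k, b) (?q r t (a, b))"
        using Res_Cmp[OF Gpre hom(2,1) t] pmor_Res[OF r sl, of "Res G a t"] Res_in[OF Gpre hom(1) t]
        by simp
    qed
    have N: "(\<lambda>A\<in>Obj X. \<lambda>t\<in>U (Sec G A). h A (?N r A t)) \<in> pmor U X G J"
      if r: "r \<in> pmor U (slice X x) (direct (slice_forget X) G) Q" for r
    proof (rule pmorI[OF _ _ cat Gpre])
      show "h A (?N r A t) \<in> U (Sec J A)" if "A \<in> Obj X" "t \<in> U (Sec G A)" for A t
        using h[OF that(1)] N_fam[OF r that(2)] by (auto simp: bij_betw_def)
      fix f A B t assume f: "f \<in> hom X A B" and B: "B \<in> Obj X" and t: "t \<in> U (Sec G B)"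
      note ft = Res_in[OF Gpre f t]
      have "span_res X x f (?N r B t) = ?N r A (Res G f t)"
      proof (rule span_families_eqI[OF span_res_in[OF cat f N_fam[OF r t]] N_fam[OF r ft]])
        fix a b assume ab: "(a, b) \<in> spans X x A"
        then have ab': "(Cmp X f a, b) \<in> spans X x B" and a: "a \<in> hom X (Dom X b) A"
          using f cat by (auto simp: spans_iff hom_iff)
        show "span_res X x f (?N r B t) (a, b) = ?N r A (Res G f t) (a, b)"
          using ab ab' f Res_Cmp[OF Gpre a f t] by (simp add: span_res_apply hom_iff)
      qed
      then show "h A (?N r A (Res G f t)) = Res J f (h B (?N r B t))"
        using Jh[OF f B N_fam[OF r t]] by simp
    qed
    have "(\<lambda>A\<in>Obj X. \<lambda>t\<in>U (Sec G A). h A (?N n A t)) = (\<lambda>A\<in>Obj X. \<lambda>t\<in>U (Sec G A). h A (?N n' A t))"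
    proof (rule universal_arrow_eqI[OF G\<alpha> J N[OF n] N[OF n']])
      fix V s assume V: "V \<in> Obj C" and s: "s \<in> U (Sec F V)"
      \<comment> \<open>By naturality of \<open>r\<close>, the value at any span over
        \<open>fobj w V\<close> comes from the value at the product, where \<open>n\<close> and
        \<open>n'\<close> agree.\<close>
      have val: "r b (Res G a (\<alpha> V s)) = Res Q (b, pair V a b, fobj v V) (r (fobj v V) (?\<alpha> V s))"
        if r: "r \<in> pmor U (slice X x) (direct (slice_forget X) G) Q"
          and ab: "(a, b) \<in> spans X x (fobj w V)" for r a b
      proof -
        note pr = pair[OF V ab]
        have "Res G a (\<alpha> V s) = Res G (pair V a b) (Res G (p V) (\<alpha> V s))"
          using Res_Cmp[OF Gpre pr(1) p[OF V] \<alpha>_in[OF V s]] pr(2) by simp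
        moreover have "(b, pair V a b, fobj v V) \<in> hom (slice X x) b (fobj v V)"
          using pr ab v_Obj[OF V] unfolding slice_hom_iff by (auto simp: spans_iff arrows_to_iff)
        ultimately show ?thesis
          using pmor_Res[OF r, of "(b, pair V a b, fobj v V)" b "fobj v V"] \<alpha>'_in[OF V s] V s by simp
      qed
      have "n b (Res G a (\<alpha> V s)) = n' b (Res G a (\<alpha> V s))" if "(a, b) \<in> spans X x (fobj w V)" for a b
        using val[OF n that] val[OF n' that] eq V s by simp
      then have "?N n (fobj w V) (\<alpha> V s) = ?N n' (fobj w V) (\<alpha> V s)"
        by (intro restrict_ext) auto
      then show "(\<lambda>A\<in>Obj X. \<lambda>t\<in>U (Sec G A). h A (?N n A t)) (fobj w V) (\<alpha> V s) =
          (\<lambda>A\<in>Obj X. \<lambda>t\<in>U (Sec G A). h A (?N n' A t)) (fobj w V) (\<alpha> V s)"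
        using \<alpha>_in[OF V s] functor_Obj[OF w V] by simp
    qed
    note NN = this
    have "h A (?N n A t) = h A (?N n' A t)" if "A \<in> Obj X" "t \<in> U (Sec G A)" for A t
      using fun_cong[OF fun_cong[OF NN, of A], of t] that by simp
    then have N_eq: "?N n A t = ?N n' A t" if "A \<in> Obj X" "t \<in> U (Sec G A)" for A t
      using h[OF that(1)] N_fam[OF n that(2)] N_fam[OF n' that(2)] that
      unfolding bij_betw_def inj_on_def by blast
    show "n = n'"
    proof (rule pmor_eqI[OF n n'])
      fix b t assume b: "b \<in> Obj (slice X x)" and t: "t \<in> U (Sec (direct (slice_forget X) G) b)"
      have b': "b \<in> Arr X" "Cod X b = x" "Dom X b \<in> Obj X"
        using b cat by (simp_all add: slice_simps arrows_to_iff)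
      \<comment> \<open>Evaluating the adjunct at this span gives back \<open>n b t\<close>.\<close>
      have sp: "(Ide X (Dom X b), b) \<in> spans X x (Dom X b)"
        using b' cat by (simp add: spans_iff)
      have "t \<in> U (Sec G (Dom X b))"
        using t by simp
      with fun_cong[OF N_eq[OF b'(3)], of t "(Ide X (Dom X b), b)"] show "n b t = n' b t"
        using sp Res_Ide[OF Gpre b'(3)] by simp
    qed
  qed
qed

section \<open>Finite limits\<close>

lemma functor_fcomp:
  assumes u: "is_functor A B u" and v: "is_functor B C v"
  shows "is_functor A C (fcomp v u)"
  unfolding is_functor_def
proof (intro conjI ballI impI)
  fix c assume "c \<in> Obj A"
  then show "fobj (fcomp v u) c \<in> Obj C" "farr (fcomp v u) (Ide A c) = Ide C (fobj (fcomp v u) c)"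
    using u v by (simp_all add: fcomp_def functor_simps)
next
  fix f assume "f \<in> Arr A"
  then show "farr (fcomp v u) f \<in> hom C (fobj (fcomp v u) (Dom A f)) (fobj (fcomp v u) (Cod A f))"
    using u v by (simp add: fcomp_def functor_simps hom_iff)
next
  fix f g assume "f \<in> Arr A" "g \<in> Arr A" "Dom A g = Cod A f"
  then show "farr (fcomp v u) (Cmp A g f) = Cmp C (farr (fcomp v u) g) (farr (fcomp v u) f)"
    using u v by (simp add: fcomp_def functor_simps functor_Cmp)
qed

text \<open>Limits over this shape and the next two are final objects, products and fibre
  products.\<close>

definition empty_cat :: "(nat, nat) cat" where
  "empty_cat = \<lparr>Obj = {}, Arr = {}, Dom = id, Cod = id, Ide = id, Cmp = (\<lambda>g f. f)\<rparr>"

definition pair_cat :: "(nat, nat) cat" where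
  "pair_cat = \<lparr>Obj = {0, 1}, Arr = {0, 1}, Dom = id, Cod = id, Ide = id, Cmp = (\<lambda>g f. f)\<rparr>"

text \<open>The arrows 3 and 4 of \<open>cospan_cat\<close> go from 0 and 1 to 2; the other ones are identities.\<close>

definition cospan_cat :: "(nat, nat) cat" where
  "cospan_cat = \<lparr>Obj = {0, 1, 2}, Arr = {0, 1, 2, 3, 4},
     Dom = (\<lambda>k. if k = 3 then 0 else if k = 4 then 1 else k), Cod = (\<lambda>k. if k < 3 then k else 2),
     Ide = id, Cmp = (\<lambda>g f. if g < 3 then f else g)\<rparr>"

lemma finite_category_empty_cat: "finite_category empty_cat"
  by (simp add: finite_category_def category_def empty_cat_def)

lemma finite_category_pair_cat: "finite_category pair_cat"
  by (simp add: finite_category_def category_def pair_cat_def hom_def)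

lemma finite_category_cospan_cat: "finite_category cospan_cat"
  by (simp add: finite_category_def category_def cospan_cat_def hom_def)

text \<open>A final object is a limit of the empty diagram, whose object and arrow parts, like the
  legs of the cone, are arbitrary.\<close>

lemma left_exact_final_obj:
  assumes "left_exact C D u" "final_obj C t"
  shows "final_obj D (fobj u t)"
proof -
  have "is_limit empty_cat C \<lparr>fobj = \<lambda>_. t, farr = undefined\<rparr> t undefined"
    using assms(2) by (simp add: is_limit_def is_cone_def empty_cat_def final_obj_def)
  moreover have "is_functor empty_cat C \<lparr>fobj = \<lambda>_. t, farr = undefined\<rparr>"
    by (simp add: is_functor_def empty_cat_def)
  ultimately obtain G where "is_limit empty_cat D G (fobj u t) (\<lambda>j. farr u (undefined j))"
    using assms(1) finite_category_empty_cat unfolding left_exact_def by blast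
  then show ?thesis
    by (simp add: is_limit_def is_cone_def empty_cat_def final_obj_def)
qed

section \<open>Products and fibre products as limits of diagrams\<close>

definition is_product ::
    "('o, 'a, 'z) cat_scheme \<Rightarrow> 'o \<Rightarrow> 'o \<Rightarrow> 'o \<Rightarrow> 'a \<Rightarrow> 'a \<Rightarrow> bool" where
  "is_product C a b l p q \<longleftrightarrow>
     l \<in> Obj C \<and> p \<in> hom C l a \<and> q \<in> hom C l b \<and>
     (\<forall>c\<in>Obj C. \<forall>f\<in>hom C c a. \<forall>g\<in>hom C c b. \<exists>!h. h \<in> hom C c l \<and> Cmp C p h = f \<and> Cmp C q h = g)"

definition is_pullback ::
    "('o, 'a, 'z) cat_scheme \<Rightarrow> 'a \<Rightarrow> 'a \<Rightarrow> 'o \<Rightarrow> 'a \<Rightarrow> 'a \<Rightarrow> bool" where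
  "is_pullback C f g l p q \<longleftrightarrow>
     l \<in> Obj C \<and> p \<in> hom C l (Dom C f) \<and> q \<in> hom C l (Dom C g) \<and> Cmp C f p = Cmp C g q \<and>
     (\<forall>c\<in>Obj C. \<forall>r\<in>hom C c (Dom C f). \<forall>s\<in>hom C c (Dom C g). Cmp C f r = Cmp C g s \<longrightarrow>
        (\<exists>!h. h \<in> hom C c l \<and> Cmp C p h = r \<and> Cmp C q h = s))"

definition pair_diagram :: "('o, 'a, 'z) cat_scheme \<Rightarrow> 'o \<Rightarrow> 'o \<Rightarrow> (nat, nat, 'o, 'a) fctr" where
  "pair_diagram C a b =
     \<lparr>fobj = (\<lambda>j. if j = 0 then a else b), farr = (\<lambda>j. Ide C (if j = 0 then a else b))\<rparr>"

definition cospan_diagram :: "('o, 'a, 'z) cat_scheme \<Rightarrow> 'a \<Rightarrow> 'a \<Rightarrow> (nat, nat, 'o, 'a) fctr" where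
  "cospan_diagram C f g =
     \<lparr>fobj = (\<lambda>j. if j = 0 then Dom C f else if j = 1 then Dom C g else Cod C f),
      farr = (\<lambda>k. if k = 0 then Ide C (Dom C f) else if k = 1 then Ide C (Dom C g)
                  else if k = 2 then Ide C (Cod C f) else if k = 3 then f else g)\<rparr>"

lemma limit_pair_cat_iff:
  assumes C: "category C" and G: "is_functor pair_cat C G"
  shows "is_limit pair_cat C G l \<pi> \<longleftrightarrow> is_product C (fobj G 0) (fobj G 1) l (\<pi> 0) (\<pi> 1)"
proof -
  have Ob: "fobj G 0 \<in> Obj C" "fobj G 1 \<in> Obj C"
    and Id: "farr G 0 = Ide C (fobj G 0)" "farr G 1 = Ide C (fobj G 1)"
    using G by (simp_all add: is_functor_def pair_cat_def)
  have cone: "is_cone pair_cat C G c \<theta> \<longleftrightarrow>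
      c \<in> Obj C \<and> \<theta> 0 \<in> hom C c (fobj G 0) \<and> \<theta> 1 \<in> hom C c (fobj G 1)" for c \<theta>
    using C Ob Id by (auto simp: is_cone_def pair_cat_def hom_iff)
  show ?thesis
  proof
    assume *: "is_limit pair_cat C G l \<pi>"
    show "is_product C (fobj G 0) (fobj G 1) l (\<pi> 0) (\<pi> 1)"
      unfolding is_product_def
    proof (intro conjI ballI)
      show "l \<in> Obj C" "\<pi> 0 \<in> hom C l (fobj G 0)" "\<pi> 1 \<in> hom C l (fobj G 1)"
        using * cone unfolding is_limit_def by blast+
      fix c f g assume "c \<in> Obj C" "f \<in> hom C c (fobj G 0)" "g \<in> hom C c (fobj G 1)"
      then have "is_cone pair_cat C G c (\<lambda>j. if j = 0 then f else g)"
        by (simp add: cone)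
      with * have "\<exists>!h. h \<in> hom C c l \<and> (\<forall>j\<in>Obj pair_cat. Cmp C (\<pi> j) h = (if j = 0 then f else g))"
        unfolding is_limit_def by blast
      then show "\<exists>!h. h \<in> hom C c l \<and> Cmp C (\<pi> 0) h = f \<and> Cmp C (\<pi> 1) h = g"
        by (simp add: pair_cat_def)
    qed
  next
    assume *: "is_product C (fobj G 0) (fobj G 1) l (\<pi> 0) (\<pi> 1)"
    show "is_limit pair_cat C G l \<pi>"
      unfolding is_limit_def
    proof (intro conjI allI impI)
      show "is_cone pair_cat C G l \<pi>"
        using * by (simp add: cone is_product_def)
      fix c \<theta> assume "is_cone pair_cat C G c \<theta>"
      then have "\<exists>!h. h \<in> hom C c l \<and> Cmp C (\<pi> 0) h = \<theta> 0 \<and> Cmp C (\<pi> 1) h = \<theta> 1"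
        using * unfolding cone is_product_def by blast
      then show "\<exists>!h. h \<in> hom C c l \<and> (\<forall>j\<in>Obj pair_cat. Cmp C (\<pi> j) h = \<theta> j)"
        by (simp add: pair_cat_def)
    qed
  qed
qed

text \<open>The leg at the corner \<open>2\<close> is forced by the one at \<open>0\<close> and
  drops out of the universal property, which leaves a fibre product together with the equation for
  that leg.\<close>

lemma limit_cospan_cat_iff:
  assumes C: "category C" and G: "is_functor cospan_cat C G"
  shows "is_limit cospan_cat C G l \<pi> \<longleftrightarrow>
    \<pi> 2 = Cmp C (farr G 3) (\<pi> 0) \<and> is_pullback C (farr G 3) (farr G 4) l (\<pi> 0) (\<pi> 1)"
proof -
  have Ob: "fobj G 0 \<in> Obj C" "fobj G 1 \<in> Obj C" "fobj G 2 \<in> Obj C"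
    and Id: "farr G 0 = Ide C (fobj G 0)" "farr G 1 = Ide C (fobj G 1)" "farr G 2 = Ide C (fobj G 2)"
    and G34: "farr G 3 \<in> hom C (fobj G 0) (fobj G 2)" "farr G 4 \<in> hom C (fobj G 1) (fobj G 2)"
    using G by (simp_all add: is_functor_def cospan_cat_def)
  have cone: "is_cone cospan_cat C G c \<theta> \<longleftrightarrow>
      c \<in> Obj C \<and> \<theta> 0 \<in> hom C c (fobj G 0) \<and> \<theta> 1 \<in> hom C c (fobj G 1) \<and>
      \<theta> 2 = Cmp C (farr G 3) (\<theta> 0) \<and> Cmp C (farr G 3) (\<theta> 0) = Cmp C (farr G 4) (\<theta> 1)" for c \<theta>
    using C Ob Id G34 by (auto simp: is_cone_def cospan_cat_def hom_iff)
  \<comment> \<open>A factorization that is correct at the corner \<open>0\<close> is automatically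
    correct at \<open>2\<close>.\<close>
  have cmp2: "Cmp C (\<theta> 2) h = Cmp C (farr G 3) (Cmp C (\<theta> 0) h)"
    if "is_cone cospan_cat C G l \<theta>" "h \<in> hom C c l" for \<theta> l c h
  proof -
    have "\<theta> 2 = Cmp C (farr G 3) (\<theta> 0)" "\<theta> 0 \<in> hom C l (fobj G 0)"
      using that(1) unfolding cone by blast+
    then show ?thesis
      using Cmp_assoc[OF C, of h "\<theta> 0" "farr G 3"] that(2) G34 by (simp add: hom_iff)
  qed
  have GD: "Dom C (farr G 3) = fobj G 0" "Dom C (farr G 4) = fobj G 1"
    using G34 by (simp_all add: hom_iff)
  show ?thesis
  proof
    assume *: "is_limit cospan_cat C G l \<pi>"
    then have **: "is_cone cospan_cat C G l \<pi>"
      by (simp add: is_limit_def)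
    have "is_pullback C (farr G 3) (farr G 4) l (\<pi> 0) (\<pi> 1)"
      unfolding is_pullback_def GD
    proof (intro conjI ballI impI)
      show "l \<in> Obj C" "\<pi> 0 \<in> hom C l (fobj G 0)" "\<pi> 1 \<in> hom C l (fobj G 1)"
        "Cmp C (farr G 3) (\<pi> 0) = Cmp C (farr G 4) (\<pi> 1)"
        using ** unfolding cone by blast+
      fix c r s assume rs: "c \<in> Obj C" "r \<in> hom C c (fobj G 0)" "s \<in> hom C c (fobj G 1)"
        "Cmp C (farr G 3) r = Cmp C (farr G 4) s"
      let ?\<theta> = "\<lambda>j::nat. if j = 0 then r else if j = 1 then s else Cmp C (farr G 3) r"
      have "is_cone cospan_cat C G c ?\<theta>"
        using rs by (simp add: cone)
      with * have ex1: "\<exists>!h. h \<in> hom C c l \<and> (\<forall>j\<in>Obj cospan_cat. Cmp C (\<pi> j) h = ?\<theta> j)"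
        unfolding is_limit_def by blast
      have "Cmp C (\<pi> 2) h = Cmp C (farr G 3) r" if "h \<in> hom C c l" "Cmp C (\<pi> 0) h = r" for h
        using cmp2[OF ** that(1)] that(2) by simp
      then have "(h \<in> hom C c l \<and> (\<forall>j\<in>Obj cospan_cat. Cmp C (\<pi> j) h = ?\<theta> j)) \<longleftrightarrow>
         h \<in> hom C c l \<and> Cmp C (\<pi> 0) h = r \<and> Cmp C (\<pi> 1) h = s" for h
        by (auto simp: cospan_cat_def)
      with ex1 show "\<exists>!h. h \<in> hom C c l \<and> Cmp C (\<pi> 0) h = r \<and> Cmp C (\<pi> 1) h = s"
        by simp
    qed
    then show "\<pi> 2 = Cmp C (farr G 3) (\<pi> 0) \<and> is_pullback C (farr G 3) (farr G 4) l (\<pi> 0) (\<pi> 1)"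
      using ** unfolding cone by blast
  next
    assume *: "\<pi> 2 = Cmp C (farr G 3) (\<pi> 0) \<and> is_pullback C (farr G 3) (farr G 4) l (\<pi> 0) (\<pi> 1)"
    then have **: "is_cone cospan_cat C G l \<pi>"
      by (simp add: cone is_pullback_def GD)
    show "is_limit cospan_cat C G l \<pi>"
      unfolding is_limit_def
    proof (intro conjI allI impI **)
      fix c \<theta> assume \<theta>: "is_cone cospan_cat C G c \<theta>"
      then have ex1: "\<exists>!h. h \<in> hom C c l \<and> Cmp C (\<pi> 0) h = \<theta> 0 \<and> Cmp C (\<pi> 1) h = \<theta> 1"
        using * unfolding cone is_pullback_def GD by blast
      have "Cmp C (\<pi> 2) h = \<theta> 2" if "h \<in> hom C c l" "Cmp C (\<pi> 0) h = \<theta> 0" for h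
        using cmp2[OF ** that(1)] that(2) \<theta> unfolding cone by simp
      then have "(h \<in> hom C c l \<and> (\<forall>j\<in>Obj cospan_cat. Cmp C (\<pi> j) h = \<theta> j)) \<longleftrightarrow>
         h \<in> hom C c l \<and> Cmp C (\<pi> 0) h = \<theta> 0 \<and> Cmp C (\<pi> 1) h = \<theta> 1" for h
        by (auto simp: cospan_cat_def)
      with ex1 show "\<exists>!h. h \<in> hom C c l \<and> (\<forall>j\<in>Obj cospan_cat. Cmp C (\<pi> j) h = \<theta> j)"
        by simp
    qed
  qed
qed

lemma left_exact_product:
  assumes "left_exact C D u" "is_functor C D u" "category C" "category D" "is_product C a b l p q"
  shows "is_product D (fobj u a) (fobj u b) (fobj u l) (farr u p) (farr u q)"
proof -
  let ?G = "pair_diagram C a b" and ?\<pi> = "\<lambda>j::nat. if j = 0 then p else q"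
  have ab: "a \<in> Obj C" "b \<in> Obj C"
    using assms(3,5) by (auto simp: is_product_def hom_iff)
  have G: "is_functor pair_cat C ?G"
    using ab assms(3) by (simp add: is_functor_def pair_cat_def pair_diagram_def hom_iff)
  have G0: "fobj ?G 0 = a" "fobj ?G 1 = b"
    by (simp_all add: pair_diagram_def)
  have "is_limit pair_cat C ?G l ?\<pi>"
    using limit_pair_cat_iff[OF assms(3) G] assms(5) G0 by simp
  with G assms(1) finite_category_pair_cat
  have "is_limit pair_cat D (fcomp u ?G) (fobj u l) (\<lambda>j. farr u (?\<pi> j))"
    unfolding left_exact_def by blast
  then show ?thesis
    using limit_pair_cat_iff[OF assms(4) functor_fcomp[OF G assms(2)]] G0 by (simp add: fcomp_def)
qed

lemma cospan_diagram_functor: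
  assumes "category C" "f \<in> Arr C" "g \<in> Arr C" "Cod C f = Cod C g"
  shows "is_functor cospan_cat C (cospan_diagram C f g)"
  using assms by (simp add: is_functor_def cospan_cat_def cospan_diagram_def hom_iff)

lemma has_finite_limits_pullback:
  assumes "has_finite_limits C" "category C" "f \<in> Arr C" "g \<in> Arr C" "Cod C f = Cod C g"
  shows "\<exists>l p q. is_pullback C f g l p q"
proof -
  note G = cospan_diagram_functor[OF assms(2-5)]
  obtain l \<pi> where "is_limit cospan_cat C (cospan_diagram C f g) l \<pi>"
    using assms(1) finite_category_cospan_cat G unfolding has_finite_limits_def by blast
  then show ?thesis
    using limit_cospan_cat_iff[OF assms(2) G] by (auto simp: cospan_diagram_def)
qed

lemma left_exact_pullback:
  assumes "left_exact C D u" "is_functor C D u" "category C" "category D"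
    and "f \<in> Arr C" "g \<in> Arr C" "Cod C f = Cod C g" "is_pullback C f g l p q"
  shows "is_pullback D (farr u f) (farr u g) (fobj u l) (farr u p) (farr u q)"
proof -
  let ?G = "cospan_diagram C f g" and ?\<pi> = "\<lambda>j::nat. if j = 0 then p else if j = 1 then q else Cmp C f p"
  note G = cospan_diagram_functor[OF assms(3,5-7)]
  have G3: "farr ?G 3 = f" "farr ?G 4 = g"
    by (simp_all add: cospan_diagram_def)
  have "is_limit cospan_cat C ?G l ?\<pi>"
    using limit_cospan_cat_iff[OF assms(3) G] assms(8) G3 by simp
  with G assms(1) finite_category_cospan_cat
  have "is_limit cospan_cat D (fcomp u ?G) (fobj u l) (\<lambda>j. farr u (?\<pi> j))"
    unfolding left_exact_def by blast
  then show ?thesis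
    using limit_cospan_cat_iff[OF assms(4) functor_fcomp[OF G assms(2)]] G3 by (simp add: fcomp_def)
qed

section \<open>Fibred sites\<close>

lemma coevanescent_site_simps [simp]:
  "Obj (coevanescent_site P) = Obj (tot P)" "Arr (coevanescent_site P) = Arr (tot P)"
  "Dom (coevanescent_site P) = Dom (tot P)" "Cod (coevanescent_site P) = Cod (tot P)"
  "Ide (coevanescent_site P) = Ide (tot P)" "Cmp (coevanescent_site P) = Cmp (tot P)"
  "Cov (coevanescent_site P) = coevanescent_topology P"
  by (simp_all add: coevanescent_site_def cat.defs site.defs)

lemma coevanescent_site_cat [simp]:
  "hom (coevanescent_site P) = hom (tot P)"
  "arrows_to (coevanescent_site P) = arrows_to (tot P)"
  "category (coevanescent_site P) = category (tot P)"
  "is_product (coevanescent_site P) = is_product (tot P)"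
  by (simp_all only: fun_eq_iff hom_def arrows_to_def category_def is_product_def
      coevanescent_site_simps simp_thms)

lemma direct_fibre_inclusion [simp]: "direct fibre_inclusion K = K"
  by (simp add: direct_def fibre_inclusion_def)

lemma fibre_simps [simp]:
  "V \<in> Obj (fibre P i) \<longleftrightarrow> V \<in> Obj (tot P) \<and> fobj (proj P) V = i"
  "m \<in> Arr (fibre P i) \<longleftrightarrow>
     m \<in> Arr (tot P) \<and> fobj (proj P) (Dom (tot P) m) = i \<and> farr (proj P) m = Ide (base P) i"
  "Dom (fibre P i) = Dom (tot P)" "Cod (fibre P i) = Cod (tot P)"
  "Ide (fibre P i) = Ide (tot P)" "Cmp (fibre P i) = Cmp (tot P)" "Cov (fibre P i) = fcov P i"
  by (simp_all add: fibre_def)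

lemma fibre_hom_iff:
  "m \<in> hom (fibre P i) V W \<longleftrightarrow>
     m \<in> hom (tot P) V W \<and> fobj (proj P) V = i \<and> farr (proj P) m = Ide (base P) i"
  by (auto simp: hom_iff)

section \<open>Cleaved fibrations: vertical arrows and inverse image functors\<close>

locale fibration =
  fixes P :: "('o, 'a, 'i, 'f) fibred"
  assumes fibration: "cleaved_normalized_fibration P"
begin

lemma E_cat: "category (tot P)"
  and B_cat: "category (base P)"
  and proj_functor: "is_functor (tot P) (base P) (proj P)"
  using fibration by (auto simp: cleaved_normalized_fibration_def)

lemma proj_hom: "m \<in> hom (tot P) W V \<Longrightarrow>
    farr (proj P) m \<in> hom (base P) (fobj (proj P) W) (fobj (proj P) V)"
  by (rule functor_hom[OF proj_functor])

lemma proj_Cmp: "f \<in> hom (tot P) V W \<Longrightarrow> g \<in> hom (tot P) W Z \<Longrightarrow>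
    farr (proj P) (Cmp (tot P) g f) = Cmp (base P) (farr (proj P) g) (farr (proj P) f)"
  by (rule functor_Cmp[OF proj_functor]) (simp_all add: hom_iff)

lemma lift_Ide: "V \<in> Obj (tot P) \<Longrightarrow> lift P (Ide (base P) (fobj (proj P) V)) V = Ide (tot P) V"
  using fibration by (simp add: cleaved_normalized_fibration_def)

text \<open>\<open>fibre\<close> constrains the source of an arrow and its projection; the target
  lies over the same object because the projection is an identity.\<close>

lemma fibre_Cod:
  assumes "m \<in> hom (fibre P i) V W"
  shows "fobj (proj P) W = i" "V \<in> Obj (fibre P i)" "W \<in> Obj (fibre P i)"
proof -
  have m: "m \<in> hom (tot P) V W" "fobj (proj P) V = i" "farr (proj P) m = Ide (base P) i"
    using assms unfolding fibre_hom_iff by simp_all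
  have "V \<in> Obj (tot P)" "W \<in> Obj (tot P)"
    using m(1) E_cat by (auto simp: hom_iff)
  moreover have "i \<in> Obj (base P)"
    using functor_Obj[OF proj_functor \<open>V \<in> Obj (tot P)\<close>] m(2) by simp
  ultimately show "fobj (proj P) W = i" "V \<in> Obj (fibre P i)" "W \<in> Obj (fibre P i)"
    using proj_hom[OF m(1)] m B_cat by (simp_all add: hom_iff)
qed

context
  fixes f V assumes f: "f \<in> Arr (base P)" and V: "V \<in> Obj (tot P)" "fobj (proj P) V = Cod (base P) f"
begin

lemma lift_cartesian:
  "cartesian P (lift P f V)" "Cod (tot P) (lift P f V) = V" "farr (proj P) (lift P f V) = f"
proof -
  have "V \<in> Obj (fibre P (Cod (base P) f))"
    using V by simp
  then show "cartesian P (lift P f V)" "Cod (tot P) (lift P f V) = V" "farr (proj P) (lift P f V) = f"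
    using fibration f unfolding cleaved_normalized_fibration_def by blast+
qed

lemma lift_hom: "lift P f V \<in> hom (tot P) (inv_obj P f V) V"
  and inv_obj_Obj: "inv_obj P f V \<in> Obj (tot P)"
  and proj_inv_obj: "fobj (proj P) (inv_obj P f V) = Dom (base P) f"
proof -
  have "lift P f V \<in> Arr (tot P)"
    using lift_cartesian(1) by (simp add: cartesian_def)
  then show *: "lift P f V \<in> hom (tot P) (inv_obj P f V) V"
    using lift_cartesian by (simp add: hom_iff inv_obj_def)
  then show "inv_obj P f V \<in> Obj (tot P)"
    using Dom_in_Obj[OF E_cat, of "lift P f V"] by (simp add: hom_iff)
  show "fobj (proj P) (inv_obj P f V) = Dom (base P) f"
    using proj_hom[OF *] lift_cartesian by (simp add: hom_iff)
qed

lemma lift_factor: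
  assumes n: "n \<in> hom (tot P) W V" and g: "g \<in> hom (base P) (fobj (proj P) W) (Dom (base P) f)"
    and n_g: "farr (proj P) n = Cmp (base P) f g"
  shows "\<exists>!k. k \<in> hom (tot P) W (inv_obj P f V) \<and> farr (proj P) k = g \<and> Cmp (tot P) (lift P f V) k = n"
proof -
  have "n \<in> arrows_to (tot P) (Cod (tot P) (lift P f V))" and W: "Dom (tot P) n = W"
    using n lift_cartesian by (simp_all add: arrows_to_iff hom_iff)
  note * = lift_cartesian(1)[unfolded cartesian_def, THEN conjunct2, rule_format, OF this(1), of g]
  have "Dom (tot P) (lift P f V) = inv_obj P f V"
    by (simp add: inv_obj_def)
  then show ?thesis
    using * g n_g W proj_inv_obj by (simp add: lift_cartesian(3))
qed

lemma lift_eqI: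
  assumes "k \<in> hom (tot P) W (inv_obj P f V)" "k' \<in> hom (tot P) W (inv_obj P f V)"
    and "farr (proj P) k = farr (proj P) k'" "Cmp (tot P) (lift P f V) k = Cmp (tot P) (lift P f V) k'"
  shows "k = k'"
proof -
  have "farr (proj P) k \<in> hom (base P) (fobj (proj P) W) (Dom (base P) f)"
    using proj_hom[OF assms(1)] proj_inv_obj by simp
  moreover have "farr (proj P) (Cmp (tot P) (lift P f V) k) = Cmp (base P) f (farr (proj P) k)"
    using proj_Cmp[OF assms(1) lift_hom] lift_cartesian by simp
  ultimately show ?thesis
    using lift_factor[OF Cmp_in_hom[OF E_cat assms(1) lift_hom]] assms by metis
qed

text \<open>The cartesian property with an identity as base component; it shows that the description
  in \<open>vert\<close> denotes.\<close>

lemma vert_unique: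
  assumes m: "m \<in> hom (tot P) W V" "farr (proj P) m = f"
  shows "\<exists>!k. k \<in> hom (fibre P (Dom (base P) f)) W (inv_obj P f V) \<and> Cmp (tot P) (lift P f V) k = m"
proof -
  have W: "fobj (proj P) W = Dom (base P) f"
    using proj_hom[OF m(1)] m(2) by (simp add: hom_iff)
  have "Ide (base P) (Dom (base P) f) \<in> hom (base P) (fobj (proj P) W) (Dom (base P) f)"
    using W f B_cat by (simp add: hom_iff)
  from lift_factor[OF m(1) this] have "\<exists>!k. k \<in> hom (tot P) W (inv_obj P f V) \<and>
      farr (proj P) k = Ide (base P) (Dom (base P) f) \<and> Cmp (tot P) (lift P f V) k = m"
    using m f B_cat by simp
  then show ?thesis
    by (simp add: fibre_hom_iff W)
qed

lemma vert_hom: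
  assumes m: "m \<in> hom (tot P) W V" "farr (proj P) m = f"
  shows "vert P f V m \<in> hom (fibre P (Dom (base P) f)) W (inv_obj P f V)"
    and "Cmp (tot P) (lift P f V) (vert P f V m) = m"
proof -
  have "Dom (tot P) m = W"
    using m by (simp add: hom_iff)
  then show "vert P f V m \<in> hom (fibre P (Dom (base P) f)) W (inv_obj P f V)"
    "Cmp (tot P) (lift P f V) (vert P f V m) = m"
    using theI'[OF vert_unique[OF m]] by (simp_all add: vert_def)
qed

text \<open>Applied to two arrows with the same composite, this cancels the lift on the left among
  arrows of a fibre, which is how equations between such arrows are proved.\<close>

lemma vert_eqI:
  assumes "k \<in> hom (fibre P (Dom (base P) f)) W (inv_obj P f V)"
  shows "vert P f V (Cmp (tot P) (lift P f V) k) = k"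
proof -
  have k: "k \<in> hom (tot P) W (inv_obj P f V)" "farr (proj P) k = Ide (base P) (Dom (base P) f)"
    using assms unfolding fibre_hom_iff by simp_all
  have "farr (proj P) (Cmp (tot P) (lift P f V) k) = f"
    using proj_Cmp[OF k(1) lift_hom] lift_cartesian k(2) f B_cat by simp
  then show ?thesis
    using vert_unique[OF Cmp_in_hom[OF E_cat k(1) lift_hom]] vert_hom[OF Cmp_in_hom[OF E_cat k(1) lift_hom]]
      assms by blast
qed

end

lemma fibre_category: "category (fibre P i)"
proof -
  have C: "Cmp (tot P) g f \<in> hom (fibre P i) U W"
    if f: "f \<in> hom (fibre P i) U V" and g: "g \<in> hom (fibre P i) V W" for f g U V W
  proof -
    have fg: "f \<in> hom (tot P) U V" "g \<in> hom (tot P) V W"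
      using f g unfolding fibre_hom_iff by simp_all
    have "i \<in> Obj (base P)"
      using fibre_Cod(2)[OF f] functor_Obj[OF proj_functor, of U] by auto
    then show ?thesis
      using Cmp_in_hom[OF E_cat fg] proj_Cmp[OF fg] f g B_cat unfolding fibre_hom_iff by simp
  qed
  have A: "f \<in> hom (fibre P i) (Dom (tot P) f) (Cod (tot P) f)" if "f \<in> Arr (fibre P i)" for f
    using that by (simp add: hom_iff)
  show ?thesis
    unfolding category_def
  proof (intro conjI ballI impI)
    fix f assume f: "f \<in> Arr (fibre P i)"
    show "Dom (fibre P i) f \<in> Obj (fibre P i)" "Cod (fibre P i) f \<in> Obj (fibre P i)"
      using fibre_Cod[OF A[OF f]] by simp_all
    show "Cmp (fibre P i) f (Ide (fibre P i) (Dom (fibre P i) f)) = f"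
      "Cmp (fibre P i) (Ide (fibre P i) (Cod (fibre P i) f)) f = f"
      using f E_cat by simp_all
  next
    fix V assume "V \<in> Obj (fibre P i)"
    then show "Ide (fibre P i) V \<in> hom (fibre P i) V V"
      using E_cat functor_Ide[OF proj_functor] by (simp add: hom_iff)
  next
    fix f g assume "f \<in> Arr (fibre P i)" "g \<in> Arr (fibre P i)" "Dom (fibre P i) g = Cod (fibre P i) f"
    then show "Cmp (fibre P i) g f \<in> hom (fibre P i) (Dom (fibre P i) f) (Cod (fibre P i) g)"
      using C[OF A[of f], of g] A[of g] by simp
  next
    fix f g h assume "f \<in> Arr (fibre P i)" "g \<in> Arr (fibre P i)" "h \<in> Arr (fibre P i)"
      "Dom (fibre P i) g = Cod (fibre P i) f \<and> Dom (fibre P i) h = Cod (fibre P i) g"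
    then show "Cmp (fibre P i) h (Cmp (fibre P i) g f) = Cmp (fibre P i) (Cmp (fibre P i) h g) f"
      using E_cat by (simp add: Cmp_assoc)
  qed
qed

text \<open>The commutative square with the two lifts characterises the image of \<open>k\<close>;
  later computations with inverse image functors use this square in place of
  \<open>vert\<close>.\<close>

lemma inv_functor_hom:
  assumes f: "f \<in> Arr (base P)" and k: "k \<in> hom (fibre P (Cod (base P) f)) V W"
  shows "farr (inv_functor P f) k \<in> hom (fibre P (Dom (base P) f)) (inv_obj P f V) (inv_obj P f W)"
    and "Cmp (tot P) (lift P f W) (farr (inv_functor P f) k) = Cmp (tot P) k (lift P f V)"
proof -
  have V: "V \<in> Obj (tot P)" "fobj (proj P) V = Cod (base P) f"
    and W: "W \<in> Obj (tot P)" "fobj (proj P) W = Cod (base P) f"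
    using fibre_Cod[OF k] by simp_all
  have k': "k \<in> hom (tot P) V W" "farr (proj P) k = Ide (base P) (Cod (base P) f)"
    using k unfolding fibre_hom_iff by simp_all
  have "farr (inv_functor P f) k = vert P f W (Cmp (tot P) k (lift P f V))"
    using k' by (simp add: inv_functor_def hom_iff)
  moreover have "farr (proj P) (Cmp (tot P) k (lift P f V)) = f"
    using proj_Cmp[OF lift_hom[OF f V] k'(1)] lift_cartesian[OF f V] k'(2) f B_cat by simp
  ultimately show "farr (inv_functor P f) k \<in> hom (fibre P (Dom (base P) f)) (inv_obj P f V) (inv_obj P f W)"
    "Cmp (tot P) (lift P f W) (farr (inv_functor P f) k) = Cmp (tot P) k (lift P f V)"
    using vert_hom[OF f W Cmp_in_hom[OF E_cat lift_hom[OF f V] k'(1)]] by simp_all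
qed

lemma fobj_inv_functor [simp]: "fobj (inv_functor P f) V = inv_obj P f V"
  by (simp add: inv_functor_def)

text \<open>Here the normalization of the cleavage enters: lifts of identities are identities, so
  the inverse image functor of an identity is the identity on the nose and not just up to
  isomorphism.\<close>

lemma inv_functor_Ide:
  assumes "k \<in> hom (fibre P i) V W"
  shows "farr (inv_functor P (Ide (base P) i)) k = k" "inv_obj P (Ide (base P) i) V = V"
proof -
  have V: "V \<in> Obj (tot P)" "fobj (proj P) V = i" and W: "W \<in> Obj (tot P)" "fobj (proj P) W = i"
    using fibre_Cod[OF assms] by simp_all
  have i: "i \<in> Obj (base P)"
    using functor_Obj[OF proj_functor V(1)] V(2) by simp
  show V': "inv_obj P (Ide (base P) i) V = V"
    using lift_Ide[OF V(1)] V E_cat by (simp add: inv_obj_def)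
  have W': "inv_obj P (Ide (base P) i) W = W"
    using lift_Ide[OF W(1)] W E_cat by (simp add: inv_obj_def)
  let ?k = "farr (inv_functor P (Ide (base P) i)) k"
  have "?k \<in> hom (fibre P i) V W" "Cmp (tot P) (lift P (Ide (base P) i) W) ?k = Cmp (tot P) k (lift P (Ide (base P) i) V)"
    using inv_functor_hom[of "Ide (base P) i" k V W] assms i B_cat V' W' by simp_all
  then show "?k = k"
    using lift_Ide[OF W(1)] lift_Ide[OF V(1)] V(2) W(2) assms E_cat unfolding fibre_hom_iff
    by (simp add: hom_iff)
qed

end

section \<open>Sheaves on the total category and their restriction to fibres\<close>

locale fibred_sites = fibration P for P :: "('o, 'a, 'i, 'f) fibred" +
  fixes U :: "'u \<Rightarrow> 'u set"
  assumes fibred_site: "fibred_site U P"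
begin

lemma fibre_U_site: "i \<in> Obj (base P) \<Longrightarrow> U_site U (fibre P i)"
  and fibre_finite_limits: "i \<in> Obj (base P) \<Longrightarrow> has_finite_limits (fibre P i)"
  and inv_continuous: "f \<in> Arr (base P) \<Longrightarrow>
    continuous_functor U (fibre P (Cod (base P) f)) (fibre P (Dom (base P) f)) (inv_functor P f)"
  and inv_left_exact: "f \<in> Arr (base P) \<Longrightarrow>
    left_exact (fibre P (Cod (base P) f)) (fibre P (Dom (base P) f)) (inv_functor P f)"
  using fibred_site by (simp_all add: fibred_site_def)

lemma inv_is_functor: "f \<in> Arr (base P) \<Longrightarrow>
    is_functor (fibre P (Cod (base P) f)) (fibre P (Dom (base P) f)) (inv_functor P f)"
  using inv_continuous by (simp add: continuous_functor_def)

lemma fibre_presheaf: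
  assumes K: "presheaf U (tot P) K"
  shows "presheaf U (fibre P i) K"
  unfolding presheaf_def
proof (intro conjI ballI impI)
  fix f assume "f \<in> Arr (fibre P i)"
  then have "f \<in> hom (tot P) (Dom (fibre P i) f) (Cod (fibre P i) f)"
    by (simp add: hom_iff)
  from Res_in[OF K this] show "Res K f \<in> U (Sec K (Cod (fibre P i) f)) \<rightarrow> U (Sec K (Dom (fibre P i) f))"
    by blast
next
  fix V s assume "V \<in> Obj (fibre P i)" "s \<in> U (Sec K V)"
  then show "Res K (Ide (fibre P i) V) s = s"
    using Res_Ide[OF K] by simp
next
  fix f g s assume "f \<in> Arr (fibre P i)" "g \<in> Arr (fibre P i)" "Dom (fibre P i) g = Cod (fibre P i) f"
    "s \<in> U (Sec K (Cod (fibre P i) g))"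
  then show "Res K (Cmp (fibre P i) g f) s = Res K f (Res K g s)"
    using Res_Cmp[OF K, of f "Dom (tot P) f" "Dom (tot P) g" g "Cod (tot P) g" s] by (simp add: hom_iff)
qed

lemma coevanescent_presheaf_iff [simp]: "presheaf U (coevanescent_site P) K \<longleftrightarrow> presheaf U (tot P) K"
  by (simp add: presheaf_def)

text \<open>A sieve of the fibre generates itself there, so a covering sieve \<open>S\<close> is a
  vertical family; the sieve that it generates in \<open>E\<close> is then covering by the
  definition of a generated topology.\<close>

lemma fibre_generated_sieve_covering:
  assumes V: "V \<in> Obj (fibre P i)" and S: "S \<in> fcov P i V" "sieve (fibre P i) V S"
  shows "generated_sieve (tot P) S \<in> coevanescent_topology P V"
proof -
  have S_arr: "f \<in> Arr (fibre P i) \<and> Cod (tot P) f = V" if "f \<in> S" for f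
    using sieve_arrows[OF S(2) that] by simp
  have "generated_sieve (fibre P i) S = S"
  proof
    show "generated_sieve (fibre P i) S \<subseteq> S"
      using S(2) by (auto simp: generated_sieve_def sieve_def)
    show "S \<subseteq> generated_sieve (fibre P i) S"
    proof
      fix f assume f: "f \<in> S"
      have "Ide (tot P) (Dom (tot P) f) \<in> arrows_to (fibre P i) (Dom (tot P) f)"
        using S_arr[OF f] Ide_in_hom[OF fibre_category, of "Dom (tot P) f" i] E_cat
        by (simp add: arrows_to_iff hom_iff)
      moreover have "f = Cmp (tot P) f (Ide (tot P) (Dom (tot P) f))"
        using S_arr[OF f] E_cat by simp
      ultimately show "f \<in> generated_sieve (fibre P i) S"
        using f unfolding generated_sieve_def by auto
    qed
  qed
  then have "(V, S) \<in> vertical_families P"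
    using V S S_arr by (auto simp: vertical_families_def covering_family_def arrows_to_iff)
  moreover have "sieve (tot P) V (generated_sieve (tot P) S)"
    unfolding sieve_def
  proof (intro conjI ballI subsetI)
    fix r assume "r \<in> generated_sieve (tot P) S"
    then obtain f g where r: "r = Cmp (tot P) f g" "f \<in> S" "g \<in> arrows_to (tot P) (Dom (tot P) f)"
      by (auto simp: generated_sieve_def)
    then show "r \<in> arrows_to (tot P) V"
      using S_arr[OF r(2)] E_cat by (simp add: arrows_to_iff)
    fix h assume "h \<in> arrows_to (tot P) (Dom (tot P) r)"
    then have "Cmp (tot P) r h = Cmp (tot P) f (Cmp (tot P) g h)"
      "Cmp (tot P) g h \<in> arrows_to (tot P) (Dom (tot P) f)"
      using S_arr[OF r(2)] E_cat r by (simp_all add: arrows_to_iff Cmp_assoc)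
    then show "Cmp (tot P) r h \<in> generated_sieve (tot P) S"
      using r(2) unfolding generated_sieve_def by blast
  qed
  ultimately show ?thesis
    unfolding coevanescent_topology_def generated_topology_def by blast
qed

text \<open>
  A family that is compatible in \<open>E\<^sub>i\<close> is compatible in \<open>E\<close>: two arrows over \<open>h: j \<rightarrow> i\<close> that agree after
  composition with \<open>f\<^sub>1\<close> and \<open>f\<^sub>2\<close> factor through the image under \<open>h\<^sup>+\<close> of the fibre product of \<open>f\<^sub>1\<close> and
  \<open>f\<^sub>2\<close> in \<open>E\<^sub>i\<close>.
\<close>

lemma fibre_matching:
  assumes K: "presheaf U (tot P) K" and V: "V \<in> Obj (fibre P i)" and S: "sieve (fibre P i) V S"
    and s: "\<And>f. f \<in> S \<Longrightarrow> s f \<in> U (Sec K (Dom (tot P) f))"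
    and nat: "\<And>f g. f \<in> S \<Longrightarrow> g \<in> arrows_to (fibre P i) (Dom (tot P) f) \<Longrightarrow>
      Res K g (s f) = s (Cmp (tot P) f g)"
    and f: "f1 \<in> S" "f2 \<in> S" and g: "g1 \<in> arrows_to (tot P) (Dom (tot P) f1)"
      "g2 \<in> arrows_to (tot P) (Dom (tot P) f2)" "Cmp (tot P) f1 g1 = Cmp (tot P) f2 g2"
  shows "Res K g1 (s f1) = Res K g2 (s f2)"
proof -
  have V: "V \<in> Obj (tot P)" "fobj (proj P) V = i"
    using V by simp_all
  have i: "i \<in> Obj (base P)"
    using functor_Obj[OF proj_functor] V by auto
  define V1 V2 W where "V1 = Dom (tot P) f1" and "V2 = Dom (tot P) f2" and "W = Dom (tot P) g1"
  have f_hom: "f1 \<in> hom (fibre P i) V1 V" "f2 \<in> hom (fibre P i) V2 V"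
    using sieve_arrows[OF S f(1)] sieve_arrows[OF S f(2)] by (simp_all add: hom_iff V1_def V2_def)
  have f_hom': "f1 \<in> hom (tot P) V1 V" "f2 \<in> hom (tot P) V2 V"
    and f_proj: "farr (proj P) f1 = Ide (base P) i" "farr (proj P) f2 = Ide (base P) i"
    using f_hom unfolding fibre_hom_iff by simp_all
  have V12: "V1 \<in> Obj (tot P)" "fobj (proj P) V1 = i" "V2 \<in> Obj (tot P)" "fobj (proj P) V2 = i"
    using fibre_Cod[OF f_hom(1)] fibre_Cod[OF f_hom(2)] by simp_all
  have "Dom (tot P) (Cmp (tot P) f1 g1) = W" "Dom (tot P) (Cmp (tot P) f2 g2) = Dom (tot P) g2"
    using g(1,2) f_hom' E_cat by (simp_all add: arrows_to_iff W_def V1_def V2_def hom_iff)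
  then have g_hom: "g1 \<in> hom (tot P) W V1" "g2 \<in> hom (tot P) W V2"
    using g by (simp_all add: arrows_to_iff hom_iff W_def V1_def V2_def)
  define h where "h = farr (proj P) g1"
  have h: "h \<in> Arr (base P)" "Dom (base P) h = fobj (proj P) W" "Cod (base P) h = i"
    using proj_hom[OF g_hom(1)] V12 by (simp_all add: h_def hom_iff)
  \<comment> \<open>Since \<open>f1\<close> and \<open>f2\<close> are vertical, \<open>g1\<close>
    and \<open>g2\<close> both lie over the projection of their common composite with them.\<close>
  have g2_h: "farr (proj P) g2 = h"
    using proj_Cmp[OF g_hom(1) f_hom'(1)] proj_Cmp[OF g_hom(2) f_hom'(2)] g(3) f_proj
      proj_hom[OF g_hom(1)] proj_hom[OF g_hom(2)] V12 B_cat by (simp add: h_def hom_iff)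
  obtain l p1 p2 where pb: "is_pullback (fibre P i) f1 f2 l p1 p2"
    using has_finite_limits_pullback[OF fibre_finite_limits[OF i] fibre_category, of f1 f2] f_hom
    by (auto simp: hom_iff)
  then have p: "p1 \<in> hom (fibre P i) l V1" "p2 \<in> hom (fibre P i) l V2"
    "Cmp (tot P) f1 p1 = Cmp (tot P) f2 p2" and l: "l \<in> Obj (tot P)" "fobj (proj P) l = Cod (base P) h"
    using h by (simp_all add: is_pullback_def V1_def V2_def)
  have p': "p1 \<in> hom (tot P) l V1" "p2 \<in> hom (tot P) l V2"
    using p unfolding fibre_hom_iff by simp_all
  let ?u = "inv_functor P h" and ?j = "Dom (base P) h"
  \<comment> \<open>Left exactness carries the fibre product of \<open>f1\<close> and
    \<open>f2\<close> to a fibre product over the source of \<open>h\<close>, where the vertical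
    parts of \<open>g1\<close> and \<open>g2\<close> live.\<close>
  have ipb: "is_pullback (fibre P ?j) (farr ?u f1) (farr ?u f2) (inv_obj P h l) (farr ?u p1) (farr ?u p2)"
    using left_exact_pullback[OF inv_left_exact[OF h(1)] inv_is_functor[OF h(1)] fibre_category
        fibre_category, of f1 f2 l p1 p2] pb f_hom h(3) V12 by (simp add: hom_iff)
  have V1h: "fobj (proj P) V1 = Cod (base P) h" and V2h: "fobj (proj P) V2 = Cod (base P) h"
    and Vh: "fobj (proj P) V = Cod (base P) h"
    using V12 V h by simp_all
  note k1 = vert_hom[OF h(1) V12(1) V1h g_hom(1) h_def[symmetric]]
  note k2 = vert_hom[OF h(1) V12(3) V2h g_hom(2) g2_h]
  let ?k1 = "vert P h V1 g1" and ?k2 = "vert P h V2 g2"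
  note uf1 = inv_functor_hom[OF h(1), of f1 V1 V, unfolded h(3), OF f_hom(1)]
  note uf2 = inv_functor_hom[OF h(1), of f2 V2 V, unfolded h(3), OF f_hom(2)]
  note up1 = inv_functor_hom[OF h(1), of p1 l V1, unfolded h(3), OF p(1)]
  note up2 = inv_functor_hom[OF h(1), of p2 l V2, unfolded h(3), OF p(2)]
  have lift_chain: "Cmp (tot P) (lift P h Z') (Cmp (tot P) (farr ?u c) k) = Cmp (tot P) c (Cmp (tot P) (lift P h Z) k)"
    if "c \<in> hom (fibre P i) Z Z'" "k \<in> hom (tot P) Y (inv_obj P h Z)" for c k Z Z' Y
  proof -
    note uc = inv_functor_hom[OF h(1), of c Z Z', unfolded h(3), OF that(1)]
    have Z: "Z \<in> Obj (tot P)" "fobj (proj P) Z = Cod (base P) h" "Z' \<in> Obj (tot P)" "fobj (proj P) Z' = Cod (base P) h"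
      using fibre_Cod[OF that(1)] h(3) by simp_all
    have "Cmp (tot P) (lift P h Z') (Cmp (tot P) (farr ?u c) k) = Cmp (tot P) (Cmp (tot P) (lift P h Z') (farr ?u c)) k"
      using uc(1) lift_hom[OF h(1) Z(3,4)] that(2) E_cat unfolding fibre_hom_iff
      by (subst Cmp_assoc) (simp_all add: hom_iff)
    also have "\<dots> = Cmp (tot P) c (Cmp (tot P) (lift P h Z) k)"
      unfolding uc(2) using lift_hom[OF h(1) Z(1,2)] that E_cat unfolding fibre_hom_iff
      by (subst Cmp_assoc) (simp_all add: hom_iff)
    finally show ?thesis .
  qed
  have k_hom: "?k1 \<in> hom (tot P) W (inv_obj P h V1)" "?k2 \<in> hom (tot P) W (inv_obj P h V2)"
    using k1(1) k2(1) unfolding fibre_hom_iff by simp_all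
  \<comment> \<open>Both sides have the same composite with the lift of \<open>h\<close> at
    \<open>V\<close>, namely the common composite of the hypothesis; the lift is then
    cancelled.\<close>
  have "Cmp (tot P) (farr ?u f1) ?k1 = Cmp (tot P) (farr ?u f2) ?k2"
  proof -
    have c1: "Cmp (tot P) (farr ?u f1) ?k1 \<in> hom (fibre P ?j) W (inv_obj P h V)"
      using Cmp_in_hom[OF fibre_category k1(1) uf1(1)] by simp
    have c2: "Cmp (tot P) (farr ?u f2) ?k2 \<in> hom (fibre P ?j) W (inv_obj P h V)"
      using Cmp_in_hom[OF fibre_category k2(1) uf2(1)] by simp
    have c: "Cmp (tot P) (lift P h V) (Cmp (tot P) (farr ?u f1) ?k1) =
        Cmp (tot P) (lift P h V) (Cmp (tot P) (farr ?u f2) ?k2)"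
      using lift_chain[OF f_hom(1) k_hom(1)] lift_chain[OF f_hom(2) k_hom(2)] k1(2) k2(2) g(3) by simp
    show ?thesis
      using vert_eqI[OF h(1) V(1) Vh c1, unfolded c] vert_eqI[OF h(1) V(1) Vh c2] by (rule trans[OF sym])
  qed
  note k_eq = this
  have W: "W \<in> Obj (fibre P ?j)"
    using fibre_Cod(2)[OF k1(1)] .
  have k_in: "?k1 \<in> hom (fibre P ?j) W (Dom (fibre P ?j) (farr ?u f1))"
    "?k2 \<in> hom (fibre P ?j) W (Dom (fibre P ?j) (farr ?u f2))"
    using k1(1) k2(1) uf1(1) uf2(1) h(2) by (simp_all add: hom_iff)
  have "\<forall>c\<in>Obj (fibre P ?j). \<forall>r\<in>hom (fibre P ?j) c (Dom (fibre P ?j) (farr ?u f1)).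
      \<forall>s\<in>hom (fibre P ?j) c (Dom (fibre P ?j) (farr ?u f2)).
        Cmp (tot P) (farr ?u f1) r = Cmp (tot P) (farr ?u f2) s \<longrightarrow>
        (\<exists>!k. k \<in> hom (fibre P ?j) c (inv_obj P h l) \<and>
           Cmp (tot P) (farr ?u p1) k = r \<and> Cmp (tot P) (farr ?u p2) k = s)"
    using ipb unfolding is_pullback_def fibre_simps(6) by (elim conjE)
  from ex1_implies_ex[OF this[rule_format, OF W k_in k_eq]]
  obtain k where k: "k \<in> hom (fibre P ?j) W (inv_obj P h l)"
    "Cmp (tot P) (farr ?u p1) k = ?k1" "Cmp (tot P) (farr ?u p2) k = ?k2"
    by (elim exE conjE)
  have k': "k \<in> hom (tot P) W (inv_obj P h l)"
    using k(1) unfolding fibre_hom_iff by simp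
  \<comment> \<open>Composing with the lift brings the factorization back to \<open>E\<close>:
    \<open>g1\<close> and \<open>g2\<close> are \<open>t\<close> followed by the projections of the
    fibre product, and these projections belong to the fibre, where compatibility is known.\<close>
  define t where "t = Cmp (tot P) (lift P h l) k"
  have t: "t \<in> hom (tot P) W l"
    unfolding t_def by (rule Cmp_in_hom[OF E_cat k' lift_hom[OF h(1) l]])
  have gt: "g1 = Cmp (tot P) p1 t" "g2 = Cmp (tot P) p2 t"
    using lift_chain[OF p(1) k'] lift_chain[OF p(2) k'] k k1(2) k2(2) by (simp_all add: t_def)
  have s': "s f1 \<in> U (Sec K V1)" "s f2 \<in> U (Sec K V2)"
    using s f by (simp_all add: V1_def V2_def)
  have "p1 \<in> arrows_to (fibre P i) (Dom (tot P) f1)" "p2 \<in> arrows_to (fibre P i) (Dom (tot P) f2)"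
    using p(1,2) l(2) h(3) unfolding arrows_to_iff hom_iff fibre_simps(4) V1_def V2_def by simp_all
  then have "Res K p1 (s f1) = Res K p2 (s f2)"
    using nat f p(3) by metis
  then show ?thesis
    unfolding gt using Res_Cmp[OF K t p'(1) s'(1)] Res_Cmp[OF K t p'(2) s'(2)] by simp
qed

text \<open>A compatible family on \<open>S\<close> extends to the sieve generated by
  \<open>S\<close> in \<open>E\<close>, and the extension is glued by the sheaf \<open>K\<close> on
  \<open>E\<close>.\<close>

lemma fibre_sheaf:
  assumes K: "sheaf U (coevanescent_site P) K"
  shows "sheaf U (fibre P i) K"
  unfolding sheaf_def
proof (intro conjI ballI allI impI)
  have Kpre: "presheaf U (tot P) K"
    using sheaf_presheaf[OF K] by simp
  then show "presheaf U (fibre P i) K"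
    by (rule fibre_presheaf)
  fix V S s assume V: "V \<in> Obj (fibre P i)" and S: "S \<in> Cov (fibre P i) V"
    and s: "(\<forall>f\<in>S. s f \<in> U (Sec K (Dom (fibre P i) f))) \<and>
      (\<forall>f\<in>S. \<forall>g\<in>arrows_to (fibre P i) (Dom (fibre P i) f). Res K g (s f) = s (Cmp (fibre P i) f g))"
  have "i \<in> Obj (base P)"
    using functor_Obj[OF proj_functor] V by auto
  then have "topology (fibre P i) (Cov (fibre P i))"
    using fibre_U_site unfolding U_site_def by blast
  then have Sv: "sieve (fibre P i) V S"
    by (rule topology_sieve[of "fibre P i" "Cov (fibre P i)", OF _ V S])
  have S_hom: "f \<in> hom (tot P) (Dom (tot P) f) V" if "f \<in> S" for f
    using sieve_arrows[OF Sv that] by (simp add: hom_iff)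
  have s_in: "s f \<in> U (Sec K (Dom (tot P) f))" if "f \<in> S" for f
    using s that by simp
  have s_nat: "Res K g (s f) = s (Cmp (tot P) f g)"
    if "f \<in> S" "g \<in> arrows_to (fibre P i) (Dom (tot P) f)" for f g
    using s that by simp
  note matching = fibre_matching[OF Kpre V Sv s_in s_nat]
  \<comment> \<open>An element of the generated sieve has many factorizations; any choice will do,
    because the values for two of them agree by \<open>matching\<close>.\<close>
  define s' where "s' r = (SOME x. \<exists>f\<in>S. \<exists>g\<in>arrows_to (tot P) (Dom (tot P) f).
    r = Cmp (tot P) f g \<and> x = Res K g (s f))" for r
  have s': "s' (Cmp (tot P) f g) = Res K g (s f)" if "f \<in> S" "g \<in> arrows_to (tot P) (Dom (tot P) f)" for f g
  proof -
    have "\<exists>x. \<exists>f'\<in>S. \<exists>g'\<in>arrows_to (tot P) (Dom (tot P) f').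
        Cmp (tot P) f g = Cmp (tot P) f' g' \<and> x = Res K g' (s f')"
      using that by blast
    from someI_ex[OF this] obtain f' g' where "f' \<in> S" "g' \<in> arrows_to (tot P) (Dom (tot P) f')"
      "Cmp (tot P) f g = Cmp (tot P) f' g'" "s' (Cmp (tot P) f g) = Res K g' (s f')"
      unfolding s'_def by blast
    then show ?thesis
      using matching[of f f' g g'] that by simp
  qed
  let ?R = "generated_sieve (tot P) S"
  have "\<exists>!t. t \<in> U (Sec K V) \<and> (\<forall>r\<in>?R. Res K r t = s' r)"
  proof (rule sheaf_glue_unique[OF K])
    show "V \<in> Obj (coevanescent_site P)" "?R \<in> Cov (coevanescent_site P) V"
      using V fibre_generated_sieve_covering[OF V _ Sv] S by simp_all
    fix r assume "r \<in> ?R"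
    then obtain f g where r: "r = Cmp (tot P) f g" "f \<in> S" "g \<in> arrows_to (tot P) (Dom (tot P) f)"
      by (auto simp: generated_sieve_def)
    have g: "g \<in> hom (tot P) (Dom (tot P) g) (Dom (tot P) f)"
      using r(3) by (simp add: arrows_to_iff hom_iff)
    have r_Dom: "Dom (tot P) r = Dom (tot P) g"
      using r S_hom[OF r(2)] E_cat by (simp add: arrows_to_iff hom_iff)
    show "s' r \<in> U (Sec K (Dom (coevanescent_site P) r))"
      using s'[OF r(2,3)] r(1) r_Dom Res_in[OF Kpre g s_in[OF r(2)]] by simp
    fix h assume "h \<in> arrows_to (coevanescent_site P) (Dom (coevanescent_site P) r)"
    then have h: "h \<in> hom (tot P) (Dom (tot P) h) (Dom (tot P) g)"
      by (simp add: arrows_to_iff hom_iff r_Dom)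
    have "Res K h (s' r) = Res K (Cmp (tot P) g h) (s f)"
      using s'[OF r(2,3)] r(1) Res_Cmp[OF Kpre h g s_in[OF r(2)]] by simp
    also have "\<dots> = s' (Cmp (tot P) f (Cmp (tot P) g h))"
      using s'[OF r(2), of "Cmp (tot P) g h"] g h E_cat by (simp add: arrows_to_iff hom_iff)
    also have "\<dots> = s' (Cmp (tot P) r h)"
      using r(1) S_hom[OF r(2)] g h E_cat by (simp add: hom_iff Cmp_assoc)
    finally show "Res K h (s' r) = s' (Cmp (coevanescent_site P) r h)"
      by simp
  qed
  \<comment> \<open>The two families have the same amalgamations: \<open>S\<close> is contained in
    the generated sieve, and restrictions along the latter are determined by those along
    \<open>S\<close>.\<close>
  moreover have "(\<forall>r\<in>?R. Res K r t = s' r) \<longleftrightarrow> (\<forall>f\<in>S. Res K f t = s f)" if t: "t \<in> U (Sec K V)" for t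
  proof
    assume R: "\<forall>r\<in>?R. Res K r t = s' r"
    show "\<forall>f\<in>S. Res K f t = s f"
    proof
      fix f assume f: "f \<in> S"
      have Id: "Dom (tot P) f \<in> Obj (tot P)" "Ide (tot P) (Dom (tot P) f) \<in> arrows_to (tot P) (Dom (tot P) f)"
        "Cmp (tot P) f (Ide (tot P) (Dom (tot P) f)) = f"
        using S_hom[OF f] E_cat by (simp_all add: hom_iff arrows_to_iff)
      then have "f \<in> ?R"
        using f unfolding generated_sieve_def by force
      then show "Res K f t = s f"
        using R s'[OF f Id(2)] Id(3) Res_Ide[OF Kpre Id(1) s_in[OF f]] by simp
    qed
  next
    assume R: "\<forall>f\<in>S. Res K f t = s f"
    show "\<forall>r\<in>?R. Res K r t = s' r"
    proof
      fix r assume "r \<in> ?R"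
      then obtain f g where r: "r = Cmp (tot P) f g" "f \<in> S" "g \<in> arrows_to (tot P) (Dom (tot P) f)"
        by (auto simp: generated_sieve_def)
      then show "Res K r t = s' r"
        using s'[OF r(2,3)] R Res_Cmp[OF Kpre _ S_hom[OF r(2)] t, of g "Dom (tot P) g"]
        by (simp add: arrows_to_iff hom_iff)
    qed
  qed
  ultimately show "\<exists>!t. t \<in> U (Sec K V) \<and> (\<forall>f\<in>S. Res K f t = s f)"
    by (simp cong: conj_cong)
qed

end

section \<open>Composition of universal arrows\<close>

lemma direct_fcomp: "direct (fcomp v u) K = direct u (direct v K)"
  by (simp add: direct_def fcomp_def)

text \<open>The composite of \<open>m\<close> with the direct image of \<open>n\<close>, written on
  sections; this is the form in which \<open>universal_arrow\<close> states factorizations.\<close>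

lemma pmor_whisker:
  assumes "category C" "is_functor C D u" "presheaf U C F"
    and m: "m \<in> pmor U C F (direct u G)" and n: "n \<in> pmor U D G K"
  shows "(\<lambda>c\<in>Obj C. \<lambda>s\<in>U (Sec F c). n (fobj u c) (m c s)) \<in> pmor U C F (direct u K)"
proof (rule pmorI[OF _ _ assms(1,3)])
  fix c s assume c: "c \<in> Obj C" and s: "s \<in> U (Sec F c)"
  show "n (fobj u c) (m c s) \<in> U (Sec (direct u K) c)"
    using pmor_in[OF n functor_Obj[OF assms(2) c]] pmor_in[OF m c s] by simp
next
  fix f a b s assume f: "f \<in> hom C a b" and b: "b \<in> Obj C" and s: "s \<in> U (Sec F b)"
  show "n (fobj u a) (m a (Res F f s)) = Res (direct u K) f (n (fobj u b) (m b s))"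
    using pmor_Res[OF m f s] pmor_Res[OF n functor_hom[OF assms(2) f]] pmor_in[OF m b s] by simp
qed

text \<open>Left adjoints compose: a morphism to a direct image under \<open>fcomp v u\<close> is
  factored through \<open>G\<close>, with target the direct image under \<open>v\<close>, and then
  through \<open>K\<close>. Continuity of \<open>v\<close> makes the intermediate target a
  sheaf.\<close>

lemma universal_arrow_comp:
  assumes C: "category C" and D: "category D" and F: "presheaf U C F"
    and u: "is_functor C D u" and v: "continuous_functor U D D' v"
    and G: "universal_arrow U C D u F G m" and K: "universal_arrow U D D' v G K m'"
  shows "universal_arrow U C D' (fcomp v u) F K (\<lambda>c\<in>Obj C. \<lambda>s\<in>U (Sec F c). m' (fobj u c) (m c s))"
  unfolding universal_arrow_def
proof (intro conjI allI impI ballI)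
  note m = universal_arrow_pmor[OF G] and m' = universal_arrow_pmor[OF K]
  have Gpre: "presheaf U D G"
    using universal_arrow_sheaf[OF G] by (rule sheaf_presheaf)
  have vf: "is_functor D D' v" and vs: "\<And>K'. sheaf U D' K' \<Longrightarrow> sheaf U D (direct v K')"
    using v unfolding continuous_functor_def by blast+
  show "sheaf U D' K"
    by (rule universal_arrow_sheaf[OF K])
  show "(\<lambda>c\<in>Obj C. \<lambda>s\<in>U (Sec F c). m' (fobj u c) (m c s)) \<in> pmor U C F (direct (fcomp v u) K)"
    unfolding direct_fcomp by (rule pmor_whisker[OF C u F m m'])
  {
    fix K' r assume K': "sheaf U D' K'" and r: "r \<in> pmor U C F (direct (fcomp v u) K')"
    obtain q where q: "q \<in> pmor U D G (direct v K')"
      "\<And>c s. c \<in> Obj C \<Longrightarrow> s \<in> U (Sec F c) \<Longrightarrow> q (fobj u c) (m c s) = r c s"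
      by (rule universal_arrow_factor[OF G vs[OF K'] r[unfolded direct_fcomp]]) (rule that)
    obtain n where n: "n \<in> pmor U D' K K'"
      "\<And>d t. d \<in> Obj D \<Longrightarrow> t \<in> U (Sec G d) \<Longrightarrow> n (fobj v d) (m' d t) = q d t"
      by (rule universal_arrow_factor[OF K K' q(1)]) (rule that)
    show "\<exists>n\<in>pmor U D' K K'. \<forall>c\<in>Obj C. \<forall>s\<in>U (Sec F c).
        n (fobj (fcomp v u) c) ((\<lambda>c\<in>Obj C. \<lambda>s\<in>U (Sec F c). m' (fobj u c) (m c s)) c s) = r c s"
    proof (intro bexI[of _ n] ballI n(1))
      fix c s assume c: "c \<in> Obj C" and s: "s \<in> U (Sec F c)"
      show "n (fobj (fcomp v u) c) ((\<lambda>c\<in>Obj C. \<lambda>s\<in>U (Sec F c). m' (fobj u c) (m c s)) c s) = r c s"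
        using n(2)[OF functor_Obj[OF u c]] q(2)[OF c s] pmor_in[OF m c s] c s by (simp add: fcomp_def)
    qed
  }
  fix K' n n' assume K': "sheaf U D' K'" and n: "n \<in> pmor U D' K K'" and n': "n' \<in> pmor U D' K K'"
    and eq: "\<forall>c\<in>Obj C. \<forall>s\<in>U (Sec F c).
      n (fobj (fcomp v u) c) ((\<lambda>c\<in>Obj C. \<lambda>s\<in>U (Sec F c). m' (fobj u c) (m c s)) c s) =
      n' (fobj (fcomp v u) c) ((\<lambda>c\<in>Obj C. \<lambda>s\<in>U (Sec F c). m' (fobj u c) (m c s)) c s)"
  let ?q = "\<lambda>n. \<lambda>d\<in>Obj D. \<lambda>t\<in>U (Sec G d). n (fobj v d) (m' d t)"
  have qq: "?q n = ?q n'"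
  proof (rule universal_arrow_eqI[OF G vs[OF K']])
    show "?q n \<in> pmor U D G (direct v K')" "?q n' \<in> pmor U D G (direct v K')"
      by (rule pmor_whisker[OF D vf Gpre m' n], rule pmor_whisker[OF D vf Gpre m' n'])
    fix c s assume c: "c \<in> Obj C" and s: "s \<in> U (Sec F c)"
    show "?q n (fobj u c) (m c s) = ?q n' (fobj u c) (m c s)"
      using eq c s functor_Obj[OF u c] pmor_in[OF m c s] by (simp add: fcomp_def)
  qed
  show "n = n'"
  proof (rule universal_arrow_eqI[OF K K' n n'])
    fix d t assume "d \<in> Obj D" "t \<in> U (Sec G d)"
    then show "n (fobj v d) (m' d t) = n' (fobj v d) (m' d t)"
      using fun_cong[OF fun_cong[OF qq, of d], of t] by simp
  qed
qed

lemma universal_arrow_iso: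
  assumes C: "category C" and D: "category D" and F: "presheaf U C F" and u: "is_functor C D u"
    and G: "universal_arrow U C D u F G m" and \<phi>: "piso U D G H \<phi>" and H: "sheaf U D H"
  shows "universal_arrow U C D u F H (\<lambda>c\<in>Obj C. \<lambda>s\<in>U (Sec F c). \<phi> (fobj u c) (m c s))"
  unfolding universal_arrow_def
proof (intro conjI allI impI ballI H)
  note m = universal_arrow_pmor[OF G] and \<phi>m = piso_pmor[OF \<phi>]
  have Gpre: "presheaf U D G" and Hpre: "presheaf U D H"
    using universal_arrow_sheaf[OF G] H by (simp_all add: sheaf_presheaf)
  show "(\<lambda>c\<in>Obj C. \<lambda>s\<in>U (Sec F c). \<phi> (fobj u c) (m c s)) \<in> pmor U C F (direct u H)"
    by (rule pmor_whisker[OF C u F m \<phi>m])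
  obtain \<psi> where \<psi>: "piso U D H G \<psi>"
    and \<psi>\<phi>: "\<And>c s. c \<in> Obj D \<Longrightarrow> s \<in> U (Sec G c) \<Longrightarrow> \<psi> c (\<phi> c s) = s"
    and \<phi>\<psi>: "\<And>c s. c \<in> Obj D \<Longrightarrow> s \<in> U (Sec H c) \<Longrightarrow> \<phi> c (\<psi> c s) = s"
    by (rule piso_inverse[OF \<phi> D Gpre Hpre]) (rule that)
  {
    fix K r assume K: "sheaf U D K" and r: "r \<in> pmor U C F (direct u K)"
    obtain q where q: "q \<in> pmor U D G K"
      "\<And>c s. c \<in> Obj C \<Longrightarrow> s \<in> U (Sec F c) \<Longrightarrow> q (fobj u c) (m c s) = r c s"
      by (rule universal_arrow_factor[OF G K r]) (rule that)
    show "\<exists>n\<in>pmor U D H K. \<forall>c\<in>Obj C. \<forall>s\<in>U (Sec F c).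
        n (fobj u c) ((\<lambda>c\<in>Obj C. \<lambda>s\<in>U (Sec F c). \<phi> (fobj u c) (m c s)) c s) = r c s"
    proof (intro bexI[of _ "pcomp U D H q \<psi>"] ballI pcomp_pmor[OF D Hpre piso_pmor[OF \<psi>] q(1)])
      fix c s assume c: "c \<in> Obj C" and s: "s \<in> U (Sec F c)"
      have uc: "fobj u c \<in> Obj D" and mcs: "m c s \<in> U (Sec G (fobj u c))"
        using functor_Obj[OF u c] pmor_in[OF m c s] by simp_all
      show "pcomp U D H q \<psi> (fobj u c) ((\<lambda>c\<in>Obj C. \<lambda>s\<in>U (Sec F c). \<phi> (fobj u c) (m c s)) c s) = r c s"
        using pmor_in[OF \<phi>m uc mcs] uc \<psi>\<phi>[OF uc mcs] q(2)[OF c s] c s by simp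
    qed
  }
  fix K n n' assume K: "sheaf U D K" and n: "n \<in> pmor U D H K" and n': "n' \<in> pmor U D H K"
    and eq: "\<forall>c\<in>Obj C. \<forall>s\<in>U (Sec F c).
      n (fobj u c) ((\<lambda>c\<in>Obj C. \<lambda>s\<in>U (Sec F c). \<phi> (fobj u c) (m c s)) c s) =
      n' (fobj u c) ((\<lambda>c\<in>Obj C. \<lambda>s\<in>U (Sec F c). \<phi> (fobj u c) (m c s)) c s)"
  have nn: "pcomp U D G n \<phi> = pcomp U D G n' \<phi>"
  proof (rule universal_arrow_eqI[OF G K pcomp_pmor[OF D Gpre \<phi>m n] pcomp_pmor[OF D Gpre \<phi>m n']])
    fix c s assume c: "c \<in> Obj C" and s: "s \<in> U (Sec F c)"
    show "pcomp U D G n \<phi> (fobj u c) (m c s) = pcomp U D G n' \<phi> (fobj u c) (m c s)"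
      using eq c s functor_Obj[OF u c] pmor_in[OF m c s] by simp
  qed
  show "n = n'"
  proof (rule pmor_eqI[OF n n'])
    fix d t assume d: "d \<in> Obj D" and t: "t \<in> U (Sec H d)"
    show "n d t = n' d t"
      using fun_cong[OF fun_cong[OF nn, of d], of "\<psi> d t"] d pmor_in[OF piso_pmor[OF \<psi>] d t] \<phi>\<psi>[OF d t]
      by simp
  qed
qed

text \<open>The definite description denotes because the composite of the two adjunction morphisms
  is again a universal arrow. The second conclusion gives the effect of the canonical morphism on
  sections coming from \<open>F\<close>, which determines it.\<close>

lemma canonical_iso:
  assumes A: "category A" and B: "category B" and C: "category C" and F: "sheaf U A F"
    and u: "is_functor A B u" and v: "continuous_functor U B C v" and w: "is_functor A C w"
    and Lu: "inverse_image U A B u Lu" and Lv: "inverse_image U B C v Lv"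
    and Lw: "inverse_image U A C w Lw"
    and \<rho>: "\<And>a. a \<in> Obj A \<Longrightarrow> \<rho> a \<in> hom C (fobj v (fobj u a)) (fobj w a)"
    and \<rho>_nat: "\<And>f a b. f \<in> hom A a b \<Longrightarrow>
      Cmp C (\<rho> b) (farr v (farr u f)) = Cmp C (farr w f) (\<rho> a)"
  shows "canonical_iso U A C u v Lu Lv Lw \<rho> F \<in> pmor U C (star Lv (star Lu F)) (star Lw F)" (is "?n \<in> _")
    and "\<And>a s. a \<in> Obj A \<Longrightarrow> s \<in> U (Sec F a) \<Longrightarrow>
      canonical_iso U A C u v Lu Lv Lw \<rho> F (fobj v (fobj u a)) (adj Lv (star Lu F) (fobj u a) (adj Lu F a s)) =
      Res (star Lw F) (\<rho> a) (adj Lw F a s)"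
proof -
  let ?G = "star Lu F" and ?K = "star Lv (star Lu F)" and ?W = "star Lw F"
  note Fpre = sheaf_presheaf[OF F]
  have vf: "is_functor B C v"
    using v by (simp add: continuous_functor_def)
  note GU = inverse_image_universal_arrow[OF A u Lu F]
  note KU = inverse_image_universal_arrow[OF B vf Lv universal_arrow_sheaf[OF GU]]
  note WU = inverse_image_universal_arrow[OF A w Lw F]
  note m = universal_arrow_pmor[OF GU] and m' = universal_arrow_pmor[OF KU] and r = universal_arrow_pmor[OF WU]
  note Wpre = sheaf_presheaf[OF universal_arrow_sheaf[OF WU]]
  note comp = universal_arrow_comp[OF A B Fpre u v GU KU]
  let ?m = "\<lambda>a\<in>Obj A. \<lambda>s\<in>U (Sec F a). adj Lv ?G (fobj u a) (adj Lu F a s)"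
  let ?r = "\<lambda>a\<in>Obj A. \<lambda>s\<in>U (Sec F a). Res ?W (\<rho> a) (adj Lw F a s)"
  have r_in: "adj Lw F a s \<in> U (Sec ?W (fobj w a))" if "a \<in> Obj A" "s \<in> U (Sec F a)" for a s
    using pmor_in[OF r that] by simp
  have r_pmor: "?r \<in> pmor U A F (direct (fcomp v u) ?W)"
  proof (rule pmorI[OF _ _ A Fpre])
    show "Res ?W (\<rho> a) (adj Lw F a s) \<in> U (Sec (direct (fcomp v u) ?W) a)"
      if "a \<in> Obj A" "s \<in> U (Sec F a)" for a s
      using Res_in[OF Wpre \<rho>[OF that(1)] r_in[OF that]] by (simp add: direct_fcomp)
    fix f a b s assume f: "f \<in> hom A a b" and a: "a \<in> Obj A" and b: "b \<in> Obj A" and s: "s \<in> U (Sec F b)"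
    have "Res ?W (\<rho> a) (adj Lw F a (Res F f s)) = Res ?W (\<rho> a) (Res ?W (farr w f) (adj Lw F b s))"
      using pmor_Res[OF r f s] by simp
    also have "\<dots> = Res ?W (Cmp C (\<rho> b) (farr v (farr u f))) (adj Lw F b s)"
      using Res_Cmp[OF Wpre \<rho>[OF a] functor_hom[OF w f] r_in[OF b s]] \<rho>_nat[OF f] by simp
    also have "\<dots> = Res ?W (farr v (farr u f)) (Res ?W (\<rho> b) (adj Lw F b s))"
      by (rule Res_Cmp[OF Wpre functor_hom[OF vf functor_hom[OF u f]] \<rho>[OF b] r_in[OF b s]])
    finally show "Res ?W (\<rho> a) (adj Lw F a (Res F f s)) =
        Res (direct (fcomp v u) ?W) f (Res ?W (\<rho> b) (adj Lw F b s))"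
      by (simp add: direct_fcomp)
  qed
  have lhs: "pcomp U A F (direct_mor A (fcomp v u) n) (pcomp U A F (direct_mor A u (adj Lv ?G)) (adj Lu F)) =
      (\<lambda>a\<in>Obj A. \<lambda>s\<in>U (Sec F a). n (fobj (fcomp v u) a) (?m a s))" for n
    unfolding pcomp_def by (intro restrict_ext) simp
  have rhs: "pcomp U A F (\<lambda>a. Res ?W (\<rho> a)) (adj Lw F) = ?r"
    by (simp add: pcomp_def)
  \<comment> \<open>Both composites are extensional functions, so their equality amounts to equality
    of values; this puts the description into the form of a universal property.\<close>
  have eq_iff: "n \<in> pmor U C ?K ?W \<and>
      pcomp U A F (direct_mor A (fcomp v u) n) (pcomp U A F (direct_mor A u (adj Lv ?G)) (adj Lu F)) =
      pcomp U A F (\<lambda>a. Res ?W (\<rho> a)) (adj Lw F) \<longleftrightarrow>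
      n \<in> pmor U C ?K ?W \<and> (\<forall>a\<in>Obj A. \<forall>s\<in>U (Sec F a). n (fobj (fcomp v u) a) (?m a s) = ?r a s)" for n
    unfolding lhs rhs
  proof (intro conj_cong refl iffI ballI)
    fix a s assume eq: "(\<lambda>a\<in>Obj A. \<lambda>s\<in>U (Sec F a). n (fobj (fcomp v u) a) (?m a s)) = ?r"
      and as: "a \<in> Obj A" "s \<in> U (Sec F a)"
    show "n (fobj (fcomp v u) a) (?m a s) = ?r a s"
      using fun_cong[OF fun_cong[OF eq, of a], of s] as by simp
  next
    assume "\<forall>a\<in>Obj A. \<forall>s\<in>U (Sec F a). n (fobj (fcomp v u) a) (?m a s) = ?r a s"
    then show "(\<lambda>a\<in>Obj A. \<lambda>s\<in>U (Sec F a). n (fobj (fcomp v u) a) (?m a s)) = ?r"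
      by (intro restrict_ext) simp
  qed
  obtain n where n: "n \<in> pmor U C ?K ?W"
    "\<And>a s. a \<in> Obj A \<Longrightarrow> s \<in> U (Sec F a) \<Longrightarrow> n (fobj (fcomp v u) a) (?m a s) = ?r a s"
    by (rule universal_arrow_factor[OF comp universal_arrow_sheaf[OF WU] r_pmor]) (rule that)
  have "\<exists>!n. n \<in> pmor U C ?K ?W \<and>
      (\<forall>a\<in>Obj A. \<forall>s\<in>U (Sec F a). n (fobj (fcomp v u) a) (?m a s) = ?r a s)"
  proof (rule ex1I[of _ n])
    show "n \<in> pmor U C ?K ?W \<and> (\<forall>a\<in>Obj A. \<forall>s\<in>U (Sec F a). n (fobj (fcomp v u) a) (?m a s) = ?r a s)"
      by (intro conjI ballI n)
    fix n' assume n': "n' \<in> pmor U C ?K ?W \<and>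
      (\<forall>a\<in>Obj A. \<forall>s\<in>U (Sec F a). n' (fobj (fcomp v u) a) (?m a s) = ?r a s)"
    show "n' = n"
    proof (rule universal_arrow_eqI[OF comp universal_arrow_sheaf[OF WU] conjunct1[OF n'] n(1)])
      fix a s assume as: "a \<in> Obj A" "s \<in> U (Sec F a)"
      show "n' (fobj (fcomp v u) a) (?m a s) = n (fobj (fcomp v u) a) (?m a s)"
        by (rule trans[OF conjunct2[OF n', rule_format, OF as] n(2)[OF as, symmetric]])
    qed
  qed
  from theI'[OF this] have *: "?n \<in> pmor U C ?K ?W \<and>
      (\<forall>a\<in>Obj A. \<forall>s\<in>U (Sec F a). ?n (fobj (fcomp v u) a) (?m a s) = ?r a s)"
    unfolding canonical_iso_def eq_iff .
  show "?n \<in> pmor U C ?K ?W"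
    by (rule conjunct1[OF *])
  show "?n (fobj v (fobj u a)) (adj Lv ?G (fobj u a) (adj Lu F a s)) = Res ?W (\<rho> a) (adj Lw F a s)"
    if "a \<in> Obj A" "s \<in> U (Sec F a)" for a s
    using conjunct2[OF *, rule_format, OF that] that by (simp add: fcomp_def)
qed

section \<open>The comparison morphism\<close>

locale comparison = fibred_sites P U
  for P :: "('o, 'a, 'i, 'f) fibred" and U :: "'u \<Rightarrow> 'u set" +
  fixes \<iota> :: 'i and e :: 'o and X :: "('x, 'y) site" and \<Psi> :: "('o, 'a, 'x, 'y) fctr"
  assumes universe: "universe U"
    and \<iota>_final: "final_obj (base P) \<iota>" and e_final: "final_obj (fibre P \<iota>) e"
    and X: "U_site U X" and \<Psi>: "continuous_functor U (coevanescent_site P) X \<Psi>"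
    and \<Psi>_left_exact: "left_exact (coevanescent_site P) X \<Psi>"
begin

abbreviation final_arrow :: "'i \<Rightarrow> 'f" where
  "final_arrow \<equiv> to_final (base P) \<iota>"

abbreviation sigma_arrow :: "'i \<Rightarrow> 'o \<Rightarrow> 'a" where
  "sigma_arrow i \<equiv> to_final (fibre P i) (sigma_obj P \<iota> e i)"

lemma X_cat: "category X"
  using X by (simp add: U_site_def)

lemma \<Psi>_functor: "is_functor (coevanescent_site P) X \<Psi>"
  using \<Psi> by (simp add: continuous_functor_def)

lemma \<Psi>_hom: "m \<in> hom (tot P) V W \<Longrightarrow> farr \<Psi> m \<in> hom X (fobj \<Psi> V) (fobj \<Psi> W)"
  using functor_hom[OF \<Psi>_functor] by simp

lemma \<Psi>_Cmp: "m \<in> hom (tot P) V W \<Longrightarrow> n \<in> hom (tot P) W Z \<Longrightarrow>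
    farr \<Psi> (Cmp (tot P) n m) = Cmp X (farr \<Psi> n) (farr \<Psi> m)"
  using functor_Cmp[OF \<Psi>_functor, of m n] by (simp add: hom_iff)

lemma final_arrow:
  assumes "i \<in> Obj (base P)"
  shows "final_arrow i \<in> Arr (base P)" "Dom (base P) (final_arrow i) = i" "Cod (base P) (final_arrow i) = \<iota>"
  using to_final_in_hom[OF \<iota>_final assms] by (simp_all add: hom_iff)

lemma \<iota>_Obj: "\<iota> \<in> Obj (base P)"
  using \<iota>_final by (simp add: final_obj_def)

lemma final_arrow_\<iota>: "final_arrow \<iota> = Ide (base P) \<iota>"
  using to_final_eqI[OF \<iota>_final \<iota>_Obj Ide_in_hom[OF B_cat \<iota>_Obj]] by simp

lemma final_arrow_Cmp:
  assumes "g \<in> hom (base P) j i"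
  shows "Cmp (base P) (final_arrow i) g = final_arrow j"
proof -
  have ij: "i \<in> Obj (base P)" "j \<in> Obj (base P)"
    using assms B_cat by (auto simp: hom_iff)
  show ?thesis
    by (rule to_final_eqI[OF \<iota>_final ij(2) Cmp_in_hom[OF B_cat assms to_final_in_hom[OF \<iota>_final ij(1)]]])
qed

lemma sigma_final:
  assumes "i \<in> Obj (base P)"
  shows "final_obj (fibre P i) (sigma_obj P \<iota> e i)"
  using left_exact_final_obj[OF inv_left_exact[OF final_arrow(1)[OF assms]]] e_final final_arrow[OF assms]
  by (simp add: sigma_obj_def)

lemma e_Obj: "e \<in> Obj (tot P)" "fobj (proj P) e = \<iota>"
  using e_final by (simp_all add: final_obj_def)

text \<open>Let \<open>j\<close> be the projection of \<open>W\<close>. Composed with the lift to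
  \<open>e\<close>, both arrows lie over the arrow from \<open>j\<close> to \<iota>, so their
  vertical parts are arrows of the fibre over \<open>j\<close> into the inverse image of
  \<open>e\<close>, which is final there. The composites therefore agree, and the cartesian property
  gives \<open>b = b'\<close>.\<close>

lemma sigma_eqI:
  assumes i: "i \<in> Obj (base P)" and b: "b \<in> hom (tot P) W (sigma_obj P \<iota> e i)"
    and b': "b' \<in> hom (tot P) W (sigma_obj P \<iota> e i)" and eq: "farr (proj P) b = farr (proj P) b'"
  shows "b = b'"
proof -
  note fi = final_arrow[OF i]
  have e_i: "fobj (proj P) e = Cod (base P) (final_arrow i)"
    using e_Obj fi by simp
  note l = lift_hom[OF fi(1) e_Obj(1) e_i]
  have b: "b \<in> hom (tot P) W (inv_obj P (final_arrow i) e)" "b' \<in> hom (tot P) W (inv_obj P (final_arrow i) e)"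
    using b b' by (simp_all add: sigma_obj_def)
  define j where "j = fobj (proj P) W"
  have "W \<in> Obj (tot P)"
    using b(1) E_cat by (auto simp: hom_iff)
  then have j: "j \<in> Obj (base P)"
    using functor_Obj[OF proj_functor] by (simp add: j_def)
  note fj = final_arrow[OF j]
  have e_j: "fobj (proj P) e = Cod (base P) (final_arrow j)"
    using e_Obj fj by simp
  have over: "farr (proj P) (Cmp (tot P) (lift P (final_arrow i) e) c) = final_arrow j"
    if "c \<in> hom (tot P) W (inv_obj P (final_arrow i) e)" for c
  proof -
    have "farr (proj P) c \<in> hom (base P) j i"
      using proj_hom[OF that] proj_inv_obj[OF fi(1) e_Obj(1) e_i] fi(2) by (simp add: j_def)
    then show ?thesis
      using proj_Cmp[OF that l] lift_cartesian(3)[OF fi(1) e_Obj(1) e_i] final_arrow_Cmp by simp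
  qed
  note v = vert_hom[OF fj(1) e_Obj(1) e_j Cmp_in_hom[OF E_cat b(1) l] over[OF b(1)], unfolded fj(2)]
  note v' = vert_hom[OF fj(1) e_Obj(1) e_j Cmp_in_hom[OF E_cat b(2) l] over[OF b(2)], unfolded fj(2)]
  have "vert P (final_arrow j) e (Cmp (tot P) (lift P (final_arrow i) e) b) =
      vert P (final_arrow j) e (Cmp (tot P) (lift P (final_arrow i) e) b')"
    using final_obj_unique[OF sigma_final[OF j] fibre_Cod(2)[OF v(1)]] v(1) v'(1) by (simp add: sigma_obj_def)
  then have "Cmp (tot P) (lift P (final_arrow i) e) b = Cmp (tot P) (lift P (final_arrow i) e) b'"
    using v(2) v'(2) by metis
  then show ?thesis
    by (rule lift_eqI[OF fi(1) e_Obj(1) e_i b eq])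
qed

lemma sigma_arrow:
  assumes "V \<in> Obj (fibre P i)"
  shows "sigma_arrow i V \<in> hom (fibre P i) V (sigma_obj P \<iota> e i)"
proof -
  have "i \<in> Obj (base P)"
    using functor_Obj[OF proj_functor, of V] assms by auto
  then show ?thesis
    by (rule to_final_in_hom[OF sigma_final assms])
qed

lemma sigma_arrow_Cmp:
  assumes "k \<in> hom (fibre P i) V W"
  shows "Cmp (tot P) (sigma_arrow i W) k = sigma_arrow i V"
proof -
  have "i \<in> Obj (base P)"
    using functor_Obj[OF proj_functor, of V] fibre_Cod(2)[OF assms] by auto
  from to_final_eqI[OF sigma_final[OF this] fibre_Cod(2)[OF assms]]
    Cmp_in_hom[OF fibre_category assms sigma_arrow[OF fibre_Cod(3)[OF assms]]]
  show ?thesis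
    by simp
qed

lemma inv_obj_final_arrow:
  assumes "i \<in> Obj (base P)" "V \<in> Obj (fibre P \<iota>)"
  shows "inv_obj P (final_arrow i) V \<in> Obj (fibre P i)"
    and "lift P (final_arrow i) V \<in> hom (tot P) (inv_obj P (final_arrow i) V) V"
    and "farr (proj P) (lift P (final_arrow i) V) = final_arrow i"
  using inv_obj_Obj[OF final_arrow(1)[OF assms(1)], of V] proj_inv_obj[OF final_arrow(1)[OF assms(1)], of V]
    lift_hom[OF final_arrow(1)[OF assms(1)], of V] lift_cartesian(3)[OF final_arrow(1)[OF assms(1)], of V]
    assms final_arrow[OF assms(1)] by simp_all

text \<open>An arrow into \<open>inv_obj P (final_arrow i) V\<close> amounts to an arrow into
  \<open>V\<close> together with a base arrow to \<open>i\<close>. An arrow into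
  \<open>sigma_obj P \<iota> e i\<close> is determined by its projection, so prescribing the base
  arrow as the projection of \<open>b\<close> is the same as prescribing the second component
  \<open>b\<close>.\<close>

lemma total_product:
  assumes i: "i \<in> Obj (base P)" and V: "V \<in> Obj (fibre P \<iota>)"
  shows "is_product (tot P) V (sigma_obj P \<iota> e i) (inv_obj P (final_arrow i) V)
    (lift P (final_arrow i) V) (sigma_arrow i (inv_obj P (final_arrow i) V))"
  unfolding is_product_def
proof (intro conjI ballI)
  let ?l = "lift P (final_arrow i) V" and ?t = "sigma_arrow i (inv_obj P (final_arrow i) V)"
  note fi = final_arrow[OF i]
  have V': "V \<in> Obj (tot P)" "fobj (proj P) V = Cod (base P) (final_arrow i)"
    using V fi by simp_all
  note iV = inv_obj_final_arrow[OF i V]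
  have t: "?t \<in> hom (tot P) (inv_obj P (final_arrow i) V) (sigma_obj P \<iota> e i)"
    "farr (proj P) ?t = Ide (base P) i"
    using sigma_arrow[OF iV(1)] unfolding fibre_hom_iff by simp_all
  have \<sigma>i: "fobj (proj P) (sigma_obj P \<iota> e i) = i"
    using fibre_Cod(1)[OF sigma_arrow[OF iV(1)]] .
  show "inv_obj P (final_arrow i) V \<in> Obj (tot P)" "?l \<in> hom (tot P) (inv_obj P (final_arrow i) V) V"
    "?t \<in> hom (tot P) (inv_obj P (final_arrow i) V) (sigma_obj P \<iota> e i)"
    using iV t by simp_all
  fix W a b assume W: "W \<in> Obj (tot P)" and a: "a \<in> hom (tot P) W V"
    and b: "b \<in> hom (tot P) W (sigma_obj P \<iota> e i)"
  have W': "fobj (proj P) W \<in> Obj (base P)"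
    using functor_Obj[OF proj_functor W] .
  have g: "farr (proj P) b \<in> hom (base P) (fobj (proj P) W) i"
    using proj_hom[OF b] \<sigma>i by simp
  have t_over: "farr (proj P) (Cmp (tot P) ?t k) = farr (proj P) k"
    if k: "k \<in> hom (tot P) W (inv_obj P (final_arrow i) V)" for k
    using proj_Cmp[OF k t(1)] t(2) proj_hom[OF k] iV(1) B_cat by (simp add: hom_iff)
  \<comment> \<open>There is only one base arrow from the projection of \<open>W\<close> to the
    final object \<iota>, so \<open>a\<close> and \<open>b\<close> have compatible
    projections.\<close>
  have "farr (proj P) a = Cmp (base P) (final_arrow i) (farr (proj P) b)"
    using final_arrow_Cmp[OF g] to_final_eqI[OF \<iota>_final W'] proj_hom[OF a] V by simp
  from lift_factor[OF fi(1) V' a _ this] g fi(2)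
  have ex1: "\<exists>!k. k \<in> hom (tot P) W (inv_obj P (final_arrow i) V) \<and> farr (proj P) k = farr (proj P) b \<and>
      Cmp (tot P) ?l k = a"
    by simp
  have "Cmp (tot P) ?t k = b \<longleftrightarrow> farr (proj P) k = farr (proj P) b"
    if k: "k \<in> hom (tot P) W (inv_obj P (final_arrow i) V)" for k
    using sigma_eqI[OF i Cmp_in_hom[OF E_cat k t(1)] b] t_over[OF k] by auto
  then have "(k \<in> hom (tot P) W (inv_obj P (final_arrow i) V) \<and> farr (proj P) k = farr (proj P) b \<and>
      Cmp (tot P) ?l k = a) \<longleftrightarrow>
      (k \<in> hom (tot P) W (inv_obj P (final_arrow i) V) \<and> Cmp (tot P) ?l k = a \<and> Cmp (tot P) ?t k = b)" for k
    by blast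
  with ex1 show "\<exists>!k. k \<in> hom (tot P) W (inv_obj P (final_arrow i) V) \<and>
      Cmp (tot P) ?l k = a \<and> Cmp (tot P) ?t k = b"
    by simp
qed

lemma Psi_at_simps [simp]:
  "fobj (Psi_at P \<Psi> \<iota> e i) V = farr \<Psi> (sigma_arrow i V)"
  "farr (Psi_at P \<Psi> \<iota> e i) k =
     (farr \<Psi> (sigma_arrow i (Dom (tot P) k)), farr \<Psi> k, farr \<Psi> (sigma_arrow i (Cod (tot P) k)))"
  by (simp_all add: Psi_at_def)

lemma Psi_sigma_arrow:
  assumes "V \<in> Obj (fibre P i)"
  shows "farr \<Psi> (sigma_arrow i V) \<in> hom X (fobj \<Psi> V) (u_obj P \<Psi> \<iota> e i)"
  using \<Psi>_hom sigma_arrow[OF assms] unfolding fibre_hom_iff u_obj_def by blast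

lemma Psi_at_hom:
  assumes k: "k \<in> hom (fibre P i) V W"
  shows "farr (Psi_at P \<Psi> \<iota> e i) k = (farr \<Psi> (sigma_arrow i V), farr \<Psi> k, farr \<Psi> (sigma_arrow i W))"
    and "farr \<Psi> k \<in> hom X (fobj \<Psi> V) (fobj \<Psi> W)"
    and "Cmp X (farr \<Psi> (sigma_arrow i W)) (farr \<Psi> k) = farr \<Psi> (sigma_arrow i V)"
    and "farr (Psi_at P \<Psi> \<iota> e i) k \<in>
      hom (slice X (u_obj P \<Psi> \<iota> e i)) (farr \<Psi> (sigma_arrow i V)) (farr \<Psi> (sigma_arrow i W))"
proof -
  have k': "k \<in> hom (tot P) V W"
    using k unfolding fibre_hom_iff by simp
  show 1: "farr (Psi_at P \<Psi> \<iota> e i) k = (farr \<Psi> (sigma_arrow i V), farr \<Psi> k, farr \<Psi> (sigma_arrow i W))"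
    using k' by (simp add: hom_iff)
  show 2: "farr \<Psi> k \<in> hom X (fobj \<Psi> V) (fobj \<Psi> W)"
    by (rule \<Psi>_hom[OF k'])
  have s: "sigma_arrow i W \<in> hom (tot P) W (sigma_obj P \<iota> e i)"
    using sigma_arrow[OF fibre_Cod(3)[OF k]] unfolding fibre_hom_iff by simp
  show 3: "Cmp X (farr \<Psi> (sigma_arrow i W)) (farr \<Psi> k) = farr \<Psi> (sigma_arrow i V)"
    using \<Psi>_Cmp[OF k' s] sigma_arrow_Cmp[OF k] by simp
  show "farr (Psi_at P \<Psi> \<iota> e i) k \<in>
      hom (slice X (u_obj P \<Psi> \<iota> e i)) (farr \<Psi> (sigma_arrow i V)) (farr \<Psi> (sigma_arrow i W))"
    using 1 2 3 Psi_sigma_arrow[OF fibre_Cod(2)[OF k]] Psi_sigma_arrow[OF fibre_Cod(3)[OF k]]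
    unfolding slice_hom_iff by (simp add: arrows_to_iff hom_iff)
qed

lemma Psi_at_functor:
  "is_functor (fibre P i) (slice X (u_obj P \<Psi> \<iota> e i)) (Psi_at P \<Psi> \<iota> e i)"
  unfolding is_functor_def
proof (intro conjI ballI impI)
  fix V assume V: "V \<in> Obj (fibre P i)"
  have s: "farr \<Psi> (sigma_arrow i V) \<in> arrows_to X (u_obj P \<Psi> \<iota> e i)"
    "Dom X (farr \<Psi> (sigma_arrow i V)) = fobj \<Psi> V"
    using Psi_sigma_arrow[OF V] by (simp_all add: arrows_to_iff hom_iff)
  show "fobj (Psi_at P \<Psi> \<iota> e i) V \<in> Obj (slice X (u_obj P \<Psi> \<iota> e i))"
    using s by (simp add: slice_simps)
  have "farr \<Psi> (Ide (tot P) V) = Ide X (fobj \<Psi> V)"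
    using functor_Ide[OF \<Psi>_functor, of V] V by simp
  then show "farr (Psi_at P \<Psi> \<iota> e i) (Ide (fibre P i) V) =
      Ide (slice X (u_obj P \<Psi> \<iota> e i)) (fobj (Psi_at P \<Psi> \<iota> e i) V)"
    using V s E_cat by (simp add: slice_simps)
next
  fix k assume "k \<in> Arr (fibre P i)"
  then have "k \<in> hom (fibre P i) (Dom (fibre P i) k) (Cod (fibre P i) k)"
    by (simp add: hom_iff)
  from Psi_at_hom(4)[OF this] show "farr (Psi_at P \<Psi> \<iota> e i) k \<in>
      hom (slice X (u_obj P \<Psi> \<iota> e i)) (fobj (Psi_at P \<Psi> \<iota> e i) (Dom (fibre P i) k))
        (fobj (Psi_at P \<Psi> \<iota> e i) (Cod (fibre P i) k))"
    by simp
next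
  fix f g assume "f \<in> Arr (fibre P i)" "g \<in> Arr (fibre P i)" "Dom (fibre P i) g = Cod (fibre P i) f"
  then have "f \<in> hom (tot P) (Dom (tot P) f) (Dom (tot P) g)" "g \<in> hom (tot P) (Dom (tot P) g) (Cod (tot P) g)"
    by (simp_all add: hom_iff)
  then show "farr (Psi_at P \<Psi> \<iota> e i) (Cmp (fibre P i) g f) =
      Cmp (slice X (u_obj P \<Psi> \<iota> e i)) (farr (Psi_at P \<Psi> \<iota> e i) g) (farr (Psi_at P \<Psi> \<iota> e i) f)"
    using \<Psi>_Cmp[of f "Dom (tot P) f" "Dom (tot P) g" g "Cod (tot P) g"] E_cat
    by (simp add: slice_simps hom_iff)
qed

lemma fibre_inclusion_functor: "is_functor (fibre P i) (coevanescent_site P) fibre_inclusion"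
  by (simp add: is_functor_def fibre_inclusion_def hom_iff)

lemma fobj_fibre_inclusion [simp]: "fobj fibre_inclusion V = V" "farr fibre_inclusion m = m"
  by (simp_all add: fibre_inclusion_def)

lemma fcomp_fibre_inclusion [simp]:
  "fobj (fcomp \<Psi> fibre_inclusion) V = fobj \<Psi> V" "farr (fcomp \<Psi> fibre_inclusion) m = farr \<Psi> m"
  by (simp_all add: fcomp_def fibre_inclusion_def)

lemma direct_\<Psi>_fibre_inclusion: "direct (fcomp \<Psi> fibre_inclusion) G = direct \<Psi> G"
  by (simp add: direct_fcomp)

text \<open>Left exactness of \<Psi> sends the product of \<open>V\<close> and
  \<open>sigma_obj P \<iota> e i\<close> in \<open>E\<close> to a product in \<open>X\<close>. Its
  projections are the images of the chosen lift and of the arrow to the final object of the fibre,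
  the latter being the value at \<open>V\<close> of the functor to the slice.\<close>

lemma localized_universal_arrow:
  assumes F: "presheaf U (fibre P \<iota>) F"
    and G: "universal_arrow U (fibre P \<iota>) X (fcomp \<Psi> fibre_inclusion) F G \<alpha>" and i: "i \<in> Obj (base P)"
  shows "universal_arrow U (fibre P \<iota>) (slice X (u_obj P \<Psi> \<iota> e i))
    (fcomp (Psi_at P \<Psi> \<iota> e i) (inv_functor P (final_arrow i))) F (direct (slice_forget X) G)
    (\<lambda>V\<in>Obj (fibre P \<iota>). \<lambda>s\<in>U (Sec F V). Res G (farr \<Psi> (lift P (final_arrow i) V)) (\<alpha> V s))"
proof (rule slice_universal_arrow[OF universe X _ fibre_category F
      functor_fcomp[OF fibre_inclusion_functor \<Psi>_functor] G])
  let ?v = "fcomp (Psi_at P \<Psi> \<iota> e i) (inv_functor P (final_arrow i))"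
  have v: "fobj ?v V = farr \<Psi> (sigma_arrow i (inv_obj P (final_arrow i) V))" for V
    by (simp add: fcomp_def)
  have s: "farr \<Psi> (sigma_arrow i (inv_obj P (final_arrow i) V)) \<in>
      hom X (fobj \<Psi> (inv_obj P (final_arrow i) V)) (u_obj P \<Psi> \<iota> e i)" if "V \<in> Obj (fibre P \<iota>)" for V
    by (rule Psi_sigma_arrow[OF inv_obj_final_arrow(1)[OF i that]])
  then have v_Dom: "Dom X (fobj ?v V) = fobj \<Psi> (inv_obj P (final_arrow i) V)" if "V \<in> Obj (fibre P \<iota>)" for V
    using that v by (simp add: hom_iff)
  show "u_obj P \<Psi> \<iota> e i \<in> Obj X"
    using functor_Obj[OF \<Psi>_functor, of "sigma_obj P \<iota> e i"] sigma_final[OF i]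
    by (simp add: u_obj_def final_obj_def)
  show "fobj ?v V \<in> arrows_to X (u_obj P \<Psi> \<iota> e i)" if "V \<in> Obj (fibre P \<iota>)" for V
    using s[OF that] unfolding v by (simp add: hom_iff arrows_to_iff)
  show "farr \<Psi> (lift P (final_arrow i) V) \<in> hom X (Dom X (fobj ?v V)) (fobj (fcomp \<Psi> fibre_inclusion) V)"
    if "V \<in> Obj (fibre P \<iota>)" for V
    using \<Psi>_hom[OF inv_obj_final_arrow(2)[OF i that]] v_Dom[OF that] by simp
  show "\<exists>k\<in>hom X (Dom X (fobj ?v V')) (Dom X (fobj ?v V)).
       farr ?v f = (fobj ?v V', k, fobj ?v V) \<and> Cmp X (fobj ?v V) k = fobj ?v V' \<and>
       Cmp X (farr \<Psi> (lift P (final_arrow i) V)) k =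
       Cmp X (farr (fcomp \<Psi> fibre_inclusion) f) (farr \<Psi> (lift P (final_arrow i) V'))"
    if f: "f \<in> hom (fibre P \<iota>) V' V" for f V' V
  proof -
    note fi = final_arrow[OF i]
    note V = fibre_Cod(2)[OF f] fibre_Cod(3)[OF f]
    have f': "f \<in> hom (tot P) V' V"
      using f unfolding fibre_hom_iff by simp
    let ?k = "farr (inv_functor P (final_arrow i)) f"
    have k: "?k \<in> hom (fibre P i) (inv_obj P (final_arrow i) V') (inv_obj P (final_arrow i) V)"
      "Cmp (tot P) (lift P (final_arrow i) V) ?k = Cmp (tot P) f (lift P (final_arrow i) V')"
      using inv_functor_hom[OF fi(1), of f V' V] f fi by simp_all
    have k': "?k \<in> hom (tot P) (inv_obj P (final_arrow i) V') (inv_obj P (final_arrow i) V)"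
      using k(1) unfolding fibre_hom_iff by simp
    note Pk = Psi_at_hom[OF k(1)]
    show ?thesis
    proof (intro bexI[of _ "farr \<Psi> ?k"] conjI)
      show "farr ?v f = (fobj ?v V', farr \<Psi> ?k, fobj ?v V)"
        using Pk(1) by (simp add: fcomp_def)
      show "Cmp X (fobj ?v V) (farr \<Psi> ?k) = fobj ?v V'"
        using Pk(3) v by simp
      show "Cmp X (farr \<Psi> (lift P (final_arrow i) V)) (farr \<Psi> ?k) =
          Cmp X (farr (fcomp \<Psi> fibre_inclusion) f) (farr \<Psi> (lift P (final_arrow i) V'))"
        using \<Psi>_Cmp[OF k' inv_obj_final_arrow(2)[OF i V(2)]]
          \<Psi>_Cmp[OF inv_obj_final_arrow(2)[OF i V(1)] f'] k(2) by simp
      show "farr \<Psi> ?k \<in> hom X (Dom X (fobj ?v V')) (Dom X (fobj ?v V))"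
        using Pk(2) v_Dom[OF V(1)] v_Dom[OF V(2)] by simp
    qed
  qed
  show "\<exists>!k. k \<in> hom X (Dom X b) (Dom X (fobj ?v V)) \<and> Cmp X (farr \<Psi> (lift P (final_arrow i) V)) k = a \<and>
      Cmp X (fobj ?v V) k = b"
    if V: "V \<in> Obj (fibre P \<iota>)" and ab: "(a, b) \<in> spans X (u_obj P \<Psi> \<iota> e i) (fobj (fcomp \<Psi> fibre_inclusion) V)"
    for V a b
  proof -
    have "is_product X (fobj \<Psi> V) (u_obj P \<Psi> \<iota> e i) (fobj \<Psi> (inv_obj P (final_arrow i) V))
       (farr \<Psi> (lift P (final_arrow i) V)) (fobj ?v V)"
      using left_exact_product[OF \<Psi>_left_exact \<Psi>_functor _ X_cat] total_product[OF i V] E_cat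
      by (simp add: v u_obj_def)
    then have prod: "\<forall>c\<in>Obj X. \<forall>a\<in>hom X c (fobj \<Psi> V). \<forall>b\<in>hom X c (u_obj P \<Psi> \<iota> e i).
        \<exists>!k. k \<in> hom X c (fobj \<Psi> (inv_obj P (final_arrow i) V)) \<and>
          Cmp X (farr \<Psi> (lift P (final_arrow i) V)) k = a \<and> Cmp X (fobj ?v V) k = b"
      unfolding is_product_def by (elim conjE)
    have "Dom X b \<in> Obj X" "a \<in> hom X (Dom X b) (fobj \<Psi> V)" "b \<in> hom X (Dom X b) (u_obj P \<Psi> \<iota> e i)"
      using ab X_cat by (simp_all add: spans_iff hom_iff)
    then show ?thesis
      unfolding v_Dom[OF V] by (rule prod[rule_format])
  qed
qed

end

section \<open>Identification of the inverse images on the fibres with the restrictions of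
  \<open>H\<close>\<close>

locale comparison_sheaf = comparison P U \<iota> e X \<Psi>
  for P :: "('o, 'a, 'i, 'f) fibred" and U :: "'u \<Rightarrow> 'u set"
    and \<iota> :: 'i and e :: 'o and X :: "('x, 'y) site" and \<Psi> :: "('o, 'a, 'x, 'y) fctr" +
  fixes L :: "'f \<Rightarrow> ('o, 'a, 'o, 'a, 'u) inv_im"
    and L\<Psi>\<iota> :: "('o, 'a, 'x, 'y, 'u) inv_im"
    and L\<Psi>i :: "'i \<Rightarrow> ('o, 'a, 'y, 'y \<times> 'y \<times> 'y, 'u) inv_im"
    and F :: "('o, 'a, 'u) psh"
  assumes L: "\<And>f. f \<in> Arr (base P) \<Longrightarrow>
      inverse_image U (fibre P (Cod (base P) f)) (fibre P (Dom (base P) f)) (inv_functor P f) (L f)"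
    and L\<Psi>\<iota>: "inverse_image U (fibre P \<iota>) X (fcomp \<Psi> fibre_inclusion) L\<Psi>\<iota>"
    and L\<Psi>i: "\<And>i. i \<in> Obj (base P) \<Longrightarrow>
      inverse_image U (fibre P i) (slice X (u_obj P \<Psi> \<iota> e i)) (Psi_at P \<Psi> \<iota> e i) (L\<Psi>i i)"
    and L\<Psi>i_iso: "\<And>i F. i \<in> Obj (base P) \<Longrightarrow> sheaf U (fibre P i) F \<Longrightarrow>
      piso U (fibre P i) F (direct (Psi_at P \<Psi> \<iota> e i) (star (L\<Psi>i i) F)) (adj (L\<Psi>i i) F)"
    and F: "sheaf U (fibre P \<iota>) F"
begin

abbreviation G :: "('x, 'y, 'u) psh" where "G \<equiv> star L\<Psi>\<iota> F"
abbreviation H :: "('o, 'a, 'u) psh" where "H \<equiv> direct \<Psi> G"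
abbreviation \<alpha> :: "'o \<Rightarrow> 'u \<Rightarrow> 'u" where "\<alpha> \<equiv> adj L\<Psi>\<iota> F"
abbreviation Fi :: "'i \<Rightarrow> ('o, 'a, 'u) psh" where "Fi i \<equiv> star (L (final_arrow i)) F"

text \<open>The candidate for the adjunction morphism that exhibits \<open>H\<close>, on the fibre
  over \<open>i\<close>, as the inverse image of \<open>F\<close>: \<alpha> followed by the
  transition morphism of \<open>H\<close>.\<close>

definition \<alpha>i :: "'i \<Rightarrow> 'o \<Rightarrow> 'u \<Rightarrow> 'u" where
  "\<alpha>i i = (\<lambda>V\<in>Obj (fibre P \<iota>). \<lambda>s\<in>U (Sec F V). Res H (lift P (final_arrow i) V) (\<alpha> V s))"

lemma \<alpha>i_apply: "V \<in> Obj (fibre P \<iota>) \<Longrightarrow> s \<in> U (Sec F V) \<Longrightarrow>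
    \<alpha>i i V s = Res H (lift P (final_arrow i) V) (\<alpha> V s)"
  unfolding \<alpha>i_def by (simp only: restrict_apply' if_True)

lemma F_presheaf: "presheaf U (fibre P \<iota>) F"
  by (rule sheaf_presheaf[OF F])

lemma G_universal: "universal_arrow U (fibre P \<iota>) X (fcomp \<Psi> fibre_inclusion) F G \<alpha>"
  by (rule inverse_image_universal_arrow[OF fibre_category
        functor_fcomp[OF fibre_inclusion_functor \<Psi>_functor] L\<Psi>\<iota> F])

lemma H_sheaf: "sheaf U (coevanescent_site P) H"
  using \<Psi> universal_arrow_sheaf[OF G_universal] unfolding continuous_functor_def by blast

lemma H_presheaf: "presheaf U (tot P) H"
  using sheaf_presheaf[OF H_sheaf] by simp

lemma \<alpha>_pmor: "\<alpha> \<in> pmor U (fibre P \<iota>) F H"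
  using universal_arrow_pmor[OF G_universal] by (simp only: direct_\<Psi>_fibre_inclusion)

lemma Fi_universal:
  assumes "i \<in> Obj (base P)"
  shows "universal_arrow U (fibre P \<iota>) (fibre P i) (inv_functor P (final_arrow i)) F
    (Fi i) (adj (L (final_arrow i)) F)"
  using inverse_image_universal_arrow[OF fibre_category inv_is_functor L, of "final_arrow i" F]
    final_arrow[OF assms] F by simp

lemma \<alpha>i_pmor:
  assumes i: "i \<in> Obj (base P)"
  shows "\<alpha>i i \<in> pmor U (fibre P \<iota>) F (direct (inv_functor P (final_arrow i)) H)"
  unfolding \<alpha>i_def
proof (rule pmorI[OF _ _ fibre_category F_presheaf])
  fix V s assume V: "V \<in> Obj (fibre P \<iota>)" and s: "s \<in> U (Sec F V)"
  show "Res H (lift P (final_arrow i) V) (\<alpha> V s) \<in> U (Sec (direct (inv_functor P (final_arrow i)) H) V)"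
    using Res_in[OF H_presheaf inv_obj_final_arrow(2)[OF i V] pmor_in[OF \<alpha>_pmor V s]] by simp
next
  note fi = final_arrow[OF i]
  fix f V' V s assume f: "f \<in> hom (fibre P \<iota>) V' V" and V: "V' \<in> Obj (fibre P \<iota>)" "V \<in> Obj (fibre P \<iota>)"
    and s: "s \<in> U (Sec F V)"
  have f': "f \<in> hom (tot P) V' V"
    using f unfolding fibre_hom_iff by simp
  note k = inv_functor_hom[OF fi(1), of f V' V, unfolded fi(2,3), OF f]
  have k': "farr (inv_functor P (final_arrow i)) f \<in>
      hom (tot P) (inv_obj P (final_arrow i) V') (inv_obj P (final_arrow i) V)"
    using k(1) unfolding fibre_hom_iff by simp
  note \<alpha>s = pmor_in[OF \<alpha>_pmor V(2) s]
  have "Res H (lift P (final_arrow i) V') (\<alpha> V' (Res F f s)) =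
      Res H (Cmp (tot P) f (lift P (final_arrow i) V')) (\<alpha> V s)"
    using pmor_Res[OF \<alpha>_pmor f s] Res_Cmp[OF H_presheaf inv_obj_final_arrow(2)[OF i V(1)] f' \<alpha>s] by metis
  also have "\<dots> = Res H (farr (inv_functor P (final_arrow i)) f) (Res H (lift P (final_arrow i) V) (\<alpha> V s))"
    using Res_Cmp[OF H_presheaf k' inv_obj_final_arrow(2)[OF i V(2)] \<alpha>s] k(2) by metis
  finally show "Res H (lift P (final_arrow i) V') (\<alpha> V' (Res F f s)) =
      Res (direct (inv_functor P (final_arrow i)) H) f (Res H (lift P (final_arrow i) V) (\<alpha> V s))"
    by (simp only: Res_direct)
qed

text \<open>
  Both \<open>\<Psi>\<^sub>i\<^sup>*f\<^sub>i\<^sup>*F\<close> and the restriction of \<open>\<Psi>\<^sub>\<iota>\<^sup>*F\<close> to the slice represent the morphisms from \<open>F\<close> to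
  \<open>f\<^sub>i\<^sub>*\<Psi>\<^sub>i\<^sub>*Q\<close>. Since \<open>\<Psi>\<^sub>i\<close> is only tested on \<open>f\<^sub>i\<^sup>*F = \<Psi>\<^sub>i\<^sub>*\<Psi>\<^sub>i\<^sup>*f\<^sub>i\<^sup>*F\<close> and on \<open>H\<close>, its continuity is not needed.
\<close>

lemma Fi_iso_H:
  assumes i: "i \<in> Obj (base P)"
  shows "\<exists>a. piso U (fibre P i) (Fi i) H a \<and>
    (\<forall>V\<in>Obj (fibre P \<iota>). \<forall>s\<in>U (Sec F V).
       a (inv_obj P (final_arrow i) V) (adj (L (final_arrow i)) F V s) = \<alpha>i i V s)"
proof -
  let ?adj = "adj (L (final_arrow i)) F" and ?\<Psi>i = "Psi_at P \<Psi> \<iota> e i" and ?x = "u_obj P \<Psi> \<iota> e i"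
  let ?v = "fcomp ?\<Psi>i (inv_functor P (final_arrow i))" and ?G = "direct (slice_forget X) G"
  note fi = final_arrow[OF i]
  note FU = Fi_universal[OF i]
  note Fi = universal_arrow_sheaf[OF FU] and adj = universal_arrow_pmor[OF FU]
  note Fi_pre = sheaf_presheaf[OF Fi]
  note H_i = fibre_sheaf[OF H_sheaf, of i]
  note QU = inverse_image_universal_arrow[OF fibre_category Psi_at_functor L\<Psi>i[OF i] Fi]
  let ?Q = "star (L\<Psi>i i) (Fi i)" and ?\<eta> = "adj (L\<Psi>i i) (Fi i)"
  note Q = universal_arrow_sheaf[OF QU] and \<eta> = universal_arrow_pmor[OF QU]
  have GU: "universal_arrow U (fibre P \<iota>) (slice X ?x) ?v F ?G (\<alpha>i i)"
    unfolding \<alpha>i_def Res_direct by (rule localized_universal_arrow[OF F_presheaf G_universal i])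
  have v: "fobj ?v V = farr \<Psi> (sigma_arrow i (inv_obj P (final_arrow i) V))" for V
    by (simp add: fcomp_def)
  have inv: "is_functor (fibre P \<iota>) (fibre P i) (inv_functor P (final_arrow i))"
    using inv_is_functor[OF fi(1)] fi by simp
  have Sec_G: "Sec ?G (fobj ?\<Psi>i V) = Sec H V" if "V \<in> Obj (fibre P i)" for V
    using Psi_sigma_arrow[OF that] by (simp add: hom_iff)
  have Gpre: "presheaf U (fibre P i) (direct ?\<Psi>i ?G)"
    by (rule direct_presheaf[OF Psi_at_functor fibre_category slice_category[OF X_cat]
          sheaf_presheaf[OF universal_arrow_sheaf[OF GU]]])
  \<comment> \<open>One direction comes directly from the universal property of \<open>Fi i\<close>,
    because \<open>H\<close> is a sheaf on the fibre.\<close>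
  obtain a where a: "a \<in> pmor U (fibre P i) (Fi i) H"
    "\<And>V s. V \<in> Obj (fibre P \<iota>) \<Longrightarrow> s \<in> U (Sec F V) \<Longrightarrow> a (fobj (inv_functor P (final_arrow i)) V) (?adj V s) = \<alpha>i i V s"
    by (rule universal_arrow_factor[OF FU H_i \<alpha>i_pmor[OF i]]) (rule that)
  note a_adj = a(2)[unfolded fobj_inv_functor]
  \<comment> \<open>The assumption on the adjunction morphisms is used here, for the sheaf
    \<open>Fi i\<close>.\<close>
  obtain \<eta>' where \<eta>': "piso U (fibre P i) (direct ?\<Psi>i ?Q) (Fi i) \<eta>'"
    and \<eta>'\<eta>: "\<And>V s. V \<in> Obj (fibre P i) \<Longrightarrow> s \<in> U (Sec (Fi i) V) \<Longrightarrow> \<eta>' V (?\<eta> V s) = s"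
    and \<eta>\<eta>': "\<And>V s. V \<in> Obj (fibre P i) \<Longrightarrow> s \<in> U (Sec (direct ?\<Psi>i ?Q) V) \<Longrightarrow> ?\<eta> V (\<eta>' V s) = s"
    by (rule piso_inverse[OF L\<Psi>i_iso[OF i Fi] fibre_category Fi_pre
          direct_presheaf[OF Psi_at_functor fibre_category slice_category[OF X_cat] sheaf_presheaf[OF Q]]])
      (rule that)
  note \<eta>'m = piso_pmor[OF \<eta>']
  \<comment> \<open>The composite adjunction morphism of \<open>F\<close> with target
    \<open>?Q\<close> factors through the restriction \<open>?G\<close> of \<open>G\<close> to the
    slice. This gives \<open>n\<close> from \<open>?G\<close> to \<open>?Q\<close>;
    \<open>a'\<close> below goes back.\<close>
  have "(\<lambda>V\<in>Obj (fibre P \<iota>). \<lambda>s\<in>U (Sec F V).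
      ?\<eta> (fobj (inv_functor P (final_arrow i)) V) (?adj V s)) \<in> pmor U (fibre P \<iota>) F (direct ?v ?Q)"
    unfolding direct_fcomp by (rule pmor_whisker[OF fibre_category inv F_presheaf adj \<eta>])
  with GU Q obtain n where n: "n \<in> pmor U (slice X ?x) ?G ?Q"
    and n': "\<And>V s. V \<in> Obj (fibre P \<iota>) \<Longrightarrow> s \<in> U (Sec F V) \<Longrightarrow>
      n (fobj ?v V) (\<alpha>i i V s) = (\<lambda>V\<in>Obj (fibre P \<iota>). \<lambda>s\<in>U (Sec F V).
        ?\<eta> (fobj (inv_functor P (final_arrow i)) V) (?adj V s)) V s"
    by (rule universal_arrow_factor) (rule that)
  have n_\<alpha>: "n (farr \<Psi> (sigma_arrow i (inv_obj P (final_arrow i) V))) (\<alpha>i i V s) =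
      ?\<eta> (inv_obj P (final_arrow i) V) (?adj V s)" if "V \<in> Obj (fibre P \<iota>)" "s \<in> U (Sec F V)" for V s
    using n'[OF that] that by (simp only: v restrict_apply' fobj_inv_functor)
  \<comment> \<open>\<open>H\<close> and the direct image of \<open>?G\<close> have the same
    sections over objects of the fibre but may differ as records elsewhere, so membership of
    \<open>a\<close> is established anew.\<close>
  have "a \<in> pmor U (fibre P i) (Fi i) (direct ?\<Psi>i ?G)"
  proof -
    have "(\<lambda>V\<in>Obj (fibre P i). \<lambda>s\<in>U (Sec (Fi i) V). a V s) \<in> pmor U (fibre P i) (Fi i) (direct ?\<Psi>i ?G)"
    proof (rule pmorI[OF _ _ fibre_category Fi_pre])
      show "a V s \<in> U (Sec (direct ?\<Psi>i ?G) V)" if "V \<in> Obj (fibre P i)" "s \<in> U (Sec (Fi i) V)" for V s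
        using pmor_in[OF a(1) that] Sec_G[OF that(1)] by simp
      show "a V' (Res (Fi i) f s) = Res (direct ?\<Psi>i ?G) f (a V s)"
        if "f \<in> hom (fibre P i) V' V" "s \<in> U (Sec (Fi i) V)" for f V' V s
        using pmor_Res[OF a(1) that] by simp
    qed
    moreover have "(\<lambda>V\<in>Obj (fibre P i). \<lambda>s\<in>U (Sec (Fi i) V). a V s) = a"
      by (rule pmor_eqI[OF calculation a(1)]) simp
    ultimately show ?thesis
      by simp
  qed
  with QU universal_arrow_sheaf[OF GU] obtain a' where a': "a' \<in> pmor U (slice X ?x) ?Q ?G"
    and a'_\<eta>: "\<And>V s. V \<in> Obj (fibre P i) \<Longrightarrow> s \<in> U (Sec (Fi i) V) \<Longrightarrow>
      a' (fobj ?\<Psi>i V) (?\<eta> V s) = a V s"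
    by (rule universal_arrow_factor) (rule that)
  note a'_\<eta> = a'_\<eta>[unfolded Psi_at_simps]
  note G_pre = sheaf_presheaf[OF universal_arrow_sheaf[OF GU]]
  have iV: "inv_obj P (final_arrow i) V \<in> Obj (fibre P i)" if "V \<in> Obj (fibre P \<iota>)" for V
    by (rule inv_obj_final_arrow(1)[OF i that])
  have adj_in: "?adj V s \<in> U (Sec (Fi i) (inv_obj P (final_arrow i) V))"
    if "V \<in> Obj (fibre P \<iota>)" "s \<in> U (Sec F V)" for V s
    using pmor_in[OF adj that] by simp
  have \<alpha>i_in: "\<alpha>i i V s \<in> U (Sec ?G (fobj ?v V))" if "V \<in> Obj (fibre P \<iota>)" "s \<in> U (Sec F V)" for V s
    using pmor_in[OF \<alpha>i_pmor[OF i] that] Sec_G[OF iV[OF that(1)]] by (simp add: fcomp_def)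
  have v_Obj: "fobj ?v V \<in> Obj (slice X ?x)" if "V \<in> Obj (fibre P \<iota>)" for V
    using functor_Obj[OF functor_fcomp[OF inv Psi_at_functor] that] .
  \<comment> \<open>Tested on \<open>F\<close>: \<open>n\<close> sends \<open>\<alpha>i i\<close> to
    the composite adjunction morphism, and \<open>a'\<close> sends this back to
    \<open>\<alpha>i i\<close> because it extends \<open>a\<close>.\<close>
  have a'n: "pcomp U (slice X ?x) ?G a' n = pid U (slice X ?x) ?G"
  proof (rule universal_arrow_eqI[OF GU universal_arrow_sheaf[OF GU]])
    show "pcomp U (slice X ?x) ?G a' n \<in> pmor U (slice X ?x) ?G ?G"
      by (rule pcomp_pmor[OF slice_category[OF X_cat] G_pre n a'])
    show "pid U (slice X ?x) ?G \<in> pmor U (slice X ?x) ?G ?G"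
      by (rule pid_pmor[OF slice_category[OF X_cat] G_pre])
    fix V s assume V: "V \<in> Obj (fibre P \<iota>)" and s: "s \<in> U (Sec F V)"
    have "a' (fobj ?v V) (n (fobj ?v V) (\<alpha>i i V s)) = \<alpha>i i V s"
      using n_\<alpha>[OF V s] a'_\<eta>[OF iV[OF V] adj_in[OF V s]] a_adj[OF V s] by (simp add: fcomp_def)
    then show "pcomp U (slice X ?x) ?G a' n (fobj ?v V) (\<alpha>i i V s) = pid U (slice X ?x) ?G (fobj ?v V) (\<alpha>i i V s)"
      using v_Obj[OF V] \<alpha>i_in[OF V s] by (simp only: pcomp_apply pid_apply)
  qed
  \<comment> \<open>The inverse of \<open>a\<close>: the direct image of \<open>n\<close> followed
    by the inverse of the adjunction morphism.\<close>
  let ?b = "\<lambda>V t. \<eta>' V (n (farr \<Psi> (sigma_arrow i V)) t)"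
  have slice_Obj: "farr \<Psi> (sigma_arrow i V) \<in> Obj (slice X ?x)" if "V \<in> Obj (fibre P i)" for V
    using functor_Obj[OF Psi_at_functor that] by simp
  have n_in: "n (farr \<Psi> (sigma_arrow i V)) t \<in> U (Sec (direct ?\<Psi>i ?Q) V)"
    if "V \<in> Obj (fibre P i)" "t \<in> U (Sec H V)" for V t
    using pmor_in[OF n slice_Obj[OF that(1)]] that(2) Sec_G[OF that(1)] by simp
  have b: "(\<lambda>V\<in>Obj (fibre P i). \<lambda>t\<in>U (Sec H V). ?b V t) \<in> pmor U (fibre P i) H (Fi i)"
  proof (rule pmorI[OF _ _ fibre_category sheaf_presheaf[OF H_i]])
    show "?b V t \<in> U (Sec (Fi i) V)" if "V \<in> Obj (fibre P i)" "t \<in> U (Sec H V)" for V t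
      by (rule pmor_in[OF \<eta>'m that(1) n_in[OF that]])
    fix f V' V t assume f: "f \<in> hom (fibre P i) V' V" and V: "V \<in> Obj (fibre P i)" and t: "t \<in> U (Sec H V)"
    have t': "t \<in> U (Sec ?G (farr \<Psi> (sigma_arrow i V)))"
      using t Sec_G[OF V] by simp
    have "n (farr \<Psi> (sigma_arrow i V')) (Res H f t) = Res (direct ?\<Psi>i ?Q) f (n (farr \<Psi> (sigma_arrow i V)) t)"
      using pmor_Res[OF n Psi_at_hom(4)[OF f] t'] by simp
    then show "?b V' (Res H f t) = Res (Fi i) f (?b V t)"
      using pmor_Res[OF \<eta>'m f n_in[OF V t]] by simp
  qed
  have ba: "?b V (a V s) = s" if V: "V \<in> Obj (fibre P i)" and s: "s \<in> U (Sec (Fi i) V)" for V s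
  proof -
    let ?c = "pcomp U (fibre P i) (Fi i) (\<lambda>V\<in>Obj (fibre P i). \<lambda>t\<in>U (Sec H V). ?b V t) a"
    have "?c = pid U (fibre P i) (Fi i)"
    proof (rule universal_arrow_eqI[OF FU Fi pcomp_pmor[OF fibre_category Fi_pre a(1) b]
          pid_pmor[OF fibre_category Fi_pre]])
      fix V s assume V: "V \<in> Obj (fibre P \<iota>)" and s: "s \<in> U (Sec F V)"
      have "?b (inv_obj P (final_arrow i) V) (\<alpha>i i V s) = ?adj V s"
        unfolding n_\<alpha>[OF V s] by (rule \<eta>'\<eta>[OF iV[OF V] adj_in[OF V s]])
      then show "?c (fobj (inv_functor P (final_arrow i)) V) (?adj V s) =
          pid U (fibre P i) (Fi i) (fobj (inv_functor P (final_arrow i)) V) (?adj V s)"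
        using iV[OF V] adj_in[OF V s] pmor_in[OF a(1) iV[OF V] adj_in[OF V s]] a_adj[OF V s]
        by (simp only: pcomp_apply pid_apply restrict_apply' fobj_inv_functor)
    qed
    from fun_cong[OF fun_cong[OF this, of V], of s] show ?thesis
      using V s pmor_in[OF a(1) V s] by (simp only: pcomp_apply pid_apply restrict_apply')
  qed
  \<comment> \<open>Here \<open>a\<close> is written as \<open>a'\<close> after
    \<open>?\<eta>\<close>; the latter cancels against \<open>\<eta>'\<close>, and \<open>a'\<close>
    after \<open>n\<close> is the identity.\<close>
  have ab: "a V (?b V t) = t" if V: "V \<in> Obj (fibre P i)" and t: "t \<in> U (Sec H V)" for V t
  proof -
    have t': "t \<in> U (Sec ?G (farr \<Psi> (sigma_arrow i V)))"
      using t Sec_G[OF V] by simp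
    have "a V (?b V t) = a' (farr \<Psi> (sigma_arrow i V)) (?\<eta> V (?b V t))"
      using a'_\<eta>[OF V pmor_in[OF \<eta>'m V n_in[OF V t]]] by simp
    also have "\<dots> = a' (farr \<Psi> (sigma_arrow i V)) (n (farr \<Psi> (sigma_arrow i V)) t)"
      using \<eta>\<eta>'[OF V n_in[OF V t]] by simp
    also have "\<dots> = t"
      using fun_cong[OF fun_cong[OF a'n, of "farr \<Psi> (sigma_arrow i V)"], of t]
        slice_Obj[OF V] t' by (simp only: pcomp_apply pid_apply)
    finally show ?thesis .
  qed
  have "bij_betw (a V) (U (Sec (Fi i) V)) (U (Sec H V))" if V: "V \<in> Obj (fibre P i)" for V
  proof (rule bij_betw_byWitness[where f' = "?b V"])
    show "a V ` U (Sec (Fi i) V) \<subseteq> U (Sec H V)"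
      using pmor_in[OF a(1) V] by blast
    show "?b V ` U (Sec H V) \<subseteq> U (Sec (Fi i) V)"
      using pmor_in[OF \<eta>'m V n_in[OF V]] by blast
  qed (intro ballI ab[OF V] ba[OF V], assumption)+
  then have "piso U (fibre P i) (Fi i) H a"
    using piso_iff[OF fibre_category Fi_pre sheaf_presheaf[OF H_i]] a(1) by blast
  then show ?thesis
    using a_adj by blast
qed

text \<open>Universal arrows are stable under isomorphism of the target, and the isomorphism from
  \<open>Fi i\<close> to \<open>H\<close> takes the adjunction morphism to
  \<open>\<alpha>i i\<close>.\<close>

lemma H_universal_fibre:
  assumes i: "i \<in> Obj (base P)"
  shows "universal_arrow U (fibre P \<iota>) (fibre P i) (inv_functor P (final_arrow i)) F H (\<alpha>i i)"
proof -
  obtain a where a: "piso U (fibre P i) (Fi i) H a"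
    "\<forall>V\<in>Obj (fibre P \<iota>). \<forall>s\<in>U (Sec F V).
       a (inv_obj P (final_arrow i) V) (adj (L (final_arrow i)) F V s) = \<alpha>i i V s"
    using Fi_iso_H[OF i] by blast
  have inv: "is_functor (fibre P \<iota>) (fibre P i) (inv_functor P (final_arrow i))"
    using inv_is_functor[OF final_arrow(1)[OF i]] final_arrow[OF i] by simp
  have "(\<lambda>V\<in>Obj (fibre P \<iota>). \<lambda>s\<in>U (Sec F V).
      a (fobj (inv_functor P (final_arrow i)) V) (adj (L (final_arrow i)) F V s)) = \<alpha>i i"
    unfolding \<alpha>i_def by (intro restrict_ext) (simp only: fobj_inv_functor a(2) \<alpha>i_apply)
  then show ?thesis
    using universal_arrow_iso[OF fibre_category fibre_category F_presheaf inv Fi_universal[OF i] a(1)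
        fibre_sheaf[OF H_sheaf]] by simp
qed

end

section \<open>Uniqueness of universal arrows and transport of the sheaf condition\<close>

lemma universal_arrow_unique_iso:
  assumes C: "category C" and D: "category D" and F: "presheaf U C F" and u: "is_functor C D u"
    and G: "universal_arrow U C D u F G m" and H: "universal_arrow U C D u F H m'"
  obtains \<phi> where "piso U D G H \<phi>"
    "\<And>c s. c \<in> Obj C \<Longrightarrow> s \<in> U (Sec F c) \<Longrightarrow> \<phi> (fobj u c) (m c s) = m' c s"
proof -
  note Gs = universal_arrow_sheaf[OF G] and Hs = universal_arrow_sheaf[OF H]
  note Gpre = sheaf_presheaf[OF Gs] and Hpre = sheaf_presheaf[OF Hs]
  note m = universal_arrow_pmor[OF G] and m' = universal_arrow_pmor[OF H]
  obtain \<phi> where \<phi>: "\<phi> \<in> pmor U D G H"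
    "\<And>c s. c \<in> Obj C \<Longrightarrow> s \<in> U (Sec F c) \<Longrightarrow> \<phi> (fobj u c) (m c s) = m' c s"
    by (rule universal_arrow_factor[OF G Hs m']) (rule that)
  obtain \<psi> where \<psi>: "\<psi> \<in> pmor U D H G"
    "\<And>c s. c \<in> Obj C \<Longrightarrow> s \<in> U (Sec F c) \<Longrightarrow> \<psi> (fobj u c) (m' c s) = m c s"
    by (rule universal_arrow_factor[OF H Gs m]) (rule that)
  have "pcomp U D G \<psi> \<phi> = pid U D G"
  proof (rule universal_arrow_eqI[OF G Gs pcomp_pmor[OF D Gpre \<phi>(1) \<psi>(1)] pid_pmor[OF D Gpre]])
    fix c s assume "c \<in> Obj C" "s \<in> U (Sec F c)"
    then show "pcomp U D G \<psi> \<phi> (fobj u c) (m c s) = pid U D G (fobj u c) (m c s)"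
      using functor_Obj[OF u] pmor_in[OF m] \<phi>(2) \<psi>(2) by simp
  qed
  moreover have "pcomp U D H \<phi> \<psi> = pid U D H"
  proof (rule universal_arrow_eqI[OF H Hs pcomp_pmor[OF D Hpre \<psi>(1) \<phi>(1)] pid_pmor[OF D Hpre]])
    fix c s assume "c \<in> Obj C" "s \<in> U (Sec F c)"
    then show "pcomp U D H \<phi> \<psi> (fobj u c) (m' c s) = pid U D H (fobj u c) (m' c s)"
      using functor_Obj[OF u] pmor_in[OF m'] \<phi>(2) \<psi>(2) by simp
  qed
  ultimately have "piso U D G H \<phi>"
    using \<phi>(1) \<psi>(1) by (auto simp: piso_def)
  then show thesis
    using \<phi>(2) that by blast
qed

text \<open>Functoriality of \<open>F\<close> is a consequence: by naturality both sides of an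
  equation have the same image under \<phi>, which is injective. For a presheaf glued from
  transition morphisms this replaces a verification of the cocycle condition.\<close>

lemma sheaf_transport:
  fixes C :: "('o, 'a, 'z) site_scheme"
  assumes C: "category C" and sv: "\<And>c S. c \<in> Obj C \<Longrightarrow> S \<in> Cov C c \<Longrightarrow> sieve C c S"
    and H: "sheaf U C H"
    and Res_F: "\<And>f a b s. f \<in> hom C a b \<Longrightarrow> s \<in> U (Sec F b) \<Longrightarrow> Res F f s \<in> U (Sec F a)"
    and bij: "\<And>c. c \<in> Obj C \<Longrightarrow> bij_betw (\<phi> c) (U (Sec F c)) (U (Sec H c))"
    and nat: "\<And>f a b s. f \<in> hom C a b \<Longrightarrow> s \<in> U (Sec F b) \<Longrightarrow> \<phi> a (Res F f s) = Res H f (\<phi> b s)"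
  shows "sheaf U C F"
proof -
  note Hpre = sheaf_presheaf[OF H]
  have \<phi>_in: "\<phi> c s \<in> U (Sec H c)" if "c \<in> Obj C" "s \<in> U (Sec F c)" for c s
    using bij[OF that(1)] that(2) by (auto simp: bij_betw_def)
  have inj: "s = t" if "c \<in> Obj C" "s \<in> U (Sec F c)" "t \<in> U (Sec F c)" "\<phi> c s = \<phi> c t" for c s t
    using bij[OF that(1)] that(2-4) by (auto simp: bij_betw_def inj_on_def)
  have F: "presheaf U C F"
    unfolding presheaf_def
  proof (intro conjI ballI impI)
    fix f assume "f \<in> Arr C"
    then have "f \<in> hom C (Dom C f) (Cod C f)"
      by (simp add: hom_iff)
    from Res_F[OF this] show "Res F f \<in> U (Sec F (Cod C f)) \<rightarrow> U (Sec F (Dom C f))"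
      by blast
  next
    fix c s assume c: "c \<in> Obj C" and s: "s \<in> U (Sec F c)"
    note id = Ide_in_hom[OF C c]
    show "Res F (Ide C c) s = s"
      by (rule inj[OF c Res_F[OF id s] s]) (simp only: nat[OF id s] Res_Ide[OF Hpre c \<phi>_in[OF c s]])
  next
    fix f g s assume *: "f \<in> Arr C" "g \<in> Arr C" "Dom C g = Cod C f" and s: "s \<in> U (Sec F (Cod C g))"
    have f: "f \<in> hom C (Dom C f) (Dom C g)" and g: "g \<in> hom C (Dom C g) (Cod C g)"
      and a: "Dom C f \<in> Obj C" "Cod C g \<in> Obj C"
      using * C by (simp_all add: hom_iff)
    note gf = Cmp_in_hom[OF C f g]
    show "Res F (Cmp C g f) s = Res F f (Res F g s)"
    proof (rule inj[OF a(1) Res_F[OF gf s] Res_F[OF f Res_F[OF g s]]])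
      show "\<phi> (Dom C f) (Res F (Cmp C g f) s) = \<phi> (Dom C f) (Res F f (Res F g s))"
        by (simp only: nat[OF gf s] nat[OF f Res_F[OF g s]] nat[OF g s] Res_Cmp[OF Hpre f g \<phi>_in[OF a(2) s]])
    qed
  qed
  show ?thesis
    unfolding sheaf_def
  proof (intro conjI ballI allI impI F)
    fix c S s assume c: "c \<in> Obj C" and S: "S \<in> Cov C c"
      and s: "(\<forall>f\<in>S. s f \<in> U (Sec F (Dom C f))) \<and>
        (\<forall>f\<in>S. \<forall>g\<in>arrows_to C (Dom C f). Res F g (s f) = s (Cmp C f g))"
    have f: "f \<in> hom C (Dom C f) c" "Dom C f \<in> Obj C" "s f \<in> U (Sec F (Dom C f))" if "f \<in> S" for f
      using sieve_arrows[OF sv[OF c S] that] C s that by (simp_all add: hom_iff)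
    have "\<exists>!t. t \<in> U (Sec H c) \<and> (\<forall>f\<in>S. Res H f t = \<phi> (Dom C f) (s f))"
    proof (rule sheaf_glue_unique[OF H c S])
      show "\<phi> (Dom C f) (s f) \<in> U (Sec H (Dom C f))" if "f \<in> S" for f
        by (rule \<phi>_in[OF f(2,3)[OF that]])
      fix f' g assume f': "f' \<in> S" and g: "g \<in> arrows_to C (Dom C f')"
      have g': "g \<in> hom C (Dom C g) (Dom C f')" "Dom C (Cmp C f' g) = Dom C g"
        using f[OF f'] g C by (simp_all add: arrows_to_iff hom_iff)
      show "Res H g (\<phi> (Dom C f') (s f')) = \<phi> (Dom C (Cmp C f' g)) (s (Cmp C f' g))"
        using nat[OF g'(1) f(3)[OF f']] s f' g by (simp add: g'(2))
    qed
    then obtain t where t: "t \<in> U (Sec H c) \<and> (\<forall>f\<in>S. Res H f t = \<phi> (Dom C f) (s f))"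
      and t_unique: "\<forall>t'. t' \<in> U (Sec H c) \<and> (\<forall>f\<in>S. Res H f t' = \<phi> (Dom C f) (s f)) \<longrightarrow> t' = t"
      by (rule ex1E)
    have "t \<in> \<phi> c ` U (Sec F c)"
      using bij[OF c] t by (simp add: bij_betw_def)
    then obtain r where r: "r \<in> U (Sec F c)" "\<phi> c r = t"
      by blast
    \<comment> \<open>Restriction equations for \<open>F\<close> and for \<open>H\<close>
      correspond, by naturality and injectivity of \<phi>; hence so do amalgamations.\<close>
    have Res_iff: "Res F f' q = s f' \<longleftrightarrow> Res H f' (\<phi> c q) = \<phi> (Dom C f') (s f')"
      if "f' \<in> S" "q \<in> U (Sec F c)" for f' q
      using nat[OF f(1)[OF that(1)] that(2)] inj[OF f(2)[OF that(1)] Res_F[OF f(1)[OF that(1)] that(2)] f(3)[OF that(1)]]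
      by auto
    show "\<exists>!q. q \<in> U (Sec F c) \<and> (\<forall>f\<in>S. Res F f q = s f)"
    proof (rule ex1I[of _ r])
      show "r \<in> U (Sec F c) \<and> (\<forall>f\<in>S. Res F f r = s f)"
        using r t Res_iff by simp
      fix q assume q: "q \<in> U (Sec F c) \<and> (\<forall>f\<in>S. Res F f q = s f)"
      have "Res H f' (\<phi> c q) = \<phi> (Dom C f') (s f')" if "f' \<in> S" for f'
        using Res_iff[OF that, of q] q that by simp
      then have "\<phi> c q \<in> U (Sec H c) \<and> (\<forall>f\<in>S. Res H f (\<phi> c q) = \<phi> (Dom C f) (s f))"
        using \<phi>_in[OF c, of q] q by simp
      then have "\<phi> c q = \<phi> c r"
        using t_unique r(2) by blast
      then show "q = r"
        using inj[OF c] q r(1) by blast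
    qed
  qed
qed

section \<open>Naturality along vertical arrows and along chosen lifts\<close>

context fibration
begin

text \<open>Every arrow of \<open>E\<close> is a vertical arrow followed by a chosen lift, so
  naturality is checked on these two kinds of arrows.\<close>

lemma natural_totalI:
  assumes A: "presheaf U (tot P) A" and K: "presheaf U (tot P) K"
    and t_in: "\<And>V s. V \<in> Obj (tot P) \<Longrightarrow> s \<in> U (Sec A V) \<Longrightarrow> t V s \<in> U (Sec K V)"
    and vertical: "\<And>i k V W s. k \<in> hom (fibre P i) W V \<Longrightarrow> s \<in> U (Sec A V) \<Longrightarrow>
      t W (Res A k s) = Res K k (t V s)"
    and cartesian: "\<And>f V s. f \<in> Arr (base P) \<Longrightarrow> V \<in> Obj (fibre P (Cod (base P) f)) \<Longrightarrow> s \<in> U (Sec A V) \<Longrightarrow>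
      t (inv_obj P f V) (Res A (lift P f V) s) = Res K (lift P f V) (t V s)"
    and m: "m \<in> hom (tot P) W V" and s: "s \<in> U (Sec A V)"
  shows "t W (Res A m s) = Res K m (t V s)"
proof -
  define f where "f = farr (proj P) m"
  have V: "V \<in> Obj (tot P)"
    using m E_cat by (auto simp: hom_iff)
  have f: "f \<in> Arr (base P)" "fobj (proj P) V = Cod (base P) f"
    using proj_hom[OF m] by (simp_all add: f_def hom_iff)
  note l = lift_hom[OF f(1) V f(2)]
  note v = vert_hom[OF f(1) V f(2) m f_def[symmetric]]
  have v': "vert P f V m \<in> hom (tot P) W (inv_obj P f V)"
    using v(1) unfolding fibre_hom_iff by simp
  have "t W (Res A m s) = t W (Res A (vert P f V m) (Res A (lift P f V) s))"
    using Res_Cmp[OF A v' l s] v(2) by simp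
  also have "\<dots> = Res K (vert P f V m) (Res K (lift P f V) (t V s))"
    using vertical[OF v(1) Res_in[OF A l s]] cartesian[OF f(1) _ s] V f(2) by simp
  also have "\<dots> = Res K m (t V s)"
    using Res_Cmp[OF K v' l t_in[OF V s]] v(2) by simp
  finally show ?thesis .
qed

end

context fibred_sites
begin

lemma pmor_fibre:
  assumes "presheaf U (tot P) A" "n \<in> pmor U (coevanescent_site P) A K"
  shows "(\<lambda>V\<in>Obj (fibre P i). \<lambda>s\<in>U (Sec A V). n V s) \<in> pmor U (fibre P i) A K"
proof (rule pmorI[OF _ _ fibre_category fibre_presheaf[OF assms(1)]])
  show "n V s \<in> U (Sec K V)" if "V \<in> Obj (fibre P i)" "s \<in> U (Sec A V)" for V s
    using pmor_in[OF assms(2)] that by simp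
  show "n W (Res A k s) = Res K k (n V s)" if "k \<in> hom (fibre P i) W V" "s \<in> U (Sec A V)" for k V W s
    using pmor_Res[OF assms(2)] that unfolding fibre_hom_iff by simp
qed

text \<open>For a presheaf \<open>K\<close> on \<open>E\<close>, restriction along the chosen lifts
  is the transition morphism from \<open>K\<close> on one fibre to the direct image of
  \<open>K\<close> on the other.\<close>

lemma lift_pmor:
  assumes f: "f \<in> Arr (base P)" and K: "presheaf U (tot P) K"
  shows "(\<lambda>V\<in>Obj (fibre P (Cod (base P) f)). \<lambda>s\<in>U (Sec K V). Res K (lift P f V) s)
    \<in> pmor U (fibre P (Cod (base P) f)) K (direct (inv_functor P f) K)"
proof (rule pmorI[OF _ _ fibre_category fibre_presheaf[OF K]])
  have l: "lift P f V \<in> hom (tot P) (inv_obj P f V) V" if "V \<in> Obj (fibre P (Cod (base P) f))" for V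
    using lift_hom[OF f] that by simp
  show "Res K (lift P f V) s \<in> U (Sec (direct (inv_functor P f) K) V)"
    if "V \<in> Obj (fibre P (Cod (base P) f))" "s \<in> U (Sec K V)" for V s
    using Res_in[OF K l that(2)] that(1) by simp
  fix k W V s assume k: "k \<in> hom (fibre P (Cod (base P) f)) W V" and W: "W \<in> Obj (fibre P (Cod (base P) f))"
    and V: "V \<in> Obj (fibre P (Cod (base P) f))" and s: "s \<in> U (Sec K V)"
  note fk = inv_functor_hom[OF f k]
  have k': "k \<in> hom (tot P) W V" "farr (inv_functor P f) k \<in> hom (tot P) (inv_obj P f W) (inv_obj P f V)"
    using k fk(1) unfolding fibre_hom_iff by simp_all
  show "Res K (lift P f W) (Res K k s) = Res (direct (inv_functor P f) K) k (Res K (lift P f V) s)"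
    using Res_Cmp[OF K l[OF W] k'(1) s] Res_Cmp[OF K k'(2) l[OF V] s] fk(2) by simp
qed

lemma direct_inv_sheaf:
  "f \<in> Arr (base P) \<Longrightarrow> sheaf U (fibre P (Dom (base P) f)) K \<Longrightarrow>
     sheaf U (fibre P (Cod (base P) f)) (direct (inv_functor P f) K)"
  using inv_continuous unfolding continuous_functor_def by blast

end

context comparison
begin

text \<open>The canonical isomorphism between the inverse images of \<open>V\<close> over the source
  of \<open>f\<close>, taken in two steps and along the composite. The body is the \<rho> occurring
  in \<open>inv_comp_iso\<close>, with the composite of a \<open>final_arrow\<close> and
  \<open>f\<close> written as a \<open>final_arrow\<close>.\<close>

definition rho :: "'f \<Rightarrow> 'o \<Rightarrow> 'a" where
  "rho f V = vert P (final_arrow (Dom (base P) f)) V (Cmp (tot P) (lift P (final_arrow (Cod (base P) f)) V)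
     (lift P f (inv_obj P (final_arrow (Cod (base P) f)) V)))"

lemma rho:
  assumes f: "f \<in> hom (base P) j i" and V: "V \<in> Obj (fibre P \<iota>)"
  shows "rho f V \<in> hom (fibre P j) (inv_obj P f (inv_obj P (final_arrow i) V)) (inv_obj P (final_arrow j) V)"
    and "Cmp (tot P) (lift P (final_arrow j) V) (rho f V) =
      Cmp (tot P) (lift P (final_arrow i) V) (lift P f (inv_obj P (final_arrow i) V))"
    and "lift P f (inv_obj P (final_arrow i) V) \<in>
      hom (tot P) (inv_obj P f (inv_obj P (final_arrow i) V)) (inv_obj P (final_arrow i) V)"
proof -
  have f': "f \<in> Arr (base P)" "Dom (base P) f = j" "Cod (base P) f = i"
    using f by (simp_all add: hom_iff)
  have ij: "i \<in> Obj (base P)" "j \<in> Obj (base P)"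
    using f' B_cat by auto
  note fj = final_arrow[OF ij(2)] and iV = inv_obj_final_arrow[OF ij(1) V]
  have iV': "inv_obj P (final_arrow i) V \<in> Obj (tot P)"
    "fobj (proj P) (inv_obj P (final_arrow i) V) = Cod (base P) f"
    using iV(1) f'(3) by simp_all
  show l: "lift P f (inv_obj P (final_arrow i) V) \<in>
      hom (tot P) (inv_obj P f (inv_obj P (final_arrow i) V)) (inv_obj P (final_arrow i) V)"
    by (rule lift_hom[OF f'(1) iV'])
  have V': "V \<in> Obj (tot P)" "fobj (proj P) V = Cod (base P) (final_arrow j)"
    using V fj by simp_all
  have over: "farr (proj P) (Cmp (tot P) (lift P (final_arrow i) V) (lift P f (inv_obj P (final_arrow i) V))) =
      final_arrow j"
    using proj_Cmp[OF l iV(2)] iV(3) lift_cartesian(3)[OF f'(1) iV'] final_arrow_Cmp[OF f] by simp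
  note v = vert_hom[OF fj(1) V' Cmp_in_hom[OF E_cat l iV(2)] over]
  show "rho f V \<in> hom (fibre P j) (inv_obj P f (inv_obj P (final_arrow i) V)) (inv_obj P (final_arrow j) V)"
    "Cmp (tot P) (lift P (final_arrow j) V) (rho f V) =
      Cmp (tot P) (lift P (final_arrow i) V) (lift P f (inv_obj P (final_arrow i) V))"
    using v f' fj by (simp_all add: rho_def)
qed

text \<open>Both sides restrict \<open>t\<close> along the same arrow to \<open>V\<close>. This
  exchanges a restriction along the lift of \<open>f\<close> for one along a vertical arrow, which
  morphisms on a single fibre respect.\<close>

lemma Res_rho:
  assumes f: "f \<in> hom (base P) j i" and V: "V \<in> Obj (fibre P \<iota>)"
    and K: "presheaf U (tot P) K" and t: "t \<in> U (Sec K V)"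
  shows "Res K (rho f V) (Res K (lift P (final_arrow j) V) t) =
    Res K (lift P f (inv_obj P (final_arrow i) V)) (Res K (lift P (final_arrow i) V) t)"
proof -
  have ij: "i \<in> Obj (base P)" "j \<in> Obj (base P)"
    using f B_cat by (auto simp: hom_iff)
  note r = rho[OF f V]
  have r1: "rho f V \<in> hom (tot P) (inv_obj P f (inv_obj P (final_arrow i) V)) (inv_obj P (final_arrow j) V)"
    using r(1) unfolding fibre_hom_iff by simp
  show ?thesis
    using Res_Cmp[OF K r1 inv_obj_final_arrow(2)[OF ij(2) V] t]
      Res_Cmp[OF K r(3) inv_obj_final_arrow(2)[OF ij(1) V] t] r(2) by simp
qed

text \<open>After composition with the lift of \<open>final_arrow j\<close> at \<open>W\<close>,
  both sides become \<open>k\<close> after the two-step lift at \<open>V\<close>; the lift is then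
  cancelled among vertical arrows.\<close>

lemma rho_natural:
  assumes f: "f \<in> hom (base P) j i" and k: "k \<in> hom (fibre P \<iota>) V W"
  shows "Cmp (tot P) (rho f W) (farr (inv_functor P f) (farr (inv_functor P (final_arrow i)) k)) =
    Cmp (tot P) (farr (inv_functor P (final_arrow j)) k) (rho f V)"
proof -
  have f': "f \<in> Arr (base P)" "Dom (base P) f = j" "Cod (base P) f = i"
    using f by (simp_all add: hom_iff)
  have ij: "i \<in> Obj (base P)" "j \<in> Obj (base P)"
    using f' B_cat by auto
  note VW = fibre_Cod(2,3)[OF k]
  note rV = rho[OF f VW(1)] and rW = rho[OF f VW(2)]
  note fi = final_arrow[OF ij(1)] and fj = final_arrow[OF ij(2)]
  note iV = inv_obj_final_arrow[OF ij(1) VW(1)] and iW = inv_obj_final_arrow[OF ij(1) VW(2)]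
  note jV = inv_obj_final_arrow[OF ij(2) VW(1)] and jW = inv_obj_final_arrow[OF ij(2) VW(2)]
  let ?ki = "farr (inv_functor P (final_arrow i)) k" and ?kj = "farr (inv_functor P (final_arrow j)) k"
  let ?kf = "farr (inv_functor P f) ?ki"
  note ki = inv_functor_hom[OF fi(1), of k V W, unfolded fi(2,3), OF k]
  note kj = inv_functor_hom[OF fj(1), of k V W, unfolded fj(2,3), OF k]
  note kf = inv_functor_hom[OF f'(1), of ?ki, unfolded f'(2,3), OF ki(1)]
  note ri = rV(1) rW(1)
  have hom: "k \<in> hom (tot P) V W" "?ki \<in> hom (tot P) (inv_obj P (final_arrow i) V) (inv_obj P (final_arrow i) W)"
    "?kj \<in> hom (tot P) (inv_obj P (final_arrow j) V) (inv_obj P (final_arrow j) W)"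
    "?kf \<in> hom (tot P) (inv_obj P f (inv_obj P (final_arrow i) V)) (inv_obj P f (inv_obj P (final_arrow i) W))"
    "rho f V \<in> hom (tot P) (inv_obj P f (inv_obj P (final_arrow i) V)) (inv_obj P (final_arrow j) V)"
    "rho f W \<in> hom (tot P) (inv_obj P f (inv_obj P (final_arrow i) W)) (inv_obj P (final_arrow j) W)"
    using k ki(1) kj(1) kf(1) ri unfolding fibre_hom_iff by simp_all
  have W': "W \<in> Obj (tot P)" "fobj (proj P) W = Cod (base P) (final_arrow j)"
    using VW fj by simp_all
  have "Cmp (tot P) (lift P (final_arrow j) W) (Cmp (tot P) (rho f W) ?kf) =
      Cmp (tot P) (Cmp (tot P) (lift P (final_arrow i) W) (lift P f (inv_obj P (final_arrow i) W))) ?kf"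
    unfolding rW(2)[symmetric] using hom jW(2) E_cat by (subst Cmp_assoc) (simp_all add: hom_iff)
  also have "\<dots> = Cmp (tot P) (lift P (final_arrow i) W) (Cmp (tot P) ?ki (lift P f (inv_obj P (final_arrow i) V)))"
    unfolding kf(2)[symmetric] using hom rW(3) iW(2) E_cat by (subst Cmp_assoc) (simp_all add: hom_iff)
  also have "\<dots> = Cmp (tot P) (Cmp (tot P) k (lift P (final_arrow i) V)) (lift P f (inv_obj P (final_arrow i) V))"
    unfolding ki(2)[symmetric] using hom rV(3) iW(2) E_cat by (subst Cmp_assoc) (simp_all add: hom_iff)
  also have "\<dots> = Cmp (tot P) k (Cmp (tot P) (lift P (final_arrow j) V) (rho f V))"
    unfolding rV(2) using hom rV(3) iV(2) E_cat by (subst Cmp_assoc) (simp_all add: hom_iff)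
  also have "\<dots> = Cmp (tot P) (Cmp (tot P) (lift P (final_arrow j) W) ?kj) (rho f V)"
    unfolding kj(2) using hom jV(2) E_cat by (subst Cmp_assoc) (simp_all add: hom_iff)
  also have "\<dots> = Cmp (tot P) (lift P (final_arrow j) W) (Cmp (tot P) ?kj (rho f V))"
    using hom jW(2) E_cat by (subst Cmp_assoc) (simp_all add: hom_iff)
  finally have eq: "Cmp (tot P) (lift P (final_arrow j) W) (Cmp (tot P) (rho f W) ?kf) =
    Cmp (tot P) (lift P (final_arrow j) W) (Cmp (tot P) ?kj (rho f V))" .
  have c: "Cmp (tot P) (rho f W) ?kf \<in> hom (fibre P j) (inv_obj P f (inv_obj P (final_arrow i) V)) (inv_obj P (final_arrow j) W)"
    "Cmp (tot P) ?kj (rho f V) \<in> hom (fibre P j) (inv_obj P f (inv_obj P (final_arrow i) V)) (inv_obj P (final_arrow j) W)"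
    using Cmp_in_hom[OF fibre_category kf(1) rW(1)] Cmp_in_hom[OF fibre_category rV(1) kj(1)] by simp_all
  show ?thesis
    using vert_eqI[OF fj(1) W', unfolded fj(2), OF c(1), unfolded eq]
      vert_eqI[OF fj(1) W', unfolded fj(2), OF c(2)] by (rule trans[OF sym])
qed

lemma coevanescent_sieve: "S \<in> coevanescent_topology P V \<Longrightarrow> sieve (coevanescent_site P) V S"
  by (simp add: coevanescent_topology_def generated_topology_def sieve_def)

end

context comparison_sheaf
begin

lemma \<alpha>i_\<iota>:
  assumes V: "V \<in> Obj (fibre P \<iota>)" and s: "s \<in> U (Sec F V)"
  shows "inv_obj P (final_arrow \<iota>) V = V" "\<alpha>i \<iota> V s = \<alpha> V s" "lift P (final_arrow \<iota>) V = Ide (tot P) V"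
proof -
  have V': "V \<in> Obj (tot P)" "fobj (proj P) V = \<iota>"
    using V by simp_all
  show l: "lift P (final_arrow \<iota>) V = Ide (tot P) V"
    using lift_Ide[OF V'(1)] V'(2) by (simp add: final_arrow_\<iota>)
  then show "inv_obj P (final_arrow \<iota>) V = V"
    using V' E_cat by (simp add: inv_obj_def)
  show "\<alpha>i \<iota> V s = \<alpha> V s"
    using Res_Ide[OF H_presheaf V'(1) pmor_in[OF \<alpha>_pmor V s]] by (simp only: \<alpha>i_apply[OF V s] l)
qed

lemma H_universal: "universal_arrow U (fibre P \<iota>) (coevanescent_site P) fibre_inclusion F H \<alpha>"
  unfolding universal_arrow_def direct_fibre_inclusion
proof (intro conjI allI impI ballI H_sheaf \<alpha>_pmor)
  fix K m assume K: "sheaf U (coevanescent_site P) K" and m: "m \<in> pmor U (fibre P \<iota>) F K"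
  have Kpre: "presheaf U (tot P) K"
    using sheaf_presheaf[OF K] by simp
  \<comment> \<open>The component over \<open>i\<close> is forced on sections coming from
    \<open>F\<close>: it must be \<open>m\<close> followed by the transition morphism of
    \<open>K\<close>.\<close>
  let ?m = "\<lambda>i. \<lambda>V\<in>Obj (fibre P \<iota>). \<lambda>s\<in>U (Sec F V). Res K (lift P (final_arrow i) V) (m V s)"
  have "\<exists>n. n \<in> pmor U (fibre P i) H K \<and> (\<forall>V\<in>Obj (fibre P \<iota>). \<forall>s\<in>U (Sec F V).
      n (inv_obj P (final_arrow i) V) (\<alpha>i i V s) = Res K (lift P (final_arrow i) V) (m V s))"
    if i: "i \<in> Obj (base P)" for i
  proof -
    note fi = final_arrow[OF i]
    have "?m i \<in> pmor U (fibre P \<iota>) F (direct (inv_functor P (final_arrow i)) K)"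
    proof -
      let ?l = "\<lambda>V\<in>Obj (fibre P \<iota>). \<lambda>s\<in>U (Sec K V). Res K (lift P (final_arrow i) V) s"
      have "?l \<in> pmor U (fibre P \<iota>) K (direct (inv_functor P (final_arrow i)) K)"
        using lift_pmor[OF fi(1) Kpre, unfolded fi(3)] .
      from pcomp_pmor[OF fibre_category F_presheaf m this]
      have "pcomp U (fibre P \<iota>) F ?l m \<in> pmor U (fibre P \<iota>) F (direct (inv_functor P (final_arrow i)) K)" .
      moreover have "pcomp U (fibre P \<iota>) F ?l m = ?m i"
        unfolding pcomp_def by (intro restrict_ext) (simp only: restrict_apply' pmor_in[OF m])
      ultimately show ?thesis
        by (simp only:)
    qed
    with H_universal_fibre[OF i] fibre_sheaf[OF K] obtain n where n: "n \<in> pmor U (fibre P i) H K"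
      "\<And>V s. V \<in> Obj (fibre P \<iota>) \<Longrightarrow> s \<in> U (Sec F V) \<Longrightarrow>
        n (fobj (inv_functor P (final_arrow i)) V) (\<alpha>i i V s) = ?m i V s"
      by (rule universal_arrow_factor) (rule that)
    show ?thesis
    proof (intro exI[of _ n] conjI ballI n(1))
      fix V s assume "V \<in> Obj (fibre P \<iota>)" "s \<in> U (Sec F V)"
      from n(2)[OF this] this
      show "n (inv_obj P (final_arrow i) V) (\<alpha>i i V s) = Res K (lift P (final_arrow i) V) (m V s)"
        by (simp only: restrict_apply' fobj_inv_functor)
    qed
  qed
  then obtain N where N: "\<And>i. i \<in> Obj (base P) \<Longrightarrow> N i \<in> pmor U (fibre P i) H K"
    and N\<alpha>: "\<And>i V s. i \<in> Obj (base P) \<Longrightarrow> V \<in> Obj (fibre P \<iota>) \<Longrightarrow> s \<in> U (Sec F V) \<Longrightarrow>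
      N i (inv_obj P (final_arrow i) V) (\<alpha>i i V s) = Res K (lift P (final_arrow i) V) (m V s)"
    by metis
  \<comment> \<open>The components on the fibres are assembled into one family on \<open>E\<close>;
    naturality along vertical arrows is built in, naturality along chosen lifts is not.\<close>
  let ?n = "\<lambda>V t. N (fobj (proj P) V) V t"
  have n_in: "?n V t \<in> U (Sec K V)" if "V \<in> Obj (tot P)" "t \<in> U (Sec H V)" for V t
    using pmor_in[OF N[OF functor_Obj[OF proj_functor that(1)]], of V t] that by simp
  have vertical: "?n W (Res H k t) = Res K k (?n V t)"
    if k: "k \<in> hom (fibre P i) W V" and t: "t \<in> U (Sec H V)" for i k V W t
  proof -
    have i: "fobj (proj P) W = i" "fobj (proj P) V = i" "i \<in> Obj (base P)"
      using fibre_Cod[OF k] functor_Obj[OF proj_functor, of V] by auto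
    show ?thesis
      unfolding i by (rule pmor_Res[OF N[OF i(3)] k t])
  qed
  have cartesian: "?n (inv_obj P f V) (Res H (lift P f V) t) = Res K (lift P f V) (?n V t)"
    if f: "f \<in> Arr (base P)" and V: "V \<in> Obj (fibre P (Cod (base P) f))" and t: "t \<in> U (Sec H V)" for f V t
  proof -
    define i j where "i = Cod (base P) f" and "j = Dom (base P) f"
    have ij: "i \<in> Obj (base P)" "j \<in> Obj (base P)" and f_hom: "f \<in> hom (base P) j i"
      using f B_cat by (simp_all add: i_def j_def hom_iff)
    have u: "is_functor (fibre P i) (fibre P j) (inv_functor P f)"
      using inv_is_functor[OF f] by (simp add: i_def j_def)
    have V': "V \<in> Obj (fibre P i)" "fobj (proj P) V = i" "fobj (proj P) (inv_obj P f V) = j"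
      using V proj_inv_obj[OF f] by (simp_all add: i_def j_def)
    have lH: "(\<lambda>V\<in>Obj (fibre P i). \<lambda>s\<in>U (Sec H V). Res H (lift P f V) s)
        \<in> pmor U (fibre P i) H (direct (inv_functor P f) H)" (is "?lH \<in> _")
      unfolding i_def by (rule lift_pmor[OF f H_presheaf])
    have lK: "(\<lambda>V\<in>Obj (fibre P i). \<lambda>s\<in>U (Sec K V). Res K (lift P f V) s)
        \<in> pmor U (fibre P i) K (direct (inv_functor P f) K)" (is "?lK \<in> _")
      unfolding i_def by (rule lift_pmor[OF f Kpre])
    have Ks: "sheaf U (fibre P i) (direct (inv_functor P f) K)"
      unfolding i_def by (rule direct_inv_sheaf[OF f fibre_sheaf[OF K]])
    let ?p = "\<lambda>V\<in>Obj (fibre P i). \<lambda>s\<in>U (Sec H V). N j (fobj (inv_functor P f) V) (?lH V s)"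
      and ?q = "pcomp U (fibre P i) H ?lK (N i)"
    note H_i = fibre_presheaf[OF H_presheaf]
    \<comment> \<open>Two morphisms on the fibre over \<open>i\<close> into the direct image of
      \<open>K\<close> under \<open>inv_functor P f\<close>; universality of \<open>H\<close> on
      that fibre allows them to be compared on sections coming from \<open>F\<close>.\<close>
    have "?p = ?q"
    proof (rule universal_arrow_eqI[OF H_universal_fibre[OF ij(1)] Ks])
      show "?p \<in> pmor U (fibre P i) H (direct (inv_functor P f) K)"
        by (rule pmor_whisker[OF fibre_category u H_i lH N[OF ij(2)]])
      show "?q \<in> pmor U (fibre P i) H (direct (inv_functor P f) K)"
        by (rule pcomp_pmor[OF fibre_category H_i N[OF ij(1)] lK])
      fix V s assume V: "V \<in> Obj (fibre P \<iota>)" and s: "s \<in> U (Sec F V)"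
      let ?V = "inv_obj P (final_arrow i) V"
      have iV: "?V \<in> Obj (fibre P i)"
        by (rule inv_obj_final_arrow(1)[OF ij(1) V])
      have \<alpha>s: "\<alpha>i i V s \<in> U (Sec H ?V)" "\<alpha>i j V s \<in> U (Sec H (inv_obj P (final_arrow j) V))"
        using pmor_in[OF \<alpha>i_pmor[OF ij(1)] V s] pmor_in[OF \<alpha>i_pmor[OF ij(2)] V s] by simp_all
      have "?p ?V (\<alpha>i i V s) = N j (inv_obj P f ?V) (Res H (lift P f ?V) (\<alpha>i i V s))"
        using iV \<alpha>s(1) by (simp only: restrict_apply' fobj_inv_functor)
      \<comment> \<open>The lift of \<open>f\<close> is replaced by the vertical arrow
        \<open>rho f V\<close>, along which \<open>N j\<close> is natural; the same exchange for
        \<open>K\<close> undoes the replacement.\<close>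
      also have "\<dots> = N j (inv_obj P f ?V) (Res H (rho f V) (\<alpha>i j V s))"
        using Res_rho[OF f_hom V H_presheaf pmor_in[OF \<alpha>_pmor V s]] by (simp only: \<alpha>i_apply[OF V s])
      also have "\<dots> = Res K (rho f V) (Res K (lift P (final_arrow j) V) (m V s))"
        using pmor_Res[OF N[OF ij(2)] rho(1)[OF f_hom V] \<alpha>s(2)] N\<alpha>[OF ij(2) V s] by (simp only:)
      also have "\<dots> = Res K (lift P f ?V) (N i ?V (\<alpha>i i V s))"
        using Res_rho[OF f_hom V Kpre pmor_in[OF m V s]] N\<alpha>[OF ij(1) V s] by (simp only:)
      also have "\<dots> = ?q ?V (\<alpha>i i V s)"
        using iV \<alpha>s(1) pmor_in[OF N[OF ij(1)] iV \<alpha>s(1)] by (simp only: pcomp_apply restrict_apply')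
      finally show "?p (fobj (inv_functor P (final_arrow i)) V) (\<alpha>i i V s) =
          ?q (fobj (inv_functor P (final_arrow i)) V) (\<alpha>i i V s)"
        by (simp only: fobj_inv_functor)
    qed
    from fun_cong[OF fun_cong[OF this, of V], of t] show ?thesis
      using V' t pmor_in[OF N[OF ij(1)] V'(1) t] by (simp only: pcomp_apply restrict_apply' fobj_inv_functor V'(2,3))
  qed
  have n: "(\<lambda>V\<in>Obj (coevanescent_site P). \<lambda>t\<in>U (Sec H V). ?n V t) \<in> pmor U (coevanescent_site P) H K"
  proof (rule pmorI)
    show "?n V t \<in> U (Sec K V)" if "V \<in> Obj (coevanescent_site P)" "t \<in> U (Sec H V)" for V t
      using n_in that by simp
    show "?n W (Res H f t) = Res K f (?n V t)" if "f \<in> hom (coevanescent_site P) W V" "t \<in> U (Sec H V)" for f V W t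
      by (rule natural_totalI[OF H_presheaf Kpre n_in vertical cartesian]) (use that in simp_all)
  qed (use E_cat H_presheaf in simp_all)
  show "\<exists>n\<in>pmor U (coevanescent_site P) H K. \<forall>V\<in>Obj (fibre P \<iota>). \<forall>s\<in>U (Sec F V).
      n (fobj fibre_inclusion V) (\<alpha> V s) = m V s"
  proof (rule bexI[OF _ n], intro ballI)
    fix V s assume V: "V \<in> Obj (fibre P \<iota>)" and s: "s \<in> U (Sec F V)"
    have V': "V \<in> Obj (tot P)" "fobj (proj P) V = \<iota>"
      using V by simp_all
    \<comment> \<open>Over \<iota> the lift is an identity, so the prescribed value is
      \<open>m\<close> itself.\<close>
    show "(\<lambda>V\<in>Obj (coevanescent_site P). \<lambda>t\<in>U (Sec H V). ?n V t) (fobj fibre_inclusion V) (\<alpha> V s) = m V s"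
      using N\<alpha>[OF \<iota>_Obj V s] \<alpha>i_\<iota>[OF V s] Res_Ide[OF Kpre V'(1) pmor_in[OF m V s]] V'
        pmor_in[OF \<alpha>_pmor V s] by (simp only: restrict_apply' coevanescent_site_simps fobj_fibre_inclusion)
  qed
next
  fix K n n' assume K: "sheaf U (coevanescent_site P) K"
    and n: "n \<in> pmor U (coevanescent_site P) H K" and n': "n' \<in> pmor U (coevanescent_site P) H K"
    and eq: "\<forall>V\<in>Obj (fibre P \<iota>). \<forall>s\<in>U (Sec F V).
      n (fobj fibre_inclusion V) (\<alpha> V s) = n' (fobj fibre_inclusion V) (\<alpha> V s)"
  show "n = n'"
  proof (rule pmor_eqI[OF n n'])
    fix V t assume V: "V \<in> Obj (coevanescent_site P)" and t: "t \<in> U (Sec H V)"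
    define i where "i = fobj (proj P) V"
    have i: "i \<in> Obj (base P)" and V': "V \<in> Obj (fibre P i)"
      using V functor_Obj[OF proj_functor] by (simp_all add: i_def)
    \<comment> \<open>Uniqueness is checked fibre by fibre: agreement on the values of \<alpha> over
      \<iota> propagates along the lifts to agreement on those of
      \<open>\<alpha>i i\<close>.\<close>
    have "(\<lambda>V\<in>Obj (fibre P i). \<lambda>t\<in>U (Sec H V). n V t) = (\<lambda>V\<in>Obj (fibre P i). \<lambda>t\<in>U (Sec H V). n' V t)"
    proof (rule universal_arrow_eqI[OF H_universal_fibre[OF i] fibre_sheaf[OF K]
          pmor_fibre[OF H_presheaf n] pmor_fibre[OF H_presheaf n']])
      fix W s assume W: "W \<in> Obj (fibre P \<iota>)" and s: "s \<in> U (Sec F W)"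
      note iW = inv_obj_final_arrow[OF i W]
      have l: "lift P (final_arrow i) W \<in> hom (coevanescent_site P) (inv_obj P (final_arrow i) W) W"
        using iW(2) by simp
      note \<alpha>s = pmor_in[OF \<alpha>_pmor W s]
      have "\<alpha>i i W s \<in> U (Sec H (inv_obj P (final_arrow i) W))"
        using pmor_in[OF \<alpha>i_pmor[OF i] W s] by simp
      moreover have "n (inv_obj P (final_arrow i) W) (\<alpha>i i W s) = n' (inv_obj P (final_arrow i) W) (\<alpha>i i W s)"
        using pmor_Res[OF n l \<alpha>s] pmor_Res[OF n' l \<alpha>s] eq W s by (simp add: \<alpha>i_apply[OF W s] del: Res_direct)
      ultimately show "(\<lambda>V\<in>Obj (fibre P i). \<lambda>t\<in>U (Sec H V). n V t) (fobj (inv_functor P (final_arrow i)) W) (\<alpha>i i W s) =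
          (\<lambda>V\<in>Obj (fibre P i). \<lambda>t\<in>U (Sec H V). n' V t) (fobj (inv_functor P (final_arrow i)) W) (\<alpha>i i W s)"
        using iW(1) by (simp only: restrict_apply' fobj_inv_functor)
    qed
    from fun_cong[OF fun_cong[OF this, of V], of t] show "n V t = n' V t"
      using V' t by (simp only: restrict_apply')
  qed
qed

text \<open>Along an identity functor a universal arrow from a sheaf is an isomorphism: the identity
  of \<open>F\<close> factors through it, and the factorization is inverse to it by uniqueness. By
  normalization, \<open>final_arrow \<iota>\<close> gives the identity functor.\<close>

lemma \<alpha>_iso: "piso U (fibre P \<iota>) F H \<alpha>"
proof -
  note HU = H_universal_fibre[OF \<iota>_Obj]
  note H_\<iota> = fibre_sheaf[OF H_sheaf, of \<iota>]
  have "(\<lambda>V\<in>Obj (fibre P \<iota>). \<lambda>s\<in>U (Sec F V). s) \<in> pmor U (fibre P \<iota>) F (direct (inv_functor P (final_arrow \<iota>)) F)"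
  proof (rule pmorI[OF _ _ fibre_category F_presheaf])
    show "s \<in> U (Sec (direct (inv_functor P (final_arrow \<iota>)) F) V)" if "V \<in> Obj (fibre P \<iota>)" "s \<in> U (Sec F V)" for V s
      using \<alpha>i_\<iota>(1)[OF that] that(2) by simp
    show "Res F k s = Res (direct (inv_functor P (final_arrow \<iota>)) F) k s"
      if "k \<in> hom (fibre P \<iota>) W V" for k V W s
      using inv_functor_Ide(1)[OF that] by (simp add: final_arrow_\<iota>)
  qed
  with HU F obtain n where n: "n \<in> pmor U (fibre P \<iota>) H F"
    and n_\<alpha>i: "\<And>V s. V \<in> Obj (fibre P \<iota>) \<Longrightarrow> s \<in> U (Sec F V) \<Longrightarrow>
      n (fobj (inv_functor P (final_arrow \<iota>)) V) (\<alpha>i \<iota> V s) = (\<lambda>V\<in>Obj (fibre P \<iota>). \<lambda>s\<in>U (Sec F V). s) V s"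
    by (rule universal_arrow_factor) (rule that)
  have n_\<alpha>: "n V (\<alpha> V s) = s" if "V \<in> Obj (fibre P \<iota>)" "s \<in> U (Sec F V)" for V s
    using n_\<alpha>i[OF that] that by (simp only: restrict_apply' fobj_inv_functor \<alpha>i_\<iota>[OF that])
  have "pcomp U (fibre P \<iota>) F n \<alpha> = pid U (fibre P \<iota>) F"
    by (rule pcomp_eqI[OF pid_pmor[OF fibre_category F_presheaf]]) (simp only: n_\<alpha> pid_apply)
  moreover have "pcomp U (fibre P \<iota>) H \<alpha> n = pid U (fibre P \<iota>) H"
  proof (rule universal_arrow_eqI[OF HU H_\<iota> pcomp_pmor[OF fibre_category sheaf_presheaf[OF H_\<iota>] n \<alpha>_pmor]
        pid_pmor[OF fibre_category sheaf_presheaf[OF H_\<iota>]]])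
    fix V s assume V: "V \<in> Obj (fibre P \<iota>)" and s: "s \<in> U (Sec F V)"
    show "pcomp U (fibre P \<iota>) H \<alpha> n (fobj (inv_functor P (final_arrow \<iota>)) V) (\<alpha>i \<iota> V s) =
        pid U (fibre P \<iota>) H (fobj (inv_functor P (final_arrow \<iota>)) V) (\<alpha>i \<iota> V s)"
      unfolding fobj_inv_functor \<alpha>i_\<iota>[OF V s] using V pmor_in[OF \<alpha>_pmor V s] n_\<alpha>[OF V s]
      by (simp only: pcomp_apply pid_apply)
  qed
  ultimately show ?thesis
    using \<alpha>_pmor n unfolding piso_def by blast
qed

end

section \<open>The presheaf glued from the inverse images, and the three assertions\<close>

context comparison_sheaf
begin

text \<open>The transition morphism is the adjunct of a canonical isomorphism, whose defining
  equation yields its values on sections coming from \<open>F\<close>.\<close>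

lemma transition:
  assumes f: "f \<in> hom (base P) j i"
  shows "pullback_transition U P L \<iota> F f \<in> pmor U (fibre P i) (Fi i) (direct (inv_functor P f) (Fi j))"
    and "\<And>V s. V \<in> Obj (fibre P \<iota>) \<Longrightarrow> s \<in> U (Sec F V) \<Longrightarrow>
      pullback_transition U P L \<iota> F f (inv_obj P (final_arrow i) V) (adj (L (final_arrow i)) F V s) =
      Res (Fi j) (rho f V) (adj (L (final_arrow j)) F V s)"
proof -
  have f': "f \<in> Arr (base P)" "Dom (base P) f = j" "Cod (base P) f = i"
    using f by (simp_all add: hom_iff)
  have ij: "i \<in> Obj (base P)" "j \<in> Obj (base P)"
    using f' B_cat by auto
  note fi = final_arrow[OF ij(1)] and fj = final_arrow[OF ij(2)]
  note ui = inv_is_functor[OF fi(1), unfolded fi(2,3)] and uj = inv_is_functor[OF fj(1), unfolded fj(2,3)]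
    and uf = inv_is_functor[OF f'(1), unfolded f'(2,3)]
  note adj_pmor = universal_arrow_pmor[OF Fi_universal[OF ij(1)]]
  note Fi_i = universal_arrow_sheaf[OF Fi_universal[OF ij(1)]]
  note LfU = inverse_image_universal_arrow[OF fibre_category uf L[OF f'(1), unfolded f'(2,3)] Fi_i]
  note Lf_pmor = universal_arrow_pmor[OF LfU]
  let ?n = "inv_comp_iso U P L (final_arrow i) f F"
  \<comment> \<open>Since the composite of \<open>final_arrow i\<close> and \<open>f\<close> is
    \<open>final_arrow j\<close>, this isomorphism ends in \<open>Fi j\<close>, with comparison
    arrow \<open>rho f\<close>.\<close>
  have n_def: "?n = canonical_iso U (fibre P \<iota>) (fibre P j) (inv_functor P (final_arrow i)) (inv_functor P f)
      (L (final_arrow i)) (L f) (L (final_arrow j)) (rho f) F"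
    unfolding inv_comp_iso_def Let_def final_arrow_Cmp[OF f] fi f' rho_def by (rule refl)
  note can = canonical_iso[OF fibre_category fibre_category fibre_category F ui
      inv_continuous[OF f'(1), unfolded f'(2,3)] uj L[OF fi(1), unfolded fi(2,3)] L[OF f'(1), unfolded f'(2,3)]
      L[OF fj(1), unfolded fj(2,3)], of "rho f", folded n_def, unfolded fobj_inv_functor fibre_simps]
  have rho_hom: "\<And>V. V \<in> Obj (tot P) \<and> fobj (proj P) V = \<iota> \<Longrightarrow>
      rho f V \<in> hom (fibre P j) (inv_obj P f (inv_obj P (final_arrow i) V)) (inv_obj P (final_arrow j) V)"
    using rho(1)[OF f] by simp
  note n = can(1)[OF rho_hom rho_natural[OF f]] and n_adj = can(2)[OF rho_hom rho_natural[OF f]]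
  have tr: "pullback_transition U P L \<iota> F f =
      (\<lambda>V\<in>Obj (fibre P i). \<lambda>s\<in>U (Sec (Fi i) V). ?n (inv_obj P f V) (adj (L f) (Fi i) V s))"
    unfolding pullback_transition_def Let_def pcomp_def f'(3)
    by (intro restrict_ext) (simp only: direct_mor_apply fobj_inv_functor)
  show "pullback_transition U P L \<iota> F f \<in> pmor U (fibre P i) (Fi i) (direct (inv_functor P f) (Fi j))"
    unfolding tr using pmor_whisker[OF fibre_category uf sheaf_presheaf[OF Fi_i] Lf_pmor n]
    by (simp only: fobj_inv_functor)
  fix V s assume V: "V \<in> Obj (fibre P \<iota>)" and s: "s \<in> U (Sec F V)"
  have "adj (L (final_arrow i)) F V s \<in> U (Sec (Fi i) (inv_obj P (final_arrow i) V))"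
    using pmor_in[OF adj_pmor V s] by simp
  then show "pullback_transition U P L \<iota> F f (inv_obj P (final_arrow i) V) (adj (L (final_arrow i)) F V s) =
      Res (Fi j) (rho f V) (adj (L (final_arrow j)) F V s)"
    using n_adj[of V s] V s inv_obj_final_arrow(1)[OF ij(1) V] unfolding tr
    by (simp only: restrict_apply' fibre_simps)
qed

text \<open>The fibrewise isomorphisms with \<open>H\<close> are compatible with the transition
  morphisms, so together they form a natural bijection on all of \<open>E\<close>, along which the
  sheaf condition is transported. The last clause uses the adjunction morphism for an identity arrow
  because \<open>final_arrow \<iota>\<close> is one.\<close>

lemma pullback_presheaf_iso:
  obtains \<phi> where "sheaf U (coevanescent_site P) (pullback_presheaf U P L \<iota> F)"
    and "piso U (coevanescent_site P) (pullback_presheaf U P L \<iota> F) H \<phi>"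
    and "\<And>V s. V \<in> Obj (fibre P \<iota>) \<Longrightarrow> s \<in> U (Sec F V) \<Longrightarrow> \<phi> V (adj (L (Ide (base P) \<iota>)) F V s) = \<alpha> V s"
proof -
  let ?\<Phi> = "pullback_presheaf U P L \<iota> F" and ?\<gamma> = "pullback_transition U P L \<iota> F"
  have "\<exists>a. i \<in> Obj (base P) \<longrightarrow> piso U (fibre P i) (Fi i) H a \<and>
    (\<forall>V\<in>Obj (fibre P \<iota>). \<forall>s\<in>U (Sec F V).
       a (inv_obj P (final_arrow i) V) (adj (L (final_arrow i)) F V s) = \<alpha>i i V s)" for i
    using Fi_iso_H by blast
  then obtain a where a_iso: "\<And>i. i \<in> Obj (base P) \<Longrightarrow> piso U (fibre P i) (Fi i) H (a i)"
    and a_adj: "\<And>i V s. i \<in> Obj (base P) \<Longrightarrow> V \<in> Obj (fibre P \<iota>) \<Longrightarrow> s \<in> U (Sec F V) \<Longrightarrow>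
       a i (inv_obj P (final_arrow i) V) (adj (L (final_arrow i)) F V s) = \<alpha>i i V s"
    by metis
  note a = piso_pmor[OF a_iso]
  note Fi_sheaf = universal_arrow_sheaf[OF Fi_universal]
  have proj_Obj: "fobj (proj P) V \<in> Obj (base P)" if "V \<in> Obj (tot P)" for V
    by (rule functor_Obj[OF proj_functor that])
  have Sec_\<Phi>: "Sec ?\<Phi> V = Sec (Fi (fobj (proj P) V)) V" for V
    by (simp add: pullback_presheaf_def glue_def)
  have Res_\<Phi>: "Res ?\<Phi> m s = Res (Fi (Dom (base P) (farr (proj P) m)))
      (vert P (farr (proj P) m) (Cod (tot P) m) m) (?\<gamma> (farr (proj P) m) (Cod (tot P) m) s)" for m s
    by (simp add: pullback_presheaf_def glue_def Let_def)
  have a_\<gamma>: "a j (inv_obj P f V) (?\<gamma> f V s) = Res H (lift P f V) (a i V s)"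
    if f: "f \<in> hom (base P) j i" and V: "V \<in> Obj (fibre P i)" and s: "s \<in> U (Sec (Fi i) V)" for f i j V s
  proof -
    have f': "f \<in> Arr (base P)" "Dom (base P) f = j" "Cod (base P) f = i"
      using f by (simp_all add: hom_iff)
    have ij: "i \<in> Obj (base P)" "j \<in> Obj (base P)"
      using f' B_cat by auto
    note uf = inv_is_functor[OF f'(1), unfolded f'(2,3)]
    note Fi_pre = sheaf_presheaf[OF Fi_sheaf[OF ij(1)]]
    note adj_pmor = universal_arrow_pmor[OF Fi_universal]
    note lH = lift_pmor[OF f'(1) H_presheaf, unfolded f'(2,3)]
    let ?lH = "\<lambda>V\<in>Obj (fibre P i). \<lambda>s\<in>U (Sec H V). Res H (lift P f V) s"
    let ?p = "\<lambda>V\<in>Obj (fibre P i). \<lambda>s\<in>U (Sec (Fi i) V). a j (fobj (inv_functor P f) V) (?\<gamma> f V s)"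
      and ?q = "pcomp U (fibre P i) (Fi i) ?lH (a i)"
    \<comment> \<open>Both are morphisms from \<open>Fi i\<close>, hence comparable on sections
      coming from \<open>F\<close>; there \<open>transition\<close> computes the left side and
      \<open>Res_rho\<close> gives the equality.\<close>
    have "?p = ?q"
    proof (rule universal_arrow_eqI[OF Fi_universal[OF ij(1)]])
      show "sheaf U (fibre P i) (direct (inv_functor P f) H)"
        using direct_inv_sheaf[OF f'(1) fibre_sheaf[OF H_sheaf], unfolded f'(3)] .
      show "?p \<in> pmor U (fibre P i) (Fi i) (direct (inv_functor P f) H)"
        by (rule pmor_whisker[OF fibre_category uf Fi_pre transition(1)[OF f] a[OF ij(2)]])
      show "?q \<in> pmor U (fibre P i) (Fi i) (direct (inv_functor P f) H)"
        by (rule pcomp_pmor[OF fibre_category Fi_pre a[OF ij(1)] lH])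
      fix V s assume V: "V \<in> Obj (fibre P \<iota>)" and s: "s \<in> U (Sec F V)"
      let ?V = "inv_obj P (final_arrow i) V" and ?s = "adj (L (final_arrow i)) F V s"
      have iV: "?V \<in> Obj (fibre P i)"
        by (rule inv_obj_final_arrow(1)[OF ij(1) V])
      have s_in: "?s \<in> U (Sec (Fi i) ?V)"
        "adj (L (final_arrow j)) F V s \<in> U (Sec (Fi j) (inv_obj P (final_arrow j) V))"
        using pmor_in[OF adj_pmor[OF ij(1)] V s] pmor_in[OF adj_pmor[OF ij(2)] V s] by simp_all
      have "?p ?V ?s = a j (inv_obj P f ?V) (Res (Fi j) (rho f V) (adj (L (final_arrow j)) F V s))"
        using iV s_in(1) transition(2)[OF f V s] by (simp only: restrict_apply' fobj_inv_functor)
      also have "\<dots> = Res H (rho f V) (\<alpha>i j V s)"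
        using pmor_Res[OF a[OF ij(2)] rho(1)[OF f V] s_in(2)] a_adj[OF ij(2) V s] by (simp only:)
      also have "\<dots> = Res H (lift P f ?V) (\<alpha>i i V s)"
        using Res_rho[OF f V H_presheaf pmor_in[OF \<alpha>_pmor V s]] by (simp only: \<alpha>i_apply[OF V s])
      also have "\<dots> = ?q ?V ?s"
        using iV s_in(1) pmor_in[OF a[OF ij(1)] iV s_in(1)] a_adj[OF ij(1) V s]
        by (simp only: pcomp_apply restrict_apply')
      finally show "?p (fobj (inv_functor P (final_arrow i)) V) ?s = ?q (fobj (inv_functor P (final_arrow i)) V) ?s"
        by (simp only: fobj_inv_functor)
    qed
    from fun_cong[OF fun_cong[OF this, of V], of s] show ?thesis
      using V s pmor_in[OF a[OF ij(1)] V s] by (simp only: pcomp_apply restrict_apply' fobj_inv_functor)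
  qed
  \<comment> \<open>\<open>glue\<close> acts along the factorization of \<open>m\<close> into a
    vertical arrow and a lift; naturality of the fibrewise isomorphism handles the first factor and
    \<open>a_\<gamma>\<close> the second.\<close>
  have Res_in_nat: "Res ?\<Phi> m s \<in> U (Sec ?\<Phi> W) \<and>
      a (fobj (proj P) W) W (Res ?\<Phi> m s) = Res H m (a (fobj (proj P) V) V s)"
    if m: "m \<in> hom (tot P) W V" and s: "s \<in> U (Sec ?\<Phi> V)" for m V W s
  proof -
    define f i j where "f = farr (proj P) m" and "i = fobj (proj P) V" and "j = fobj (proj P) W"
    have V: "V \<in> Obj (tot P)" and W: "W \<in> Obj (tot P)" and m_Cod: "Cod (tot P) m = V"
      using m E_cat by (auto simp: hom_iff)
    have f: "f \<in> hom (base P) j i"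
      using proj_hom[OF m] by (simp add: f_def i_def j_def)
    then have f': "f \<in> Arr (base P)" "Dom (base P) f = j" "Cod (base P) f = i"
      by (simp_all add: hom_iff)
    have ij: "i \<in> Obj (base P)" "j \<in> Obj (base P)"
      using f' B_cat by auto
    have V': "V \<in> Obj (fibre P i)" "fobj (proj P) V = Cod (base P) f"
      using V f' by (simp_all add: i_def)
    have s': "s \<in> U (Sec (Fi i) V)"
      using s by (simp add: Sec_\<Phi> i_def)
    note v = vert_hom[OF f'(1) V V'(2) m f_def[symmetric], unfolded f'(2)]
    have v': "vert P f V m \<in> hom (tot P) W (inv_obj P f V)"
      using v(1) unfolding fibre_hom_iff by simp
    note l = lift_hom[OF f'(1) V V'(2)]
    have \<gamma>s: "?\<gamma> f V s \<in> U (Sec (Fi j) (inv_obj P f V))"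
      using pmor_in[OF transition(1)[OF f] V'(1) s'] by simp
    have Res_m: "Res ?\<Phi> m s = Res (Fi j) (vert P f V m) (?\<gamma> f V s)"
      unfolding Res_\<Phi> m_Cod f_def[symmetric] f'(2) by (rule refl)
    have "Res (Fi j) (vert P f V m) (?\<gamma> f V s) \<in> U (Sec (Fi j) W)"
      by (rule Res_in[OF sheaf_presheaf[OF Fi_sheaf[OF ij(2)]] v(1) \<gamma>s])
    then have "Res ?\<Phi> m s \<in> U (Sec ?\<Phi> W)"
      by (simp only: Res_m Sec_\<Phi> j_def)
    moreover have "a j W (Res ?\<Phi> m s) = Res H m (a i V s)"
    proof -
      have "a j W (Res ?\<Phi> m s) = Res H (vert P f V m) (Res H (lift P f V) (a i V s))"
        unfolding Res_m pmor_Res[OF a[OF ij(2)] v(1) \<gamma>s] a_\<gamma>[OF f V'(1) s'] by (rule refl)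
      also have "\<dots> = Res H m (a i V s)"
        using Res_Cmp[OF H_presheaf v' l pmor_in[OF a[OF ij(1)] V'(1) s']] v(2) by simp
      finally show ?thesis .
    qed
    ultimately show ?thesis
      unfolding i_def j_def ..
  qed
  let ?a = "\<lambda>V s. a (fobj (proj P) V) V s"
  have bij: "bij_betw (?a V) (U (Sec ?\<Phi> V)) (U (Sec H V))" if "V \<in> Obj (tot P)" for V
    using pisoD[OF a_iso[OF proj_Obj[OF that]], of V] that unfolding Sec_\<Phi> by simp
  have \<Phi>: "sheaf U (coevanescent_site P) ?\<Phi>"
  proof (rule sheaf_transport[OF _ _ H_sheaf, where \<phi> = ?a])
    show "category (coevanescent_site P)"
      using E_cat by simp
    show "sieve (coevanescent_site P) V S" if "S \<in> Cov (coevanescent_site P) V" for V S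
      using coevanescent_sieve that by simp
    show "Res ?\<Phi> m s \<in> U (Sec ?\<Phi> W)" if "m \<in> hom (coevanescent_site P) W V" "s \<in> U (Sec ?\<Phi> V)" for m V W s
      using Res_in_nat that by simp
    show "bij_betw (?a V) (U (Sec ?\<Phi> V)) (U (Sec H V))" if "V \<in> Obj (coevanescent_site P)" for V
      using bij that by simp
    show "?a W (Res ?\<Phi> m s) = Res H m (?a V s)"
      if "m \<in> hom (coevanescent_site P) W V" "s \<in> U (Sec ?\<Phi> V)" for m V W s
      using Res_in_nat that by (simp del: Res_direct)
  qed
  have E: "category (coevanescent_site P)"
    using E_cat by simp
  let ?\<phi> = "\<lambda>V\<in>Obj (coevanescent_site P). \<lambda>s\<in>U (Sec ?\<Phi> V). ?a V s"
  have "?\<phi> \<in> pmor U (coevanescent_site P) ?\<Phi> H"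
  proof (rule pmorI[OF _ _ E sheaf_presheaf[OF \<Phi>]])
    show "?a V s \<in> U (Sec H V)" if "V \<in> Obj (coevanescent_site P)" "s \<in> U (Sec ?\<Phi> V)" for V s
      using bij[of V] that unfolding bij_betw_def by auto
    show "?a W (Res ?\<Phi> m s) = Res H m (?a V s)"
      if "m \<in> hom (coevanescent_site P) W V" "s \<in> U (Sec ?\<Phi> V)" for m V W s
      using Res_in_nat that by (simp del: Res_direct)
  qed
  moreover have "bij_betw (?\<phi> V) (U (Sec ?\<Phi> V)) (U (Sec H V))" if "V \<in> Obj (coevanescent_site P)" for V
  proof -
    have "bij_betw (?\<phi> V) (U (Sec ?\<Phi> V)) (U (Sec H V)) = bij_betw (?a V) (U (Sec ?\<Phi> V)) (U (Sec H V))"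
      by (rule bij_betw_cong) (use that in \<open>simp only: restrict_apply'\<close>)
    then show ?thesis
      using bij that by simp
  qed
  ultimately have iso: "piso U (coevanescent_site P) ?\<Phi> H ?\<phi>"
    using piso_iff[OF E sheaf_presheaf[OF \<Phi>] sheaf_presheaf[OF H_sheaf]] by blast
  have "?\<phi> V (adj (L (Ide (base P) \<iota>)) F V s) = \<alpha> V s"
    if V: "V \<in> Obj (fibre P \<iota>)" and s: "s \<in> U (Sec F V)" for V s
  proof -
    have V': "V \<in> Obj (coevanescent_site P)" "fobj (proj P) V = \<iota>"
      using V by simp_all
    have "adj (L (final_arrow \<iota>)) F V s \<in> U (Sec (Fi \<iota>) V)"
      using pmor_in[OF universal_arrow_pmor[OF Fi_universal[OF \<iota>_Obj]] V s] \<alpha>i_\<iota>(1)[OF V s] by simp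
    then have "adj (L (final_arrow \<iota>)) F V s \<in> U (Sec ?\<Phi> V)"
      by (simp only: Sec_\<Phi> V'(2))
    then show ?thesis
      unfolding final_arrow_\<iota>[symmetric]
      using V' a_adj[OF \<iota>_Obj V s] \<alpha>i_\<iota>[OF V s] by (simp only: restrict_apply')
  qed
  then show thesis
    by (rule that[OF \<Phi> iso])
qed

lemma beta_star_iso_H:
  assumes L\<beta>: "inverse_image U (fibre P \<iota>) (coevanescent_site P) fibre_inclusion L\<beta>"
  obtains \<theta> where "piso U (coevanescent_site P) (star L\<beta> F) H \<theta>"
    and "\<And>V s. V \<in> Obj (fibre P \<iota>) \<Longrightarrow> s \<in> U (Sec F V) \<Longrightarrow> \<theta> V (adj L\<beta> F V s) = \<alpha> V s"
proof -
  have E: "category (coevanescent_site P)"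
    using E_cat by simp
  note LU = inverse_image_universal_arrow[OF fibre_category fibre_inclusion_functor L\<beta> F]
  show thesis
    by (rule universal_arrow_unique_iso[OF fibre_category E F_presheaf fibre_inclusion_functor LU
          H_universal, unfolded fobj_fibre_inclusion]) (rule that)
qed

lemma pullback_presheaf_inverse_image:
  assumes L\<beta>: "inverse_image U (fibre P \<iota>) (coevanescent_site P) fibre_inclusion L\<beta>"
  shows "sheaf U (coevanescent_site P) (pullback_presheaf U P L \<iota> F) \<and>
    (\<exists>\<phi>. piso U (coevanescent_site P) (star L\<beta> F) (pullback_presheaf U P L \<iota> F) \<phi> \<and>
       pcomp U (fibre P \<iota>) F (direct_mor (fibre P \<iota>) fibre_inclusion \<phi>) (adj L\<beta> F) =
       adj (L (Ide (base P) \<iota>)) F)"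
proof -
  let ?\<Phi> = "pullback_presheaf U P L \<iota> F" and ?adj = "adj (L (Ide (base P) \<iota>)) F"
  have E: "category (coevanescent_site P)"
    using E_cat by simp
  note LU = inverse_image_universal_arrow[OF fibre_category fibre_inclusion_functor L\<beta> F]
  obtain \<phi> where \<Phi>: "sheaf U (coevanescent_site P) ?\<Phi>"
    and \<phi>: "piso U (coevanescent_site P) ?\<Phi> H \<phi>"
    and \<phi>_adj: "\<And>V s. V \<in> Obj (fibre P \<iota>) \<Longrightarrow> s \<in> U (Sec F V) \<Longrightarrow> \<phi> V (?adj V s) = \<alpha> V s"
    by (rule pullback_presheaf_iso) (rule that)
  note \<Phi>_pre = sheaf_presheaf[OF \<Phi>] and H_pre = sheaf_presheaf[OF H_sheaf]
    and L_pre = sheaf_presheaf[OF universal_arrow_sheaf[OF LU]]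
  obtain \<psi> where \<psi>: "piso U (coevanescent_site P) H ?\<Phi> \<psi>"
    and \<psi>\<phi>: "\<And>V s. V \<in> Obj (coevanescent_site P) \<Longrightarrow> s \<in> U (Sec ?\<Phi> V) \<Longrightarrow> \<psi> V (\<phi> V s) = s"
    by (rule piso_inverse[OF \<phi> E \<Phi>_pre H_pre]) (rule that)
  obtain \<theta> where \<theta>: "piso U (coevanescent_site P) (star L\<beta> F) H \<theta>"
    and \<theta>_adj: "\<And>V s. V \<in> Obj (fibre P \<iota>) \<Longrightarrow> s \<in> U (Sec F V) \<Longrightarrow> \<theta> V (adj L\<beta> F V s) = \<alpha> V s"
    by (rule beta_star_iso_H[OF L\<beta>]) (rule that)
  \<comment> \<open>Both \<phi> and \<theta> take an adjunction morphism to \<alpha>, so the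
    composite through \<open>H\<close> is compatible with the two adjunction morphisms.\<close>
  let ?\<kappa> = "pcomp U (coevanescent_site P) (star L\<beta> F) \<psi> \<theta>"
  have "piso U (coevanescent_site P) (star L\<beta> F) ?\<Phi> ?\<kappa>"
    by (rule piso_pcomp[OF E L_pre H_pre \<Phi>_pre \<theta> \<psi>])
  moreover have "pcomp U (fibre P \<iota>) F (direct_mor (fibre P \<iota>) fibre_inclusion ?\<kappa>) (adj L\<beta> F) = ?adj"
  proof (rule pcomp_eqI)
    note adj = universal_arrow_pmor[OF Fi_universal[OF \<iota>_Obj], unfolded final_arrow_\<iota>]
    show "?adj \<in> pmor U (fibre P \<iota>) F (direct (inv_functor P (Ide (base P) \<iota>)) (star (L (Ide (base P) \<iota>)) F))"
      by (rule adj)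
    fix V s assume V: "V \<in> Obj (fibre P \<iota>)" and s: "s \<in> U (Sec F V)"
    have V': "V \<in> Obj (coevanescent_site P)" "fobj (proj P) V = \<iota>"
      using V by simp_all
    have adj_L: "adj L\<beta> F V s \<in> U (Sec (star L\<beta> F) V)"
      using pmor_in[OF universal_arrow_pmor[OF LU] V s] by simp
    have "?adj V s \<in> U (Sec ?\<Phi> V)"
      using pmor_in[OF adj V s] \<alpha>i_\<iota>(1)[OF V s] V'(2)
      by (simp add: pullback_presheaf_def glue_def final_arrow_\<iota>)
    then have "\<psi> V (\<alpha> V s) = ?adj V s"
      using \<psi>\<phi>[OF V'(1)] \<phi>_adj[OF V s] by metis
    then show "direct_mor (fibre P \<iota>) fibre_inclusion ?\<kappa> V (adj L\<beta> F V s) = ?adj V s"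
      using \<theta>_adj[OF V s] V V'(1) adj_L by (simp only: direct_mor_apply fobj_fibre_inclusion pcomp_apply)
  qed
  ultimately show ?thesis
    using \<Phi> by blast
qed

text \<open>Over the fibre of \<iota>, \<alpha> is \<theta> after the adjunction morphism; as
  \<alpha> and \<theta> are bijective, so is the adjunction morphism.\<close>

lemma adj_beta_iso:
  assumes L\<beta>: "inverse_image U (fibre P \<iota>) (coevanescent_site P) fibre_inclusion L\<beta>"
  shows "piso U (fibre P \<iota>) F (direct fibre_inclusion (star L\<beta> F)) (adj L\<beta> F)"
proof -
  have E: "category (coevanescent_site P)"
    using E_cat by simp
  note LU = inverse_image_universal_arrow[OF fibre_category fibre_inclusion_functor L\<beta> F]
  obtain \<theta> where \<theta>: "piso U (coevanescent_site P) (star L\<beta> F) H \<theta>"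
    and \<theta>_adj: "\<And>V s. V \<in> Obj (fibre P \<iota>) \<Longrightarrow> s \<in> U (Sec F V) \<Longrightarrow> \<theta> V (adj L\<beta> F V s) = \<alpha> V s"
    by (rule beta_star_iso_H[OF L\<beta>]) (rule that)
  note adj = universal_arrow_pmor[OF LU, unfolded direct_fibre_inclusion]
  have "bij_betw (adj L\<beta> F V) (U (Sec F V)) (U (Sec (star L\<beta> F) V))" if V: "V \<in> Obj (fibre P \<iota>)" for V
  proof -
    have "bij_betw (\<theta> V) (U (Sec (star L\<beta> F) V)) (U (Sec H V))"
      using pisoD[OF \<theta>, of V] V by simp
    moreover have "bij_betw (\<theta> V \<circ> adj L\<beta> F V) (U (Sec F V)) (U (Sec H V)) =
        bij_betw (\<alpha> V) (U (Sec F V)) (U (Sec H V))"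
      by (rule bij_betw_cong) (use \<theta>_adj[OF V] in simp)
    moreover have "adj L\<beta> F V ` U (Sec F V) \<subseteq> U (Sec (star L\<beta> F) V)"
      using pmor_in[OF adj V] by blast
    ultimately show ?thesis
      using pisoD[OF \<alpha>_iso V] bij_betw_comp_iff2 by blast
  qed
  then show ?thesis
    using piso_iff[OF fibre_category F_presheaf sheaf_presheaf[OF fibre_sheaf[OF universal_arrow_sheaf[OF LU]]]]
      adj unfolding direct_fibre_inclusion by blast
qed

text \<open>The comparison morphism and the isomorphism \<theta> both take the adjunction morphism
  of \<open>F\<close> to \<alpha>, so they coincide by the universal property of
  \<open>star L\<beta> F\<close>.\<close>

lemma beta_Psi_iso:
  assumes L\<beta>: "inverse_image U (fibre P \<iota>) (coevanescent_site P) fibre_inclusion L\<beta>"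
    and L\<Psi>: "inverse_image U (coevanescent_site P) X \<Psi> L\<Psi>"
  shows "piso U (coevanescent_site P) (star L\<beta> F) H (beta_Psi_mor U P X \<Psi> \<iota> L\<beta> L\<Psi> L\<Psi>\<iota> F)"
proof -
  have E: "category (coevanescent_site P)"
    using E_cat by simp
  note LU = inverse_image_universal_arrow[OF fibre_category fibre_inclusion_functor L\<beta> F]
  note \<Psi>U = inverse_image_universal_arrow[OF E \<Psi>_functor L\<Psi> universal_arrow_sheaf[OF LU]]
  note L_pre = sheaf_presheaf[OF universal_arrow_sheaf[OF LU]]
  obtain \<theta> where \<theta>: "piso U (coevanescent_site P) (star L\<beta> F) H \<theta>"
    and \<theta>_adj: "\<And>V s. V \<in> Obj (fibre P \<iota>) \<Longrightarrow> s \<in> U (Sec F V) \<Longrightarrow> \<theta> V (adj L\<beta> F V s) = \<alpha> V s"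
    by (rule beta_star_iso_H[OF L\<beta>]) (rule that)
  let ?n = "canonical_iso U (fibre P \<iota>) X fibre_inclusion \<Psi> L\<beta> L\<Psi> L\<Psi>\<iota> (\<lambda>V. Ide X (fobj \<Psi> V)) F"
  let ?M = "beta_Psi_mor U P X \<Psi> \<iota> L\<beta> L\<Psi> L\<Psi>\<iota> F"
  have \<Psi>V: "fobj \<Psi> V \<in> Obj X" if "V \<in> Obj (fibre P \<iota>)" for V
    using functor_Obj[OF \<Psi>_functor] that by simp
  have \<rho>: "Ide X (fobj \<Psi> V) \<in> hom X (fobj \<Psi> (fobj fibre_inclusion V)) (fobj (fcomp \<Psi> fibre_inclusion) V)"
    if "V \<in> Obj (fibre P \<iota>)" for V
    using Ide_in_hom[OF X_cat \<Psi>V[OF that]] by simp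
  have \<rho>_nat: "Cmp X (Ide X (fobj \<Psi> W)) (farr \<Psi> (farr fibre_inclusion k)) =
      Cmp X (farr (fcomp \<Psi> fibre_inclusion) k) (Ide X (fobj \<Psi> V))" if k: "k \<in> hom (fibre P \<iota>) V W" for k V W
  proof -
    have "farr \<Psi> k \<in> hom X (fobj \<Psi> V) (fobj \<Psi> W)"
      using \<Psi>_hom k unfolding fibre_hom_iff by blast
    then show ?thesis
      using X_cat by (simp add: hom_iff)
  qed
  note can = canonical_iso[OF fibre_category E X_cat F fibre_inclusion_functor \<Psi>
      functor_fcomp[OF fibre_inclusion_functor \<Psi>_functor] L\<beta> L\<Psi> L\<Psi>\<iota> \<rho> \<rho>_nat]
  have M_eq: "?M = (\<lambda>V\<in>Obj (coevanescent_site P). \<lambda>s\<in>U (Sec (star L\<beta> F) V).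
      ?n (fobj \<Psi> V) (adj L\<Psi> (star L\<beta> F) V s))"
    unfolding beta_Psi_mor_def Let_def pcomp_def by (intro restrict_ext) (simp only: direct_mor_apply)
  have M: "?M \<in> pmor U (coevanescent_site P) (star L\<beta> F) H"
    unfolding M_eq by (rule pmor_whisker[OF E \<Psi>_functor L_pre universal_arrow_pmor[OF \<Psi>U] can(1)])
  have "?M = \<theta>"
  proof (rule universal_arrow_eqI[OF LU H_sheaf M piso_pmor[OF \<theta>]])
    fix V s assume V: "V \<in> Obj (fibre P \<iota>)" and s: "s \<in> U (Sec F V)"
    have V': "V \<in> Obj (coevanescent_site P)"
      using V by simp
    have adj_L: "adj L\<beta> F V s \<in> U (Sec (star L\<beta> F) V)"
      using pmor_in[OF universal_arrow_pmor[OF LU] V s] by simp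
    have \<alpha>s: "\<alpha> V s \<in> U (Sec G (fobj \<Psi> V))"
      using pmor_in[OF \<alpha>_pmor V s] by simp
    have "?M V (adj L\<beta> F V s) = ?n (fobj \<Psi> V) (adj L\<Psi> (star L\<beta> F) V (adj L\<beta> F V s))"
      unfolding M_eq using V' adj_L by (simp only: restrict_apply')
    also have "\<dots> = Res G (Ide X (fobj \<Psi> V)) (\<alpha> V s)"
      using can(2)[OF _ _ V s] by simp
    also have "\<dots> = \<alpha> V s"
      by (rule Res_Ide[OF sheaf_presheaf[OF universal_arrow_sheaf[OF G_universal]] \<Psi>V[OF V] \<alpha>s])
    finally have "?M V (adj L\<beta> F V s) = \<theta> V (adj L\<beta> F V s)"
      using \<theta>_adj[OF V s] by simp
    then show "?M (fobj (fibre_inclusion :: ('o, 'a, 'o, 'a) fctr) V) (adj L\<beta> F V s) =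
        \<theta> (fobj (fibre_inclusion :: ('o, 'a, 'o, 'a) fctr) V) (adj L\<beta> F V s)"
      by simp
  qed
  then show ?thesis
    using \<theta> by simp
qed

end

text \<open>The inverse images \<open>L\<close> and \<open>L\<beta>\<close> are arbitrary choices,
  so the first assertion describes \<open>star L\<beta> F\<close> up to isomorphism; compatibility
  with the adjunction morphisms fixes that isomorphism uniquely.\<close>

theorem proposition6p3:
  fixes U :: "'u \<Rightarrow> 'u set"
    and P :: "('o, 'a, 'i, 'f) fibred"
    and \<iota> :: 'i and e :: 'o
    and X :: "('x, 'y) site"
    and \<Psi> :: "('o, 'a, 'x, 'y) fctr"
    and L :: "'f \<Rightarrow> ('o, 'a, 'o, 'a, 'u) inv_im"
    and L\<beta> :: "('o, 'a, 'o, 'a, 'u) inv_im"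
    and L\<Psi> L\<Psi>\<iota> :: "('o, 'a, 'x, 'y, 'u) inv_im"
    and L\<Psi>i :: "'i \<Rightarrow> ('o, 'a, 'y, 'y \<times> 'y \<times> 'y, 'u) inv_im"
  assumes "universe U"
    and "fibred_site U P"
    and "final_obj (base P) \<iota>"
    and "final_obj (fibre P \<iota>) e"
    and "U_site U X"
    and "continuous_functor U (coevanescent_site P) X \<Psi>"
    and "left_exact (coevanescent_site P) X \<Psi>"
    \<comment> \<open>the inverse image functors \<open>f\<^sup>*\<close>, \<open>\<beta>\<^sup>*\<close>, \<open>\<Psi>\<^sup>*\<close>, \<open>\<Psi>\<^sub>\<iota>\<^sup>*\<close> (with \<open>\<Psi>\<^sub>\<iota> = \<beta>\<Psi>\<close>) and \<open>\<Psi>\<^sub>i\<^sup>*\<close>\<close>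
    and "\<And>f. f \<in> Arr (base P) \<Longrightarrow>
           inverse_image U (fibre P (Cod (base P) f)) (fibre P (Dom (base P) f)) (inv_functor P f) (L f)"
    and "inverse_image U (fibre P \<iota>) (coevanescent_site P) fibre_inclusion L\<beta>"
    and "inverse_image U (coevanescent_site P) X \<Psi> L\<Psi>"
    and "inverse_image U (fibre P \<iota>) X (fcomp \<Psi> fibre_inclusion) L\<Psi>\<iota>"
    and "\<And>i. i \<in> Obj (base P) \<Longrightarrow>
           inverse_image U (fibre P i) (slice X (u_obj P \<Psi> \<iota> e i)) (Psi_at P \<Psi> \<iota> e i) (L\<Psi>i i)"
    \<comment> \<open>the adjunction morphism \<open>id \<rightarrow> \<Psi>\<^sub>i\<^sub>*\<Psi>\<^sub>i\<^sup>*\<close> is an isomorphism\<close>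
    and "\<And>i F. i \<in> Obj (base P) \<Longrightarrow> sheaf U (fibre P i) F \<Longrightarrow>
           piso U (fibre P i) F (direct (Psi_at P \<Psi> \<iota> e i) (star (L\<Psi>i i) F)) (adj (L\<Psi>i i) F)"
  shows "(\<forall>F. sheaf U (fibre P \<iota>) F \<longrightarrow>
            sheaf U (coevanescent_site P) (pullback_presheaf U P L \<iota> F) \<and>
            (\<exists>\<phi>. piso U (coevanescent_site P) (star L\<beta> F) (pullback_presheaf U P L \<iota> F) \<phi> \<and>
                 pcomp U (fibre P \<iota>) F (direct_mor (fibre P \<iota>) fibre_inclusion \<phi>) (adj L\<beta> F) =
                 adj (L (Ide (base P) \<iota>)) F)) \<and>
         (\<forall>F. sheaf U (fibre P \<iota>) F \<longrightarrow>
            piso U (fibre P \<iota>) F (direct fibre_inclusion (star L\<beta> F)) (adj L\<beta> F)) \<and>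
         (\<forall>F. sheaf U (fibre P \<iota>) F \<longrightarrow>
            piso U (coevanescent_site P) (star L\<beta> F) (direct \<Psi> (star L\<Psi>\<iota> F))
              (beta_Psi_mor U P X \<Psi> \<iota> L\<beta> L\<Psi> L\<Psi>\<iota> F))"
proof -
  have fib: "cleaved_normalized_fibration P"
    using assms(2) by (simp add: fibred_site_def)
  have *: "comparison_sheaf P U \<iota> e X \<Psi> L L\<Psi>\<iota> L\<Psi>i F" if "sheaf U (fibre P \<iota>) F" for F
    by unfold_locales (fact fib assms that)+
  show ?thesis
    by (intro conjI allI impI comparison_sheaf.pullback_presheaf_inverse_image[OF * assms(9)]
        comparison_sheaf.adj_beta_iso[OF * assms(9)]
        comparison_sheaf.beta_Psi_iso[OF * assms(9,10)])
qed

end
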